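(* Let $N\geq 2$, $1<p<N$ and $\alpha>0$. Then the problem $-\Delta_p u=|x|^{\alpha}u^{p^*_\alpha-1}$, $u>0$ in $\mathbb{R}^N$, has in $D^{1,p}(\mathbb{R}^N)$ a unique (up to scalings) radial nontrivial solution, and it is of the form $U_{\lambda,\alpha}$ for some $\lambda>0$, where $$U_{\lambda,\alpha}(x)=\frac{C_{N,p,\alpha}\lambda^{\frac{N-p}{p}}}{\big(1+\lambda^{\frac{p+\alpha}{p-1}}|x|^{\frac{p+\alpha}{p-1}}\big)^{\frac{N-p}{p+\alpha}}},\qquad C_{N,p,\alpha}=\Big((N+\alpha)\Big(\frac{N-p}{p-1}\Big)^{p-1}\Big)^{\frac{N-p}{p(p+\alpha)}}.$$
   Context: $\Delta_p u=\mathrm{div}(|\nabla u|^{p-2}\nabla u)$, $p^*_\alpha=\frac{p(N+\alpha)}{N-p}$, $D^{1,p}(\mathbb{R}^N)$ is the completion of $C_c^\infty(\mathbb{R}^N)$ under $\|\nabla u\|_{L^p(\mathbb{R}^N)}$, and solutions are weak solutions. Scaling refers to $u\mapsto \lambda^{\frac{N-p}{p}}u(\lambda\,\cdot)$, $\lambda>0$. *)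

theory Defs
  imports "HOL-Analysis.Analysis"
begin

text \<open>C-infinity: a family D of iterated partial derivatives indexed by lists of
basis directions, D [] = f, every D ds is (Frechet) differentiable everywhere,
with partial derivative in direction b equal to D (b # ds).\<close>
definition smooth_fun :: "('a::euclidean_space \<Rightarrow> real) \<Rightarrow> bool" where
  "smooth_fun f \<longleftrightarrow> (\<exists>D :: 'a list \<Rightarrow> 'a \<Rightarrow> real. D [] = f \<and>
     (\<forall>ds x. (D ds has_derivative (\<lambda>h. \<Sum>b\<in>Basis. (h \<bullet> b) * D (b # ds) x)) (at x)))"

definition test_fun :: "('a::euclidean_space \<Rightarrow> real) \<Rightarrow> bool" where
  "test_fun f \<longleftrightarrow> smooth_fun f \<and> bounded {x. f x \<noteq> 0}"

definition grad :: "('a::euclidean_space \<Rightarrow> real) \<Rightarrow> 'a \<Rightarrow> 'a" where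
  "grad f x = (\<Sum>b\<in>Basis. frechet_derivative f (at x) b *\<^sub>R b)"

definition sob_exp :: "'a::euclidean_space itself \<Rightarrow> real \<Rightarrow> real" where
  "sob_exp _ p = real DIM('a) * p / (real DIM('a) - p)"

definition crit_exp :: "'a::euclidean_space itself \<Rightarrow> real \<Rightarrow> real \<Rightarrow> real" where
  "crit_exp _ p \<alpha> = p * (real DIM('a) + \<alpha>) / (real DIM('a) - p)"

text \<open>u belongs to D^{1,p}(R^N) (completion of C_c^infinity under the L^p norm of the
gradient, realised as functions via the Sobolev embedding into L^{p*}) with
(weak) gradient g: some sequence of test functions has gradients converging to g
in L^p and converges to u in L^{p*}.\<close>
definition D1p_grad :: "real \<Rightarrow> ('a::euclidean_space \<Rightarrow> real) \<Rightarrow> ('a \<Rightarrow> 'a) \<Rightarrow> bool" where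
  "D1p_grad p u g \<longleftrightarrow>
     u \<in> borel_measurable lborel \<and> g \<in> borel_measurable lborel \<and>
     (\<integral>\<^sup>+ x. ennreal (norm (g x) powr p) \<partial>lborel) < \<infinity> \<and>
     (\<exists>\<phi> :: nat \<Rightarrow> 'a \<Rightarrow> real. (\<forall>k. test_fun (\<phi> k)) \<and>
        ((\<lambda>k. \<integral>\<^sup>+ x. ennreal (norm (grad (\<phi> k) x - g x) powr p) \<partial>lborel) \<longlonglongrightarrow> 0) \<and>
        ((\<lambda>k. \<integral>\<^sup>+ x. ennreal (\<bar>\<phi> k x - u x\<bar> powr sob_exp TYPE('a) p) \<partial>lborel) \<longlonglongrightarrow> 0))"

definition in_D1p :: "real \<Rightarrow> ('a::euclidean_space \<Rightarrow> real) \<Rightarrow> bool" where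
  "in_D1p p u \<longleftrightarrow> (\<exists>g. D1p_grad p u g)"

definition weak_solution :: "real \<Rightarrow> real \<Rightarrow> ('a::euclidean_space \<Rightarrow> real) \<Rightarrow> bool" where
  "weak_solution p \<alpha> u \<longleftrightarrow> (\<exists>g. D1p_grad p u g \<and>
     (\<forall>\<phi>. test_fun \<phi> \<longrightarrow>
        integrable lborel (\<lambda>x. norm (g x) powr (p - 2) * (g x \<bullet> grad \<phi> x)) \<and>
        integrable lborel (\<lambda>x. norm x powr \<alpha> * u x powr (crit_exp TYPE('a) p \<alpha> - 1) * \<phi> x) \<and>
        (\<integral>x. norm (g x) powr (p - 2) * (g x \<bullet> grad \<phi> x) \<partial>lborel) =
        (\<integral>x. norm x powr \<alpha> * u x powr (crit_exp TYPE('a) p \<alpha> - 1) * \<phi> x \<partial>lborel)))"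

definition radial :: "('a::euclidean_space \<Rightarrow> real) \<Rightarrow> bool" where
  "radial u \<longleftrightarrow> (\<exists>v. AE x in lborel. u x = v (norm x))"

definition C_const :: "real \<Rightarrow> real \<Rightarrow> real \<Rightarrow> real" where
  "C_const N p \<alpha> = ((N + \<alpha>) * ((N - p) / (p - 1)) powr (p - 1)) powr ((N - p) / (p * (p + \<alpha>)))"

definition U_fun :: "real \<Rightarrow> real \<Rightarrow> real \<Rightarrow> 'a::euclidean_space \<Rightarrow> real" where
  "U_fun p \<alpha> l x = C_const (real DIM('a)) p \<alpha> * l powr ((real DIM('a) - p) / p) /
     (1 + l powr ((p + \<alpha>) / (p - 1)) * norm x powr ((p + \<alpha>) / (p - 1)))
        powr ((real DIM('a) - p) / (p + \<alpha>))"

end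

theory Submission
  imports Defs "HOL-Computational_Algebra.Polynomial"
begin

text \<open>Existence: the field \<open>|\<nabla>U|\<^bsup>p-2\<^esup> \<nabla>U\<close> of a bubble is explicit and continuously differentiable, so the
  equation is an integration by parts, and regularised, cut-off bubbles show that \<open>U\<close> lies in the
  energy space.

  Uniqueness: write \<open>u = V(|x|)\<close> with \<open>V\<close> continuous, and let \<open>m(r)\<close> be the (normalised) integral of
  \<open>|x|\<^sup>\<alpha> u\<^bsup>q-1\<^esup>\<close> over the ball of radius \<open>r\<close>. Radial test functions determine the spherical mean of
  the radial part of \<open>|g|\<^bsup>p-2\<^esup> g\<close>; testing with \<open>u\<close> itself and using the strict monotonicity of the
  p-Laplacian this forces \<open>g = V'(|x|) x/|x|\<close> with \<open>V' = - (m r\<^bsup>1-N\<^esup>)\<^bsup>1/(p-1)\<^esup>\<close>. The Pohozaev quantity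
  of this system is constant, and it vanishes because \<open>u\<close> lies in \<open>L\<^bsup>p*\<^esup>\<close>. Its vanishing says exactly
  that \<open>m r\<^bsup>-(N+\<alpha>)\<^esup> V\<^bsup>-(N+\<alpha>)(p-1)/(N-p)\<^esup>\<close> is constant, and then a negative power of \<open>V\<close> is affine in
  \<open>r\<^bsup>(p+\<alpha>)/(p-1)\<^esup>\<close>.\<close>

section \<open>Smooth functions\<close>

text \<open>The obstacle is the lack of regularity: \<open>u\<close> is a function modulo null sets,
  its profile is arbitrary, and \<open>g\<close> is an L^p field not known to be radial, so neither
  the differential equation nor traces on spheres are available at the start. All radial information
  is therefore carried by integrals over balls, and a relation between spherical means is expressed
  by the vanishing of such integrals for every radius. The radial part of the flux is thus known
  only in the mean. Comparing \<open>g\<close> with the candidate field -\<beta>(|x|) x/|x|, whose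
  flux has exactly this mean, gives a nonnegative integrand with weighted integral zero; the weight
  lives on an annulus, and the terms with its derivative cancel because \<open>u\<close> is radial.
  So the origin, where the profile might be singular, is never touched in this argument. It enters
  only through monotonicity: a decreasing profile with the Sobolev integrability satisfies V =
  o(r^{-(N-p)/p}), which kills the Pohozaev constant and excludes the fundamental solution of the
  p-Laplacian.\<close>

inductive smooth_closure :: "('a::euclidean_space \<Rightarrow> real) \<Rightarrow> bool" where
  base: "smooth_fun f \<Longrightarrow> smooth_closure f"
| const: "smooth_closure (\<lambda>x. c)"
| coord: "smooth_closure (\<lambda>x. x \<bullet> v)"
| add: "smooth_closure f \<Longrightarrow> smooth_closure g \<Longrightarrow> smooth_closure (\<lambda>x. f x + g x)"
| mult: "smooth_closure f \<Longrightarrow> smooth_closure g \<Longrightarrow> smooth_closure (\<lambda>x. f x * g x)"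
| comp: "smooth_closure f \<Longrightarrow> (\<And>x. f x \<in> T) \<Longrightarrow>
    (\<And>k y. y \<in> T \<Longrightarrow> (D k has_real_derivative D (Suc k) y) (at y)) \<Longrightarrow>
    smooth_closure (\<lambda>x. D (k::nat) (f x))"

lemma smooth_fun_partial:
  assumes "smooth_fun (f::'a::euclidean_space \<Rightarrow> real)"
  shows "\<exists>P. (\<forall>b. smooth_fun (P b)) \<and>
    (\<forall>x. (f has_derivative (\<lambda>h. \<Sum>b\<in>Basis. (h \<bullet> b) * P b x)) (at x))"
proof -
  from assms obtain D :: "'a list \<Rightarrow> 'a \<Rightarrow> real" where D: "D [] = f"
    "\<And>ds x. (D ds has_derivative (\<lambda>h. \<Sum>b\<in>Basis. (h \<bullet> b) * D (b # ds) x)) (at x)"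
    unfolding smooth_fun_def by blast
  have "smooth_fun (D [b])" for b
    unfolding smooth_fun_def by (rule exI[of _ "\<lambda>ds. D (ds @ [b])"]) (use D(2) in auto)
  then show ?thesis using D(1) D(2)[of "[]"] by (intro exI[of _ "\<lambda>b. D [b]"]) auto
qed

text \<open>Each formation rule reproduces itself under differentiation: products by Leibniz, and
  the chain rule for \<open>D k (f x)\<close> produces \<open>D (Suc k) (f x)\<close>. This is why
  the composition rule carries an entire sequence of derivatives, together with a set
  \<open>T\<close> containing the range of \<open>f\<close> on which they are valid, for instance
  the positive reals for real powers.\<close>

lemma smooth_closure_partial:
  assumes "smooth_closure (f::'a::euclidean_space \<Rightarrow> real)"
  shows "\<exists>P. (\<forall>b. smooth_closure (P b)) \<and>
    (\<forall>x. (f has_derivative (\<lambda>h. \<Sum>b\<in>Basis. (h \<bullet> b) * P b x)) (at x))"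
  using assms
proof induction
  case (base f)
  then show ?case using smooth_fun_partial[of f] smooth_closure.base by blast
next
  case (const c)
  then show ?case by (intro exI[of _ "\<lambda>b x. 0"]) (auto intro: smooth_closure.const)
next
  case (coord v)
  have inn: "h \<bullet> v = (\<Sum>b\<in>Basis. (h \<bullet> b) * (b \<bullet> v))" for h
    by (subst euclidean_inner) (rule sum.cong, auto simp: inner_commute)
  have "((\<lambda>x. x \<bullet> v) has_derivative (\<lambda>h. \<Sum>b\<in>Basis. (h \<bullet> b) * (b \<bullet> v))) (at x)" for x :: 'a
    by (rule has_derivative_eq_rhs[OF has_derivative_inner_left[OF has_derivative_ident]])
      (rule ext, rule inn)
  then show ?case by (intro exI[of _ "\<lambda>b x. b \<bullet> v"]) (auto intro: smooth_closure.const)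
next
  case (add f g)
  from add.IH(1) obtain P where P: "\<forall>b. smooth_closure (P b)"
    "\<forall>x. (f has_derivative (\<lambda>h. \<Sum>b\<in>Basis. (h \<bullet> b) * P b x)) (at x)" by blast
  from add.IH(2) obtain Q where Q: "\<forall>b. smooth_closure (Q b)"
    "\<forall>x. (g has_derivative (\<lambda>h. \<Sum>b\<in>Basis. (h \<bullet> b) * Q b x)) (at x)" by blast
  note * = P(1)[rule_format] Q(1)[rule_format] P(2)[rule_format] Q(2)[rule_format]
  show ?case
    apply (intro exI[of _ "\<lambda>b x. P b x + Q b x"] conjI allI smooth_closure.add *)
    apply (rule has_derivative_eq_rhs[OF has_derivative_add[OF *(3,4)]])
    by (auto simp: sum.distrib algebra_simps)
next
  case (mult f g)
  from mult.IH(1) obtain P where P: "\<forall>b. smooth_closure (P b)"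
    "\<forall>x. (f has_derivative (\<lambda>h. \<Sum>b\<in>Basis. (h \<bullet> b) * P b x)) (at x)" by blast
  from mult.IH(2) obtain Q where Q: "\<forall>b. smooth_closure (Q b)"
    "\<forall>x. (g has_derivative (\<lambda>h. \<Sum>b\<in>Basis. (h \<bullet> b) * Q b x)) (at x)" by blast
  note * = P(1)[rule_format] Q(1)[rule_format] P(2)[rule_format] Q(2)[rule_format]
  show ?case
    apply (intro exI[of _ "\<lambda>b x. f x * Q b x + P b x * g x"] conjI allI smooth_closure.add
       smooth_closure.mult * mult.hyps)
    apply (rule has_derivative_eq_rhs[OF has_derivative_mult[OF *(3,4)]])
    by (auto simp: sum.distrib algebra_simps sum_distrib_left sum_distrib_right)
next
  case (comp f T D k)
  from comp.IH obtain P where P: "\<forall>b. smooth_closure (P b)"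
    "\<forall>x. (f has_derivative (\<lambda>h. \<Sum>b\<in>Basis. (h \<bullet> b) * P b x)) (at x)" by blast
  note * = P[rule_format]
  have "((\<lambda>x. D k (f x)) has_derivative (\<lambda>h. \<Sum>b\<in>Basis. (h \<bullet> b) * (D (Suc k) (f x) * P b x))) (at x)" for x
    by (rule has_derivative_eq_rhs[OF has_derivative_compose[OF *(2)
          comp.hyps(3)[OF comp.hyps(2), unfolded has_field_derivative_def]]])
      (auto simp: sum_distrib_left mult_ac)
  moreover have "smooth_closure (\<lambda>x. D j (f x))" for j
    by (rule smooth_closure.comp[where f = f and T = T and D = D]) (fact comp.hyps)+
  ultimately show ?case
    by (intro exI[of _ "\<lambda>b x. D (Suc k) (f x) * P b x"] conjI allI smooth_closure.mult *)
qed

text \<open>\<open>smooth_fun\<close> wants a single family indexed by lists of directions. Choosing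
  for every member of the class one tuple of partial derivatives inside the class, and iterating
  this choice along the list, yields it.\<close>

lemma smooth_closure_imp_smooth:
  assumes "smooth_closure (f::'a::euclidean_space \<Rightarrow> real)"
  shows "smooth_fun f"
proof -
  define pd where "pd f = (SOME P. (\<forall>b. smooth_closure (P b)) \<and>
    (\<forall>x. (f has_derivative (\<lambda>h. \<Sum>b\<in>Basis. (h \<bullet> b) * P b x)) (at x)))" for f :: "'a \<Rightarrow> real"
  have pd: "(\<forall>b. smooth_closure (pd f b)) \<and>
    (\<forall>x. (f has_derivative (\<lambda>h. \<Sum>b\<in>Basis. (h \<bullet> b) * pd f b x)) (at x))"
    if "smooth_closure f" for f :: "'a \<Rightarrow> real"
    unfolding pd_def by (rule someI_ex[OF smooth_closure_partial[OF that]])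
  define D where "D = rec_list f (\<lambda>b ds F. pd F b)"
  have D: "D [] = f" "\<And>b ds. D (b # ds) = pd (D ds) b" by (auto simp: D_def)
  have cl: "smooth_closure (D ds)" for ds
  proof (induction ds)
    case Nil then show ?case using assms by (simp add: D(1))
  next
    case (Cons b ds)
    show ?case unfolding D(2) using pd[OF Cons.IH] by blast
  qed
  have "(D ds has_derivative (\<lambda>h. \<Sum>b\<in>Basis. (h \<bullet> b) * D (b # ds) x)) (at x)" for ds x
    unfolding D(2) using pd[OF cl[of ds]] by blast
  then show ?thesis unfolding smooth_fun_def by (intro exI[of _ D] conjI allI D(1))
qed

lemma smooth_closure_iff: "smooth_closure f \<longleftrightarrow> smooth_fun f"
  using smooth_closure_imp_smooth smooth_closure.base by blast

lemmas smooth_fun_const = smooth_closure.const[unfolded smooth_closure_iff]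
lemmas smooth_fun_coord = smooth_closure.coord[unfolded smooth_closure_iff]
lemmas smooth_fun_add = smooth_closure.add[unfolded smooth_closure_iff]
lemmas smooth_fun_mult = smooth_closure.mult[unfolded smooth_closure_iff]
lemmas smooth_fun_comp = smooth_closure.comp[unfolded smooth_closure_iff]

lemma smooth_fun_sum:
  "finite A \<Longrightarrow> (\<And>i. i \<in> A \<Longrightarrow> smooth_fun (f i)) \<Longrightarrow> smooth_fun (\<lambda>x. \<Sum>i\<in>A. f i x)"
  by (induction A rule: finite_induct) (auto intro: smooth_fun_const smooth_fun_add)

lemma smooth_fun_norm_sq: "smooth_fun (\<lambda>x::'a::euclidean_space. (norm x)\<^sup>2)"
proof -
  have "smooth_fun (\<lambda>x::'a. \<Sum>b\<in>Basis. (x \<bullet> b) * (x \<bullet> b))"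
    by (intro smooth_fun_sum smooth_fun_mult smooth_fun_coord) auto
  then show ?thesis by (simp add: power2_norm_eq_inner euclidean_inner[symmetric])
qed

lemma smooth_fun_powr:
  assumes "smooth_fun (f::'a::euclidean_space \<Rightarrow> real)" "\<And>x. f x > 0"
  shows "smooth_fun (\<lambda>x. f x powr a)"
proof -
  define D where "D = (\<lambda>k y. (\<Prod>i<k. a - real i) * y powr (a - real k))"
  have "(D k has_real_derivative D (Suc k) y) (at y)" if "y > 0" for k y
    using DERIV_cmult[OF has_real_derivative_powr[OF that, of "a - real k"], of "\<Prod>i<k. a - real i"]
    by (simp add: D_def algebra_simps)
  from smooth_fun_comp[OF assms(1), of "{0<..}" D 0] this assms(2)
  show ?thesis by (simp add: D_def)
qed

section \<open>The flat function exp(-1/t) and its derivatives\<close>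

definition bump_poly :: "real poly \<Rightarrow> real \<Rightarrow> real" where
  "bump_poly P t = (if t > 0 then poly P (1 / t) * exp (- (1 / t)) else 0)"

lemma tendsto_poly_exp_0: "((\<lambda>y. poly P y * exp (- y)) \<longlongrightarrow> (0::real)) at_top"
proof -
  have "((\<lambda>y. y ^ k * (poly P y * exp (- y))) \<longlongrightarrow> (0::real)) at_top" for k
  proof (induction P arbitrary: k)
    case 0 then show ?case by simp
  next
    case (pCons a P)
    have "((\<lambda>y. a * (y ^ k / exp y) + y ^ (Suc k) * (poly P y * exp (- y))) \<longlongrightarrow> a * 0 + 0) at_top"
      by (intro tendsto_intros tendsto_power_div_exp_0 pCons.IH)
    then show ?case by (simp add: algebra_simps exp_minus divide_inverse)
  qed
  from this[of 0] show ?thesis by simp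
qed

text \<open>For t > 0 the derivative of P(1/t) exp(-1/t) is t^-2 (P - P')(1/t) exp(-1/t), which has
  the same shape with the polynomial X^2 (P - P'). Iterating from P = 1 gives all derivatives of
  \<open>bump\<close> at once.\<close>

lemma bump_poly_deriv:
  "(bump_poly P has_real_derivative bump_poly ([:0,0,1:] * (P - pderiv P)) t) (at t)"
proof (cases "t = 0")
  case True
  \<comment> \<open>Dividing by h multiplies the polynomial in 1/h by X, so the difference quotient
    at the origin is of the same kind and decays with exp(-1/h).\<close>
  have lim: "((\<lambda>h. bump_poly P h / h) \<longlongrightarrow> 0) (at_right 0)"
  proof -
    have "((\<lambda>h. poly ([:0,1:] * P) (inverse h) * exp (- (inverse h))) \<longlongrightarrow> 0) (at_right (0::real))"
      by (rule filterlim_compose[OF tendsto_poly_exp_0 filterlim_inverse_at_top_right])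
    moreover have "\<forall>\<^sub>F h in at_right (0::real). poly ([:0,1:] * P) (inverse h) * exp (- (inverse h)) = bump_poly P h / h"
      unfolding eventually_at_right_field
      by (rule exI[of _ 1]) (auto simp: bump_poly_def divide_inverse)
    ultimately show ?thesis by (rule Lim_transform_eventually)
  qed
  have "((\<lambda>h. bump_poly P h / h) \<longlongrightarrow> 0) (at_left 0)"
    by (rule tendsto_eventually) (auto simp: eventually_at_left_field bump_poly_def intro!: exI[of _ "-1"])
  with lim have "((\<lambda>h. bump_poly P h / h) \<longlongrightarrow> 0) (at 0)"
    by (simp add: filterlim_split_at)
  then show ?thesis using True by (simp add: DERIV_def bump_poly_def)
next
  case False
  show ?thesis
  proof (cases "t > 0")
    case True
    have "((\<lambda>t. poly P (1 / t) * exp (- (1 / t))) has_real_derivative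
      bump_poly ([:0,0,1:] * (P - pderiv P)) t) (at t)"
    proof -
      have 1: "((\<lambda>t. 1 / t) has_real_derivative - (1 / t\<^sup>2)) (at t)"
        using True by (auto intro!: derivative_eq_intros simp: power2_eq_square)
      have 2: "((\<lambda>t. poly P (1 / t)) has_real_derivative poly (pderiv P) (1 / t) * (- (1 / t\<^sup>2))) (at t)"
        by (rule DERIV_chain2[OF poly_DERIV 1])
      have 3: "((\<lambda>t. exp (- (1 / t))) has_real_derivative exp (- (1 / t)) * (1 / t\<^sup>2)) (at t)"
        by (rule DERIV_chain2[OF DERIV_exp]) (use DERIV_minus[OF 1] in simp)
      show ?thesis
        by (rule DERIV_cong[OF DERIV_mult[OF 2 3]]) (use True in \<open>simp add: bump_poly_def algebra_simps power2_eq_square\<close>)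
    qed
    then show ?thesis
      by (rule has_field_derivative_transform_within_open[of _ _ _ "{0<..}"]) (use True in \<open>auto simp: bump_poly_def\<close>)
  next
    case nt: False
    have "((\<lambda>t. 0) has_real_derivative bump_poly ([:0,0,1:] * (P - pderiv P)) t) (at t)"
      using nt by (simp add: bump_poly_def)
    then show ?thesis
      by (rule has_field_derivative_transform_within_open[of _ _ _ "{..<0}"]) (use nt False in \<open>auto simp: bump_poly_def\<close>)
  qed
qed

definition bump :: "real \<Rightarrow> real" where
  "bump t = (if t > 0 then exp (- (1 / t)) else 0)"

lemma bump_eq: "bump = bump_poly 1"
  by (auto simp: bump_def bump_poly_def fun_eq_iff)

definition bump_deriv :: "nat \<Rightarrow> real \<Rightarrow> real" where
  "bump_deriv k = bump_poly (((\<lambda>P. [:0,0,1:] * (P - pderiv P)) ^^ k) 1)"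

lemma bump_deriv_0: "bump_deriv 0 = bump"
  by (simp add: bump_deriv_def bump_eq)

lemma bump_deriv_Suc: "(bump_deriv k has_real_derivative bump_deriv (Suc k) t) (at t)"
  unfolding bump_deriv_def using bump_poly_deriv by simp

lemma bump_deriv_1: "bump_deriv (Suc 0) t = (if t > 0 then exp (- (1 / t)) / t\<^sup>2 else 0)"
  by (simp add: bump_deriv_def bump_poly_def power2_eq_square)

lemma bump_has_deriv: "(bump has_real_derivative bump_deriv (Suc 0) t) (at t)"
  using bump_deriv_Suc[of 0] by (simp add: bump_deriv_0)

lemma bump_bounds: "0 \<le> bump t" "bump t \<le> 1" "t \<le> 1 \<Longrightarrow> exp 1 * bump t \<le> 1"
  by (auto simp: bump_def exp_add[symmetric] field_simps)

lemma bump_pos: "t > 0 \<Longrightarrow> bump t > 0" by (simp add: bump_def)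
lemma bump_zero: "t \<le> 0 \<Longrightarrow> bump t = 0" by (simp add: bump_def)

text \<open>With y = 1/t the derivative is y^2 exp(-y), and y/2 <= exp(y/2) bounds it by 4. A bound
  uniform in t is what controls the gradients of the rescaled cutoffs.\<close>

lemma bump_deriv1_bounds: "0 \<le> bump_deriv (Suc 0) t" "bump_deriv (Suc 0) t \<le> 4"
proof -
  show "0 \<le> bump_deriv (Suc 0) t" by (simp add: bump_deriv_1)
  have "exp (- (1 / t)) / t\<^sup>2 \<le> 4" if "t > 0"
  proof -
    define y where "y = 1 / t"
    have y: "y > 0" using that by (simp add: y_def)
    have "y / 2 \<le> exp (y / 2)" using exp_ge_add_one_self[of "y/2"] by linarith
    then have "(y / 2)\<^sup>2 \<le> (exp (y / 2))\<^sup>2" using y by (intro power_mono) auto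
    also have "\<dots> = exp y" by (simp add: power2_eq_square exp_add[symmetric])
    finally have "y\<^sup>2 \<le> 4 * exp y" by (simp add: power2_eq_square)
    then have "y\<^sup>2 * exp (- y) \<le> 4" by (simp add: exp_minus field_simps)
    then show ?thesis by (simp add: y_def power_divide)
  qed
  then show "bump_deriv (Suc 0) t \<le> 4" by (simp add: bump_deriv_1)
qed

lemma smooth_fun_bump_comp:
  assumes "smooth_fun (f::'a::euclidean_space \<Rightarrow> real)"
  shows "smooth_fun (\<lambda>x. bump (f x))"
  using smooth_fun_comp[OF assms, of UNIV bump_deriv 0] bump_deriv_Suc by (auto simp: bump_deriv_0)

lemma smooth_fun_affine:
  assumes "smooth_fun (f::'a::euclidean_space \<Rightarrow> real)"
  shows "smooth_fun (\<lambda>x. c + d * f x)"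
  by (intro smooth_fun_add smooth_fun_mult smooth_fun_const assms)

section \<open>Integrals of radial functions\<close>

lemma balls_measurable [measurable]:
  "ball c r \<in> sets borel" "cball c r \<in> sets borel"
  by auto

text \<open>The area of the sphere of radius r, extended by zero to negative r so that it can serve
  as a density on the whole real line.\<close>

definition polar_density :: "'a::euclidean_space itself \<Rightarrow> real \<Rightarrow> real" where
  "polar_density _ r = (if r < 0 then 0 else
     real DIM('a) * unit_ball_vol (real DIM('a)) * r ^ (DIM('a) - 1))"

lemma polar_density_nonneg: "polar_density TYPE('a::euclidean_space) r \<ge> 0"
  by (simp add: polar_density_def)

lemma polar_density_pos: "r > 0 \<Longrightarrow> polar_density TYPE('a::euclidean_space) r > 0"
  by (simp add: polar_density_def)

lemma polar_density_measurable [measurable]: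
  "polar_density TYPE('a::euclidean_space) \<in> borel_measurable borel"
  unfolding polar_density_def by measurable

text \<open>On the half line up to a >= 0 both measures give the volume of the ball of radius a: on
  the left by definition, on the right by the fundamental theorem of calculus. The half lines are
  stable under intersection and generate the Borel sets. Polar coordinates enter the proof in this
  form only, without any integration over angles.\<close>

lemma distr_norm_lborel:
  "distr (lborel :: 'a::euclidean_space measure) borel norm =
     density lborel (\<lambda>r. ennreal (polar_density TYPE('a) r))"
proof (rule measure_eqI_generator_eq[where E = "range (\<lambda>a::real. {..a})" and \<Omega> = UNIV and A = "\<lambda>n. {..real n}"])
  let ?n = "DIM('a)" and ?w = "unit_ball_vol (real DIM('a))"
  show "Int_stable (range (\<lambda>a::real. {..a}))"
  proof (rule Int_stableI)
    fix a b assume "a \<in> range (\<lambda>a::real. {..a})" "b \<in> range (\<lambda>a::real. {..a})"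
    then obtain x y where "a = {..x}" "b = {..y}" by auto
    then have "a \<inter> b = {..min x y}" by auto
    then show "a \<inter> b \<in> range (\<lambda>a::real. {..a})" by blast
  qed
  have D: "emeasure (distr (lborel :: 'a measure) borel norm) {..a} = ennreal (if a < 0 then 0 else ?w * a ^ ?n)" for a
  proof -
    have "norm -` {..a} = cball (0::'a) a" by auto
    then show ?thesis by (simp add: emeasure_distr emeasure_cball)
  qed
  have M: "emeasure (density lborel (\<lambda>r. ennreal (polar_density TYPE('a) r))) {..a} = ennreal (if a < 0 then 0 else ?w * a ^ ?n)" for a
  proof (cases "a < 0")
    case True
    then show ?thesis
      by (subst emeasure_density) (auto simp: polar_density_def nn_integral_0_iff_AE intro!: AE_I2 split: split_indicator)
  next
    case False
    have "emeasure (density lborel (\<lambda>r. ennreal (polar_density TYPE('a) r))) {..a} =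
        (\<integral>\<^sup>+ r. ennreal (polar_density TYPE('a) r) * indicator {..a} r \<partial>lborel)"
      by (subst emeasure_density) auto
    also have "\<dots> = (\<integral>\<^sup>+ r. ennreal (real ?n * ?w * r ^ (?n - 1)) * indicator {0..a} r \<partial>lborel)"
      by (intro nn_integral_cong) (auto simp: polar_density_def split: split_indicator)
    also have "\<dots> = ?w * a ^ ?n - ?w * 0 ^ ?n"
    proof (rule nn_integral_FTC_Icc)
      fix x :: real assume x: "x \<in> {0..a}"
      show "((\<lambda>r. ?w * r ^ ?n) has_real_derivative real ?n * ?w * x ^ (?n - 1)) (at x)"
        by (auto intro!: derivative_eq_intros)
      show "0 \<le> real ?n * ?w * x ^ (?n - 1)" using x by simp
    qed (use False in auto)
    finally show ?thesis using False by simp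
  qed
  show "emeasure (distr (lborel :: 'a measure) borel norm) X = emeasure (density lborel (\<lambda>r. ennreal (polar_density TYPE('a) r))) X"
    if "X \<in> range (\<lambda>a::real. {..a})" for X using that D M by auto
  show "emeasure (distr (lborel::'a measure) borel norm) {..real i} \<noteq> \<infinity>" for i by (simp add: D)
  show "(\<Union>i. {..real i}) = UNIV" using real_arch_simple by auto
qed (auto simp: borel_eq_atMost sets_measure_of_conv)

lemma nn_integral_polar:
  assumes [measurable]: "F \<in> borel_measurable borel"
  shows "(\<integral>\<^sup>+ x. F (norm x) \<partial>(lborel :: 'a::euclidean_space measure)) =
    (\<integral>\<^sup>+ r. ennreal (polar_density TYPE('a) r) * F r \<partial>lborel)"
proof -
  have "(\<integral>\<^sup>+ x. F (norm x) \<partial>(lborel :: 'a measure)) = (\<integral>\<^sup>+ r. F r \<partial>distr (lborel :: 'a measure) borel norm)"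
    by (subst nn_integral_distr) auto
  also have "\<dots> = (\<integral>\<^sup>+ r. ennreal (polar_density TYPE('a) r) * F r \<partial>lborel)"
    unfolding distr_norm_lborel by (subst nn_integral_density) auto
  finally show ?thesis .
qed

lemma integral_polar:
  fixes F :: "real \<Rightarrow> real"
  assumes [measurable]: "F \<in> borel_measurable borel"
  shows "(\<integral>x. F (norm x) \<partial>(lborel :: 'a::euclidean_space measure)) =
      (\<integral>r. polar_density TYPE('a) r * F r \<partial>lborel)"
    and integrable_polar: "integrable (lborel :: 'a measure) (\<lambda>x. F (norm x)) \<longleftrightarrow>
      integrable lborel (\<lambda>r. polar_density TYPE('a) r * F r)"
proof -
  have "(\<integral>x. F (norm x) \<partial>(lborel :: 'a measure)) = (\<integral>r. F r \<partial>distr (lborel :: 'a measure) borel norm)"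
    by (subst integral_distr) auto
  also have "\<dots> = (\<integral>r. polar_density TYPE('a) r * F r \<partial>lborel)"
    unfolding distr_norm_lborel by (subst integral_density) (auto simp: polar_density_nonneg)
  finally show "(\<integral>x. F (norm x) \<partial>(lborel :: 'a measure)) = (\<integral>r. polar_density TYPE('a) r * F r \<partial>lborel)" .
  have "integrable (lborel :: 'a measure) (\<lambda>x. F (norm x)) \<longleftrightarrow> integrable (distr (lborel :: 'a measure) borel norm) F"
    by (subst integrable_distr_eq) auto
  also have "\<dots> \<longleftrightarrow> integrable lborel (\<lambda>r. polar_density TYPE('a) r * F r)"
    unfolding distr_norm_lborel by (subst integrable_density) (auto simp: polar_density_nonneg)
  finally show "integrable (lborel :: 'a measure) (\<lambda>x. F (norm x)) \<longleftrightarrow>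
      integrable lborel (\<lambda>r. polar_density TYPE('a) r * F r)" .
qed

text \<open>Makes it possible to discard the origin, the boundary of a ball, and the radii in
  \<open>S\<close> at which a profile has a kink.\<close>

lemma AE_polar_finite:
  assumes "finite S"
  shows "AE x in (lborel :: 'a::euclidean_space measure). norm x \<notin> S"
proof -
  have [measurable]: "S \<in> sets borel" using assms by (simp add: finite_imp_closed)
  have "(\<integral>\<^sup>+ x. indicator S (norm x) \<partial>(lborel :: 'a measure)) =
      (\<integral>\<^sup>+ r. ennreal (polar_density TYPE('a) r) * indicator S r \<partial>lborel)"
    by (rule nn_integral_polar) auto
  also have "\<dots> = 0"
  proof (subst nn_integral_0_iff_AE)
    have "AE r in lborel. r \<notin> S"
      by (rule AE_I'[of S]) (use assms in \<open>auto simp: null_sets_def emeasure_lborel_countable[OF countable_finite]\<close>)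
    then show "AE r in lborel. ennreal (polar_density TYPE('a) r) * indicator S r = 0"
      by eventually_elim auto
  qed auto
  finally have "AE x in (lborel :: 'a measure). (indicator S (norm x) :: ennreal) = 0"
    by (subst (asm) nn_integral_0_iff_AE) auto
  then show ?thesis by eventually_elim (auto split: split_indicator_asm)
qed

lemma integrable_bounded_support:
  fixes f :: "'a::euclidean_space \<Rightarrow> 'b::{banach,second_countable_topology}"
  assumes "f \<in> borel_measurable lborel" "AE x in lborel. norm (f x) \<le> C"
    "AE x in lborel. norm x > R \<longrightarrow> f x = 0"
  shows "integrable lborel f"
proof (rule Bochner_Integration.integrable_bound)
  show "integrable lborel (\<lambda>x::'a. C * indicator (cball 0 R) x)"
    by (intro integrable_mult_right integrable_real_indicator) (auto simp: emeasure_bounded_finite[unfolded infinity_ennreal_def])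
  show "AE x in lborel. norm (f x) \<le> norm (C * indicator (cball 0 R) x)"
    using assms(2,3) by eventually_elim (auto split: split_indicator simp: not_le)
qed fact

text \<open>After the passage to the radius, r^{N-1} <= (1 + r)^{N-1} leaves a power of 1 + r with
  an explicit antiderivative. These powers dominate the bubbles and their approximants.\<close>

lemma integrable_decay:
  assumes a: "a > real DIM('a::euclidean_space)"
  shows "integrable (lborel :: 'a measure) (\<lambda>x. (1 + norm x) powr (- a))"
proof -
  let ?n = "DIM('a)"
  define c where "c = real ?n * unit_ball_vol (real ?n)"
  have c: "c \<ge> 0" by (simp add: c_def)
  define F where "F r = (1 + r) powr (real ?n - a) / (real ?n - a)" for r :: real
  have "(\<integral>\<^sup>+ x. ennreal ((1 + norm x) powr (- a)) \<partial>(lborel :: 'a measure)) =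
     (\<integral>\<^sup>+ r. ennreal (polar_density TYPE('a) r) * ennreal ((1 + r) powr (- a)) \<partial>lborel)"
    by (rule nn_integral_polar) auto
  also have "\<dots> \<le> (\<integral>\<^sup>+ r. ennreal c * (ennreal ((1 + r) powr (real ?n - a - 1)) * indicator {0..} r) \<partial>lborel)"
  proof (intro nn_integral_mono)
    fix r :: real
    show "ennreal (polar_density TYPE('a) r) * ennreal ((1 + r) powr (- a)) \<le>
       ennreal c * (ennreal ((1 + r) powr (real ?n - a - 1)) * indicator {0..} r)"
    proof (cases "r < 0")
      case False
      have "r ^ (?n - 1) \<le> (1 + r) ^ (?n - 1)" using False by (intro power_mono) auto
      also have "\<dots> = (1 + r) powr (real ?n - 1)" using False by (simp add: powr_realpow[symmetric] of_nat_diff DIM_positive Suc_leI)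
      finally have "c * r ^ (?n - 1) * (1 + r) powr (- a) \<le> c * ((1 + r) powr (real ?n - 1) * (1 + r) powr (- a))"
        using c by (simp add: mult.assoc mult_left_mono mult_right_mono)
      then have "c * r ^ (?n - 1) * (1 + r) powr (- a) \<le> c * (1 + r) powr (real ?n - a - 1)"
        by (simp add: powr_add[symmetric] algebra_simps)
      then show ?thesis using False c
        by (simp add: polar_density_def c_def[symmetric] ennreal_mult'[symmetric] ennreal_leI)
    qed (simp add: polar_density_def)
  qed
  also have "\<dots> = ennreal c * (\<integral>\<^sup>+ r. ennreal ((1 + r) powr (real ?n - a - 1)) * indicator {0..} r \<partial>lborel)"
    by (rule nn_integral_cmult) auto
  also have "(\<integral>\<^sup>+ r. ennreal ((1 + r) powr (real ?n - a - 1)) * indicator {0..} r \<partial>lborel) = ennreal (0 - F 0)"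
  proof (rule nn_integral_FTC_atLeast)
    fix x :: real assume "0 \<le> x"
    have "((\<lambda>r. (1 + r) powr (real ?n - a)) has_real_derivative (real ?n - a) * (1 + x) powr (real ?n - a - 1) * 1) (at x)"
      by (rule DERIV_chain2[OF has_real_derivative_powr]) (use \<open>0 \<le> x\<close> in \<open>auto intro!: derivative_eq_intros\<close>)
    from DERIV_cdivide[OF this, of "real ?n - a"] show "(F has_real_derivative (1 + x) powr (real ?n - a - 1)) (at x)"
      unfolding F_def using a by simp
  next
    have "((\<lambda>r. (1 + r) powr (real ?n - a)) \<longlongrightarrow> 0) at_top"
      by (rule tendsto_neg_powr) (use a in \<open>auto intro!: filterlim_tendsto_add_at_top filterlim_ident tendsto_const\<close>)
    then show "(F \<longlongrightarrow> 0) at_top" unfolding F_def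
      using tendsto_divide[of _ 0 at_top "\<lambda>_. real ?n - a" "real ?n - a"] a by fastforce
  qed auto
  finally have "(\<integral>\<^sup>+ x. ennreal ((1 + norm x) powr (- a)) \<partial>(lborel :: 'a measure)) < \<infinity>"
    by (rule order.strict_trans1) (simp add: ennreal_mult_less_top)
  then show ?thesis by (intro integrableI_bounded) auto
qed

text \<open>The hypothesis says that the positive and the negative part of \<open>k\<close>, taken
  as densities and pushed forward by the norm, give every interval below b the same finite mass; so
  the two measures on the radii coincide and every radial weight integrates to the same value. This
  replaces the statement that the mean of \<open>k\<close> vanishes on almost every sphere, without
  disintegrating the measure.\<close>

lemma radial_integral_eq_zero:
  fixes k :: "'a::euclidean_space \<Rightarrow> real"
  assumes [measurable]: "k \<in> borel_measurable lborel"
    and int: "\<And>b. integrable lborel (\<lambda>x. indicator (ball 0 b) x * k x)"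
    and zero: "\<And>b. b > 0 \<Longrightarrow> (\<integral>x. indicator (ball 0 b) x * k x \<partial>lborel) = 0"
    and [measurable]: "F \<in> borel_measurable borel"
    and Fk: "integrable lborel (\<lambda>x. F (norm x) * k x)"
  shows "(\<integral>x. F (norm x) * k x \<partial>lborel) = 0"
proof -
  define kp where "kp x = max 0 (k x)" for x
  define km where "km x = max 0 (- k x)" for x
  have [measurable]: "kp \<in> borel_measurable borel" "km \<in> borel_measurable borel"
    using assms(1) unfolding kp_def[abs_def] km_def[abs_def] by measurable
  have kk: "k x = kp x - km x" for x by (auto simp: kp_def km_def)
  have nn: "kp x \<ge> 0" "km x \<ge> 0" for x by (auto simp: kp_def km_def)
  have ip1: "integrable lborel (\<lambda>x. indicator (ball 0 b) x * kp x)" for b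
    by (rule Bochner_Integration.integrable_bound[OF int[of b]], measurable) (auto simp: kp_def split: split_indicator)
  have ip2: "integrable lborel (\<lambda>x. indicator (ball 0 b) x * km x)" for b
    by (rule Bochner_Integration.integrable_bound[OF int[of b]], measurable) (auto simp: km_def split: split_indicator)
  note ip = ip1 ip2
  define Mp where "Mp = distr (density lborel (\<lambda>x. ennreal (kp x))) borel norm"
  define Mm where "Mm = distr (density lborel (\<lambda>x. ennreal (km x))) borel norm"
  have lt: "emeasure (distr (density lborel (\<lambda>x. ennreal (h x))) borel norm) {..<b} =
      ennreal (\<integral>x. indicator (ball 0 b) x * h x \<partial>lborel)"
    if [measurable]: "h \<in> borel_measurable borel" and "\<And>x. h x \<ge> 0" "\<And>b. integrable lborel (\<lambda>x. indicator (ball 0 b) x * h x)"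
    for h :: "'a \<Rightarrow> real" and b
  proof -
    have "norm -` {..<b} = ball (0::'a) b" by auto
    then have "emeasure (distr (density lborel (\<lambda>x. ennreal (h x))) borel norm) {..<b} =
        (\<integral>\<^sup>+ x. ennreal (h x) * indicator (ball 0 b) x \<partial>lborel)"
      by (simp add: emeasure_distr emeasure_density)
    also have "\<dots> = (\<integral>\<^sup>+ x. ennreal (indicator (ball 0 b) x * h x) \<partial>lborel)"
      by (intro nn_integral_cong) (auto split: split_indicator)
    also have "\<dots> = ennreal (\<integral>x. indicator (ball 0 b) x * h x \<partial>lborel)"
      by (rule nn_integral_eq_integral) (use that in auto)
    finally show ?thesis .
  qed
  have "Mp = Mm"
  proof (rule measure_eqI_generator_eq[where E = "range (\<lambda>a::real. {..<a})" and \<Omega> = UNIV and A = "\<lambda>n. {..<real n}"])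
    show "Int_stable (range (\<lambda>a::real. {..<a}))"
    proof (rule Int_stableI)
      fix a b assume "a \<in> range (\<lambda>a::real. {..<a})" "b \<in> range (\<lambda>a::real. {..<a})"
      then obtain x y where "a = {..<x}" "b = {..<y}" by auto
      then have "a \<inter> b = {..<min x y}" by auto
      then show "a \<inter> b \<in> range (\<lambda>a::real. {..<a})" by blast
    qed
    have "(\<integral>x. indicator (ball 0 b) x * kp x \<partial>lborel) = (\<integral>x. indicator (ball 0 b) x * km x \<partial>lborel)" for b
    proof (cases "b > 0")
      case True
      have "(\<integral>x. indicator (ball 0 b) x * k x \<partial>lborel) =
         (\<integral>x. indicator (ball 0 b) x * kp x \<partial>lborel) - (\<integral>x. indicator (ball 0 b) x * km x \<partial>lborel)"
        by (subst Bochner_Integration.integral_diff[symmetric, OF ip]) (simp add: kk algebra_simps)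
      then show ?thesis using zero[OF True] by simp
    qed (simp add: ball_empty not_less)
    then show "emeasure Mp X = emeasure Mm X" if "X \<in> range (\<lambda>a::real. {..<a})" for X
      using that nn ip by (auto simp: Mp_def Mm_def lt)
    show "emeasure Mp {..<real i} \<noteq> \<infinity>" for i using nn ip by (simp add: Mp_def lt)
    show "(\<Union>i. {..<real i}) = UNIV" using reals_Archimedean2 by auto
  qed (auto simp: borel_Iio sets_measure_of_conv Mp_def Mm_def)
  moreover have "(\<integral>r. F r \<partial>Mp) = (\<integral>x. F (norm x) * kp x \<partial>lborel)"
    unfolding Mp_def by (subst integral_distr) (auto simp: integral_density nn mult.commute)
  moreover have "(\<integral>r. F r \<partial>Mm) = (\<integral>x. F (norm x) * km x \<partial>lborel)"
    unfolding Mm_def by (subst integral_distr) (auto simp: integral_density nn mult.commute)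
  moreover have "integrable lborel (\<lambda>x. F (norm x) * kp x)"
    by (rule Bochner_Integration.integrable_bound[OF Fk], measurable) (auto simp: kp_def abs_mult intro!: mult_left_mono)
  moreover have "integrable lborel (\<lambda>x. F (norm x) * km x)"
    by (rule Bochner_Integration.integrable_bound[OF Fk], measurable) (auto simp: km_def abs_mult intro!: mult_left_mono)
  ultimately show ?thesis by (simp add: kk algebra_simps)
qed

section \<open>Weak gradients and Lipschitz test fields\<close>

text \<open>The class of scalar test functions for the weak gradient. The components of the fields
  \<psi>(|x|) x used below are in general not smooth: \<psi> may have kinks, and the field may fail
  to be differentiable at the origin. A Lipschitz bound is enough to dominate the difference
  quotients.\<close>

definition lipschitz_support :: "('a::euclidean_space \<Rightarrow> real) \<Rightarrow> real \<Rightarrow> real \<Rightarrow> bool" where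
  "lipschitz_support F L R \<longleftrightarrow>
     (\<forall>x y. \<bar>F x - F y\<bar> \<le> L * norm (x - y)) \<and> (\<forall>x. norm x > R \<longrightarrow> F x = 0)"

text \<open>Each value is compared with the value zero at a point at distance |R| + 1 from the
  origin.\<close>

lemma lipschitz_support_bounded:
  assumes "lipschitz_support (F :: 'a::euclidean_space \<Rightarrow> real) L R"
  shows "\<exists>C\<ge>0. \<forall>x. \<bar>F x\<bar> \<le> C"
proof -
  obtain b :: 'a where b: "b \<in> Basis" using SOME_Basis by blast
  have L0: "L \<ge> 0"
  proof -
    have "\<bar>F b - F 0\<bar> \<le> L * norm (b - 0)" using assms unfolding lipschitz_support_def by blast
    then show ?thesis using b by simp
  qed
  have "\<bar>F x\<bar> \<le> L * (2 * \<bar>R\<bar> + 1)" for x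
  proof (cases "norm x > R")
    case True
    then show ?thesis using assms L0 by (auto simp: lipschitz_support_def)
  next
    case False
    define y where "y = (\<bar>R\<bar> + 1) *\<^sub>R b"
    have y: "norm y = \<bar>R\<bar> + 1" using b by (simp add: y_def)
    then have "F y = 0" using assms by (auto simp: lipschitz_support_def)
    then have "\<bar>F x\<bar> = \<bar>F x - F y\<bar>" by simp
    also have "\<dots> \<le> L * norm (x - y)" using assms unfolding lipschitz_support_def by blast
    also have "\<dots> \<le> L * (2 * \<bar>R\<bar> + 1)"
      using norm_triangle_ineq4[of x y] y False L0 by (intro mult_left_mono) auto
    finally show ?thesis .
  qed
  then show ?thesis using L0 by (intro exI[of _ "L * (2 * \<bar>R\<bar> + 1)"]) auto
qed

lemma lipschitz_support_continuous:
  assumes "lipschitz_support (F :: 'a::euclidean_space \<Rightarrow> real) L R"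
  shows "continuous_on UNIV F"
proof (rule lipschitz_on_continuous_on)
  show "(\<bar>L\<bar>)-lipschitz_on UNIV F"
  proof (rule lipschitz_onI)
    fix x y
    have "\<bar>F x - F y\<bar> \<le> L * norm (x - y)" using assms unfolding lipschitz_support_def by blast
    also have "\<dots> \<le> \<bar>L\<bar> * norm (x - y)" by (intro mult_right_mono) auto
    finally show "dist (F x) (F y) \<le> \<bar>L\<bar> * dist x y" by (simp add: dist_norm)
  qed simp
qed

lemma lipschitz_support_measurable:
  assumes "lipschitz_support (F :: 'a::euclidean_space \<Rightarrow> real) L R"
  shows "F \<in> borel_measurable borel"
  by (rule borel_measurable_continuous_onI[OF lipschitz_support_continuous[OF assms]])

lemma lipschitz_support_mult:
  assumes F: "lipschitz_support (F :: 'a::euclidean_space \<Rightarrow> real) L R" and G: "lipschitz_support G L' R'"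
  shows "\<exists>L''. lipschitz_support (\<lambda>x. F x * G x) L'' R"
proof -
  obtain C D where C: "C \<ge> 0" "\<And>x. \<bar>F x\<bar> \<le> C" and D: "D \<ge> 0" "\<And>x. \<bar>G x\<bar> \<le> D"
    using lipschitz_support_bounded[OF F] lipschitz_support_bounded[OF G] by auto
  have "\<bar>F x * G x - F y * G y\<bar> \<le> (C * \<bar>L'\<bar> + \<bar>L\<bar> * D) * norm (x - y)" for x y
  proof -
    have 1: "\<bar>F x - F y\<bar> \<le> \<bar>L\<bar> * norm (x - y)" "\<bar>G x - G y\<bar> \<le> \<bar>L'\<bar> * norm (x - y)"
      using F G unfolding lipschitz_support_def by (meson abs_ge_self mult_right_mono norm_ge_zero order_trans)+
    have "\<bar>F x * G x - F y * G y\<bar> = \<bar>F x * (G x - G y) + (F x - F y) * G y\<bar>" by (simp add: algebra_simps)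
    also have "\<dots> \<le> \<bar>F x\<bar> * \<bar>G x - G y\<bar> + \<bar>F x - F y\<bar> * \<bar>G y\<bar>"
      by (simp add: abs_mult[symmetric] abs_triangle_ineq)
    also have "\<dots> \<le> C * (\<bar>L'\<bar> * norm (x - y)) + (\<bar>L\<bar> * norm (x - y)) * D"
      by (intro add_mono mult_mono 1 C D) (use C D in auto)
    finally show ?thesis by (simp add: algebra_simps)
  qed
  then show ?thesis using F unfolding lipschitz_support_def by (intro exI[of _ "C * \<bar>L'\<bar> + \<bar>L\<bar> * D"]) auto
qed

lemma lipschitz_support_derivative_bound:
  assumes F: "lipschitz_support (F :: 'a::euclidean_space \<Rightarrow> real) L R" and b: "b \<in> Basis"
    and d: "((\<lambda>h. F (x + h *\<^sub>R b)) has_real_derivative d) (at 0)"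
  shows "\<bar>d\<bar> \<le> L" "norm x > R \<Longrightarrow> d = 0"
proof -
  have "((\<lambda>h. \<bar>(F (x + h *\<^sub>R b) - F x) / h\<bar>) \<longlongrightarrow> \<bar>d\<bar>) (at 0)"
    using d by (intro tendsto_rabs) (simp add: DERIV_def)
  moreover have "\<forall>\<^sub>F h in at 0. \<bar>(F (x + h *\<^sub>R b) - F x) / h\<bar> \<le> L"
    unfolding eventually_at_filter
  proof (intro always_eventually allI impI)
    fix h :: real assume h: "h \<noteq> 0"
    have "\<bar>F (x + h *\<^sub>R b) - F x\<bar> \<le> L * norm (x + h *\<^sub>R b - x)"
      using F unfolding lipschitz_support_def by blast
    then show "\<bar>(F (x + h *\<^sub>R b) - F x) / h\<bar> \<le> L" using h b by (simp add: abs_divide field_simps)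
  qed
  ultimately show "\<bar>d\<bar> \<le> L" by (rule tendsto_upperbound) simp
next
  assume x: "norm x > R"
  have "open {h. norm (x + h *\<^sub>R b) > R}"
    by (intro open_Collect_less continuous_intros)
  then have "((\<lambda>h. 0) has_real_derivative d) (at (0::real))"
    by (intro has_field_derivative_transform_within_open[OF d, of "{h. norm (x + h *\<^sub>R b) > R}"])
      (use x F in \<open>auto simp: lipschitz_support_def\<close>)
  then show "d = 0" using DERIV_unique[OF _ DERIV_const] by blast
qed

text \<open>Lebesgue measure is translation invariant, so every difference quotient of a Lipschitz function
  with bounded support has integral zero, and so does its limit.\<close>

lemma integral_directional_derivative_zero:
  assumes F: "lipschitz_support (F :: 'a::euclidean_space \<Rightarrow> real) L R" and b: "b \<in> Basis"
    and [measurable]: "d \<in> borel_measurable lborel"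
    and d: "AE x in lborel. ((\<lambda>h. F (x + h *\<^sub>R b)) has_real_derivative d x) (at 0)"
  shows "integrable lborel d" "(\<integral>x. d x \<partial>lborel) = 0"
proof -
  have [measurable]: "F \<in> borel_measurable borel" by (rule lipschitz_support_measurable[OF F])
  obtain C where C: "\<And>x. \<bar>F x\<bar> \<le> C" using lipschitz_support_bounded[OF F] by auto
  have Fint: "integrable lborel F"
    by (rule integrable_bounded_support[of _ C R]) (use C F in \<open>auto simp: lipschitz_support_def\<close>)
  define e where "e n = 1 / real (Suc n)" for n
  have e: "e n > 0" "e n \<le> 1" for n by (auto simp: e_def)
  define s where "s n x = (F (x + e n *\<^sub>R b) - F x) / e n" for n x
  have [measurable]: "s n \<in> borel_measurable borel" for n unfolding s_def[abs_def] by measurable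
  have elim: "filterlim e (at 0) sequentially"
    unfolding filterlim_at using e(1) LIMSEQ_inverse_real_of_nat
    by (auto simp: e_def[abs_def] inverse_eq_divide)
  have lim: "AE x in lborel. (\<lambda>n. s n x) \<longlonglongrightarrow> d x"
    using d
  proof eventually_elim
    case (elim x)
    then have "((\<lambda>h. (F (x + h *\<^sub>R b) - F x) / h) \<longlongrightarrow> d x) (at 0)" by (simp add: DERIV_def)
    from filterlim_compose[OF this \<open>filterlim e (at 0) sequentially\<close>] show ?case by (simp add: s_def)
  qed
  have bd: "AE x in lborel. norm (s n x) \<le> L * indicator (cball 0 (R + 1)) x" for n
  proof (intro AE_I2)
    fix x :: 'a
    show "norm (s n x) \<le> L * indicator (cball 0 (R + 1)) x"
    proof (cases "norm x \<le> R + 1")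
      case True
      have "\<bar>F (x + e n *\<^sub>R b) - F x\<bar> \<le> L * norm (x + e n *\<^sub>R b - x)"
        using F unfolding lipschitz_support_def by blast
      then show ?thesis using True e(1)[of n] b by (simp add: s_def field_simps)
    next
      case False
      have "norm x - norm (e n *\<^sub>R b) \<le> norm (x + e n *\<^sub>R b)" by (rule norm_diff_ineq)
      then have "norm (x + e n *\<^sub>R b) > R" using False e[of n] b by simp
      then show ?thesis using False F by (simp add: s_def lipschitz_support_def)
    qed
  qed
  have w: "integrable lborel (\<lambda>x::'a. L * indicator (cball 0 (R + 1)) x)"
    by (intro integrable_mult_right integrable_real_indicator) (auto simp: emeasure_bounded_finite[unfolded infinity_ennreal_def])
  show "integrable lborel d" by (rule integrable_dominated_convergence[OF _ _ w lim bd]) auto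
  have shift: "integrable lborel (\<lambda>x. F (x + v))" "(\<integral>x. F (x + v) \<partial>lborel) = (\<integral>x. F x \<partial>lborel)" for v
  proof -
    have "integrable (distr lborel borel ((+) v)) F" using Fint by (simp add: lborel_distr_plus)
    then show "integrable lborel (\<lambda>x. F (x + v))" by (subst (asm) integrable_distr_eq) (auto simp: add.commute)
    have "(\<integral>x. F x \<partial>lborel) = (\<integral>x. F x \<partial>distr lborel borel ((+) v))" by (simp add: lborel_distr_plus)
    also have "\<dots> = (\<integral>x. F (x + v) \<partial>lborel)" by (subst integral_distr) (auto simp: add.commute)
    finally show "(\<integral>x. F (x + v) \<partial>lborel) = (\<integral>x. F x \<partial>lborel)" by simp
  qed
  have "(\<integral>x. s n x \<partial>lborel) = 0" for n
    unfolding s_def by (simp add: Bochner_Integration.integral_diff[OF shift(1) Fint] shift(2))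
  moreover have "(\<lambda>n. \<integral>x. s n x \<partial>lborel) \<longlonglongrightarrow> (\<integral>x. d x \<partial>lborel)"
    by (rule integral_dominated_convergence[OF _ _ w lim bd]) auto
  ultimately show "(\<integral>x. d x \<partial>lborel) = 0" by (simp add: LIMSEQ_const_iff)
qed

lemma grad_eqI:
  assumes "(f has_derivative (\<lambda>h. h \<bullet> G)) (at (x::'a::euclidean_space))"
  shows "grad f x = G"
proof -
  have "frechet_derivative f (at x) = (\<lambda>h. h \<bullet> G)"
    using frechet_derivative_at[OF assms] by simp
  then show ?thesis by (simp add: grad_def inner_commute[of _ G] euclidean_representation)
qed

lemma smooth_fun_grad:
  assumes "smooth_fun (\<phi> :: 'a::euclidean_space \<Rightarrow> real)"
  shows "(\<phi> has_derivative (\<lambda>h. h \<bullet> grad \<phi> x)) (at x)" "continuous_on UNIV (grad \<phi>)"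
proof -
  obtain P where P: "\<And>b. smooth_fun (P b)"
    "\<And>x. (\<phi> has_derivative (\<lambda>h. \<Sum>b\<in>Basis. (h \<bullet> b) * P b x)) (at x)"
    using smooth_fun_partial[OF assms] by blast
  have d: "(\<phi> has_derivative (\<lambda>h. h \<bullet> (\<Sum>b\<in>Basis. P b x *\<^sub>R b))) (at x)" for x
    by (rule has_derivative_eq_rhs[OF P(2)]) (auto simp: inner_sum_right mult.commute)
  have g: "grad \<phi> x = (\<Sum>b\<in>Basis. P b x *\<^sub>R b)" for x by (rule grad_eqI[OF d])
  show "(\<phi> has_derivative (\<lambda>h. h \<bullet> grad \<phi> x)) (at x)" using d by (simp add: g)
  have "continuous_on UNIV (P b)" for b
  proof -
    obtain Q where "\<And>x. (P b has_derivative (\<lambda>h. \<Sum>c\<in>Basis. (h \<bullet> c) * Q c x)) (at x)"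
      using smooth_fun_partial[OF P(1)[of b]] by blast
    then show ?thesis by (meson continuous_at_imp_continuous_on has_derivative_continuous)
  qed
  then show "continuous_on UNIV (grad \<phi>)" unfolding g[abs_def] by (intro continuous_intros)
qed

lemma has_derivative_directional:
  assumes "(f has_derivative (\<lambda>h. h \<bullet> G)) (at (x::'a::euclidean_space))"
  shows "((\<lambda>h. f (x + h *\<^sub>R b)) has_real_derivative G \<bullet> b) (at 0)"
proof -
  have 1: "((\<lambda>h. x + h *\<^sub>R b) has_derivative (\<lambda>h. h *\<^sub>R b)) (at 0)"
    by (auto intro!: derivative_eq_intros)
  have "((\<lambda>h. f (x + h *\<^sub>R b)) has_derivative (\<lambda>h. (h *\<^sub>R b) \<bullet> G)) (at 0)"
    by (rule has_derivative_compose[OF 1]) (use assms in simp)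
  then show ?thesis unfolding has_field_derivative_def
    by (rule has_derivative_eq_rhs) (auto simp: inner_commute)
qed

lemma lipschitz_support_of_derivative:
  assumes d: "\<And>x::'a::euclidean_space. (f has_derivative (\<lambda>h. h \<bullet> G x)) (at x)"
    and G: "\<And>x. norm (G x) \<le> L" and R: "\<And>x. norm x > R \<Longrightarrow> f x = 0"
  shows "lipschitz_support f L R"
  unfolding lipschitz_support_def
proof (intro conjI allI impI R)
  fix x y :: 'a
  have "norm (f x - f y) \<le> L * norm (x - y)"
  proof (rule differentiable_bound[of UNIV f "\<lambda>x h. h \<bullet> G x" L])
    fix z :: 'a
    show "onorm (\<lambda>h. h \<bullet> G z) \<le> L"
      by (rule onorm_le) (metis Cauchy_Schwarz_ineq2 G mult.commute mult_left_mono norm_ge_zero order_trans real_norm_def)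
  qed (use d in auto)
  then show "\<bar>f x - f y\<bar> \<le> L * norm (x - y)" by simp
qed

lemma test_fun_facts:
  assumes "test_fun (\<phi> :: 'a::euclidean_space \<Rightarrow> real)"
  shows "\<exists>R L. lipschitz_support \<phi> L R \<and> (\<forall>x. norm (grad \<phi> x) \<le> L) \<and> (\<forall>x. norm x > R \<longrightarrow> grad \<phi> x = 0)"
proof -
  have sm: "smooth_fun \<phi>" and "bounded {x. \<phi> x \<noteq> 0}" using assms by (auto simp: test_fun_def)
  then obtain R where R: "\<And>x. \<phi> x \<noteq> 0 \<Longrightarrow> norm x \<le> R" unfolding bounded_iff by blast
  note d = smooth_fun_grad(1)[OF sm]
  have g0: "grad \<phi> x = 0" if x: "norm x > R" for x
  proof (rule grad_eqI)
    have "open {x::'a. norm x > R}" by (intro open_Collect_less continuous_intros)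
    then show "(\<phi> has_derivative (\<lambda>h. h \<bullet> 0)) (at x)"
      by (rule has_derivative_transform_within_open[rotated, where f = "\<lambda>x. 0"]) (use x R in \<open>force+\<close>)
  qed
  have "compact (grad \<phi> ` cball 0 R)"
    by (intro compact_continuous_image continuous_on_subset[OF smooth_fun_grad(2)[OF sm]]) auto
  then have "bounded (grad \<phi> ` cball 0 R)" by (rule compact_imp_bounded)
  then obtain L where "\<forall>y\<in>grad \<phi> ` cball 0 R. norm y \<le> L"
    unfolding bounded_iff by blast
  then have L: "norm (grad \<phi> x) \<le> L" if "norm x \<le> R" for x using that by simp
  have L': "norm (grad \<phi> x) \<le> \<bar>L\<bar>" for x
    using L[of x] g0[of x] by (cases "norm x \<le> R") auto
  have "lipschitz_support \<phi> \<bar>L\<bar> R"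
    by (rule lipschitz_support_of_derivative[OF d L']) (use R in force)
  then show ?thesis using L' g0 by blast
qed

lemma test_fun_measurable:
  assumes "test_fun (\<phi> :: 'a::euclidean_space \<Rightarrow> real)"
  shows "\<phi> \<in> borel_measurable borel" "grad \<phi> \<in> borel_measurable borel"
  using test_fun_facts[OF assms] lipschitz_support_measurable
    smooth_fun_grad(2)[of \<phi>] assms borel_measurable_continuous_onI by (auto simp: test_fun_def)

section \<open>Passage to the limit in integrals under convergence in L^p\<close>

lemma powr_interpolate:
  fixes e \<tau> s r :: real
  assumes "0 < s" "s \<le> r" "\<tau> > 0" "e \<ge> 0"
  shows "e powr s \<le> \<tau> powr s + \<tau> powr (s - r) * e powr r"
proof (cases "e \<le> \<tau>")
  case True
  then have "e powr s \<le> \<tau> powr s" using assms by (intro powr_mono2) auto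
  then show ?thesis by (simp add: add_increasing2)
next
  case False
  then have e: "e > 0" "\<tau> \<le> e" using assms by auto
  have "e powr s = e powr (s - r) * e powr r" by (simp add: powr_add[symmetric])
  also have "\<dots> \<le> \<tau> powr (s - r) * e powr r"
    using e assms by (intro mult_right_mono powr_mono2') auto
  finally show ?thesis by (simp add: add_increasing)
qed

text \<open>A case split at the threshold e = \<delta> a, in the spirit of Young's inequality but
  without conjugate exponents: below the threshold e is absorbed into a, above it a is bounded by
  e/\<delta>.\<close>

lemma powr_young:
  fixes a e \<delta> p :: real
  assumes "p > 1" "\<delta> > 0" "a \<ge> 0" "e \<ge> 0"
  shows "a powr (p - 1) * e \<le> \<delta> * a powr p + \<delta> powr (1 - p) * e powr p"
proof (cases "e \<le> \<delta> * a")
  case True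
  have "a powr (p - 1) * e \<le> a powr (p - 1) * (\<delta> * a)" using True by (intro mult_left_mono) auto
  also have "\<dots> = \<delta> * a powr p" using assms by (cases "a = 0") (auto simp: powr_diff)
  finally show ?thesis by (simp add: add_increasing2)
next
  case False
  then have e: "e > 0" using assms by (simp add: not_le) (meson assms less_eq_real_def mult_nonneg_nonneg order_le_less_trans)
  have "a \<le> e / \<delta>" using False assms by (simp add: field_simps)
  then have "a powr (p - 1) * e \<le> (e / \<delta>) powr (p - 1) * e" using assms e by (intro mult_right_mono powr_mono2) auto
  also have "\<dots> = \<delta> powr (1 - p) * e powr p" using assms e by (simp add: powr_divide powr_diff field_simps)
  finally show ?thesis using assms by (simp add: add_increasing)
qed

text \<open>The shape in which the threshold inequalities are used: the constant may depend on
  \<delta> but not on \<open>k\<close>, so \<delta> is fixed before \<open>k\<close> grows.\<close>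

lemma ennreal_null_by_split:
  fixes f a :: "nat \<Rightarrow> ennreal"
  assumes a: "a \<longlonglongrightarrow> 0" and f: "\<And>\<delta>. \<delta> > 0 \<Longrightarrow> \<exists>C::real. \<forall>k. f k \<le> ennreal \<delta> + ennreal C * a k"
  shows "f \<longlonglongrightarrow> 0"
proof (rule order_tendstoI)
  fix y :: ennreal assume "0 < y"
  then obtain z where z: "0 < z" "z < y" using dense by blast
  then obtain t where t: "z = ennreal t" "t > 0" by (cases z) auto
  obtain C where C: "\<And>k. f k \<le> ennreal (t / 2) + ennreal C * a k" using f[of "t / 2"] t by auto
  \<comment> \<open>\<open>C\<close> is an arbitrary real; the maximum with 1 makes it a legitimate
    divisor.\<close>
  define D where "D = max C 1"
  have "\<forall>\<^sub>F k in sequentially. a k < ennreal (t / (2 * D))"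
    using order_tendstoD(2)[OF a, of "ennreal (t / (2 * D))"] t by (simp add: D_def)
  then show "\<forall>\<^sub>F k in sequentially. f k < y"
  proof eventually_elim
    case (elim k)
    have "f k \<le> ennreal (t / 2) + ennreal C * a k" by (rule C)
    also have "\<dots> \<le> ennreal (t / 2) + ennreal D * ennreal (t / (2 * D))"
      using elim by (intro add_left_mono mult_mono ennreal_leI) (auto simp: D_def)
    also have "\<dots> = ennreal t" using t by (simp add: ennreal_mult[symmetric] ennreal_plus[symmetric] D_def del: ennreal_plus)
    also have "\<dots> < y" using z t by simp
    finally show ?case .
  qed
qed simp

text \<open>The pointwise bound e^s <= \<tau>^s + \<tau>^{s-r} e^r takes the place of Hoelder's
  inequality on the ball: the contribution of \<tau>^s is small by the choice of \<tau>, and the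
  other one tends to zero for fixed \<tau>.\<close>

lemma nn_integral_local_convergence:
  fixes e :: "nat \<Rightarrow> 'a::euclidean_space \<Rightarrow> real"
  assumes [measurable]: "\<And>k. e k \<in> borel_measurable lborel" and "0 < s" "s \<le> r" "\<And>k x. e k x \<ge> 0"
    and lim: "(\<lambda>k. \<integral>\<^sup>+ x. ennreal (e k x powr r) \<partial>lborel) \<longlonglongrightarrow> 0"
  shows "(\<lambda>k. \<integral>\<^sup>+ x. ennreal (e k x powr s) * indicator (cball 0 R) x \<partial>lborel) \<longlonglongrightarrow> 0"
proof (rule ennreal_null_by_split[OF lim])
  fix \<delta> :: real assume \<delta>: "\<delta> > 0"
  define m where "m = measure lborel (cball (0::'a) R)"
  have m: "emeasure lborel (cball (0::'a) R) = ennreal m" "m \<ge> 0"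
    using emeasure_bounded_finite[of "cball (0::'a) R"] by (auto simp: m_def emeasure_eq_ennreal_measure)
  \<comment> \<open>Chosen so that \<tau>^s times the volume m of the ball is at most \<delta>; the
    summand 1 avoids a division by zero for an empty or degenerate ball.\<close>
  define \<tau> where "\<tau> = (\<delta> / (m + 1)) powr (1 / s)"
  have \<tau>: "\<tau> > 0" "\<tau> powr s = \<delta> / (m + 1)" using \<delta> m assms by (auto simp: \<tau>_def powr_powr)
  show "\<exists>C. \<forall>k. (\<integral>\<^sup>+ x. ennreal (e k x powr s) * indicator (cball 0 R) x \<partial>lborel) \<le>
     ennreal \<delta> + ennreal C * (\<integral>\<^sup>+ x. ennreal (e k x powr r) \<partial>lborel)"
  proof (intro exI[of _ "\<tau> powr (s - r)"] allI)
    fix k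
    have "(\<integral>\<^sup>+ x. ennreal (e k x powr s) * indicator (cball 0 R) x \<partial>lborel) \<le>
       (\<integral>\<^sup>+ x. ennreal (\<tau> powr s) * indicator (cball 0 R) x + ennreal (\<tau> powr (s - r)) * ennreal (e k x powr r) \<partial>lborel)"
    proof (intro nn_integral_mono)
      fix x
      have "ennreal (e k x powr s) \<le> ennreal (\<tau> powr s + \<tau> powr (s - r) * e k x powr r)"
        using powr_interpolate[of s r \<tau> "e k x"] assms \<tau> by (intro ennreal_leI) auto
      then show "ennreal (e k x powr s) * indicator (cball 0 R) x \<le>
         ennreal (\<tau> powr s) * indicator (cball 0 R) x + ennreal (\<tau> powr (s - r)) * ennreal (e k x powr r)"
        by (auto simp: ennreal_mult[symmetric] split: split_indicator)
    qed
    also have "\<dots> = ennreal (\<tau> powr s) * ennreal m + ennreal (\<tau> powr (s - r)) * (\<integral>\<^sup>+ x. ennreal (e k x powr r) \<partial>lborel)"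
      by (subst nn_integral_add, measurable, measurable)
        (simp add: nn_integral_cmult_indicator nn_integral_cmult m(1))
    also have "\<dots> \<le> ennreal \<delta> + ennreal (\<tau> powr (s - r)) * (\<integral>\<^sup>+ x. ennreal (e k x powr r) \<partial>lborel)"
      using \<tau> m \<delta> by (intro add_right_mono) (auto simp: ennreal_mult[symmetric] field_simps intro!: ennreal_leI)
    finally show "(\<integral>\<^sup>+ x. ennreal (e k x powr s) * indicator (cball 0 R) x \<partial>lborel) \<le>
     ennreal \<delta> + ennreal (\<tau> powr (s - r)) * (\<integral>\<^sup>+ x. ennreal (e k x powr r) \<partial>lborel)" .
  qed
qed

text \<open>Pairs a fixed weight of the size of the flux, G^{p-1} with G in L^p, with an error that
  tends to zero in L^p on \<open>B\<close>. The part \<eta> G^p is made small by \<eta>, whatever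
  the error is.\<close>

lemma nn_integral_young_convergence:
  fixes e :: "nat \<Rightarrow> 'a::euclidean_space \<Rightarrow> real"
  assumes [measurable]: "\<And>k. e k \<in> borel_measurable lborel" "G \<in> borel_measurable lborel"
    and "p > 1" "\<And>k x. e k x \<ge> 0" "\<And>x. G x \<ge> 0"
    and G: "(\<integral>\<^sup>+ x. ennreal (G x powr p) \<partial>lborel) < \<infinity>"
    and lim: "(\<lambda>k. \<integral>\<^sup>+ x. ennreal (e k x powr p) * indicator B x \<partial>lborel) \<longlonglongrightarrow> 0"
    and [measurable]: "B \<in> sets borel"
  shows "(\<lambda>k. \<integral>\<^sup>+ x. ennreal (G x powr (p - 1) * e k x) * indicator B x \<partial>lborel) \<longlonglongrightarrow> 0"
proof (rule ennreal_null_by_split[OF lim])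
  fix \<delta> :: real assume \<delta>: "\<delta> > 0"
  obtain m where m: "(\<integral>\<^sup>+ x. ennreal (G x powr p) \<partial>lborel) = ennreal m" "m \<ge> 0"
    using G by (cases "\<integral>\<^sup>+ x. ennreal (G x powr p) \<partial>lborel") auto
  define \<eta> where "\<eta> = \<delta> / (m + 1)"
  have \<eta>: "\<eta> > 0" using \<delta> m by (auto simp: \<eta>_def)
  show "\<exists>C. \<forall>k. (\<integral>\<^sup>+ x. ennreal (G x powr (p - 1) * e k x) * indicator B x \<partial>lborel) \<le>
     ennreal \<delta> + ennreal C * (\<integral>\<^sup>+ x. ennreal (e k x powr p) * indicator B x \<partial>lborel)"
  proof (intro exI[of _ "\<eta> powr (1 - p)"] allI)
    fix k
    have "(\<integral>\<^sup>+ x. ennreal (G x powr (p - 1) * e k x) * indicator B x \<partial>lborel) \<le>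
       (\<integral>\<^sup>+ x. ennreal \<eta> * ennreal (G x powr p) + ennreal (\<eta> powr (1 - p)) * (ennreal (e k x powr p) * indicator B x) \<partial>lborel)"
    proof (intro nn_integral_mono)
      fix x
      have "ennreal (G x powr (p - 1) * e k x) \<le> ennreal (\<eta> * G x powr p + \<eta> powr (1 - p) * e k x powr p)"
        using powr_young[of p \<eta> "G x" "e k x"] assms \<eta> by (intro ennreal_leI) auto
      then show "ennreal (G x powr (p - 1) * e k x) * indicator B x \<le>
         ennreal \<eta> * ennreal (G x powr p) + ennreal (\<eta> powr (1 - p)) * (ennreal (e k x powr p) * indicator B x)"
        using \<eta> by (auto simp: ennreal_mult[symmetric] split: split_indicator)
    qed
    also have "\<dots> = ennreal \<eta> * ennreal m + ennreal (\<eta> powr (1 - p)) * (\<integral>\<^sup>+ x. ennreal (e k x powr p) * indicator B x \<partial>lborel)"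
      by (subst nn_integral_add, measurable, measurable) (simp add: nn_integral_cmult m(1))
    also have "\<dots> \<le> ennreal \<delta> + ennreal (\<eta> powr (1 - p)) * (\<integral>\<^sup>+ x. ennreal (e k x powr p) * indicator B x \<partial>lborel)"
      using m \<delta> by (intro add_right_mono) (auto simp: \<eta>_def ennreal_mult[symmetric] field_simps intro!: ennreal_leI)
    finally show "(\<integral>\<^sup>+ x. ennreal (G x powr (p - 1) * e k x) * indicator B x \<partial>lborel) \<le>
     ennreal \<delta> + ennreal (\<eta> powr (1 - p)) * (\<integral>\<^sup>+ x. ennreal (e k x powr p) * indicator B x \<partial>lborel)" .
  qed
qed

lemma nn_integral_weighted_null:
  fixes e h :: "nat \<Rightarrow> 'a::euclidean_space \<Rightarrow> real"
  assumes lim: "(\<lambda>k. \<integral>\<^sup>+ x. ennreal (e k x) * indicator B x \<partial>lborel) \<longlonglongrightarrow> 0"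
    and [measurable]: "\<And>k. e k \<in> borel_measurable lborel" "B \<in> sets borel"
    and e: "\<And>k x. e k x \<ge> 0" and C: "C \<ge> 0"
    and le: "\<And>k. AE x in lborel. \<bar>h k x\<bar> \<le> C * e k x * indicator B x"
  shows "(\<lambda>k. \<integral>\<^sup>+ x. ennreal \<bar>h k x\<bar> \<partial>lborel) \<longlonglongrightarrow> 0"
proof (rule ennreal_null_by_split[OF lim])
  fix \<delta> :: real assume "\<delta> > 0"
  show "\<exists>C. \<forall>k. (\<integral>\<^sup>+ x. ennreal \<bar>h k x\<bar> \<partial>lborel) \<le> ennreal \<delta> + ennreal C * (\<integral>\<^sup>+ x. ennreal (e k x) * indicator B x \<partial>lborel)"
  proof (intro exI[of _ C] allI)
    fix k
    have "(\<integral>\<^sup>+ x. ennreal \<bar>h k x\<bar> \<partial>lborel) \<le> (\<integral>\<^sup>+ x. ennreal C * (ennreal (e k x) * indicator B x) \<partial>lborel)"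
    proof (intro nn_integral_mono_AE)
      show "AE x in lborel. ennreal \<bar>h k x\<bar> \<le> ennreal C * (ennreal (e k x) * indicator B x)"
        using le[of k]
      proof eventually_elim
        case (elim x)
        then have "ennreal \<bar>h k x\<bar> \<le> ennreal (C * e k x * indicator B x)" by (rule ennreal_leI)
        then show ?case using e C by (auto simp: ennreal_mult split: split_indicator)
      qed
    qed
    also have "\<dots> = ennreal C * (\<integral>\<^sup>+ x. ennreal (e k x) * indicator B x \<partial>lborel)"
      by (rule nn_integral_cmult) auto
    also have "\<dots> \<le> ennreal \<delta> + \<dots>" by simp
    finally show "(\<integral>\<^sup>+ x. ennreal \<bar>h k x\<bar> \<partial>lborel) \<le> ennreal \<delta> + ennreal C * (\<integral>\<^sup>+ x. ennreal (e k x) * indicator B x \<partial>lborel)" .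
  qed
qed

lemma integral_convergence_L1:
  fixes f :: "nat \<Rightarrow> 'a::euclidean_space \<Rightarrow> real"
  assumes f: "\<And>k. integrable lborel (f k)" and [measurable]: "F \<in> borel_measurable lborel"
    and lim: "(\<lambda>k. \<integral>\<^sup>+ x. ennreal \<bar>f k x - F x\<bar> \<partial>lborel) \<longlonglongrightarrow> 0"
  shows "integrable lborel F" "(\<lambda>k. \<integral>x. f k x \<partial>lborel) \<longlonglongrightarrow> (\<integral>x. F x \<partial>lborel)"
proof -
  have [measurable]: "f k \<in> borel_measurable lborel" for k using f by auto
  have "\<forall>\<^sub>F k in sequentially. (\<integral>\<^sup>+ x. ennreal \<bar>f k x - F x\<bar> \<partial>lborel) < 1"
    using order_tendstoD(2)[OF lim] by simp
  then obtain k where "(\<integral>\<^sup>+ x. ennreal \<bar>f k x - F x\<bar> \<partial>lborel) < 1"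
    using eventually_happens by fastforce
  then have "integrable lborel (\<lambda>x. f k x - F x)"
    by (intro integrableI_bounded) (auto intro: order.strict_trans)
  from Bochner_Integration.integrable_diff[OF f[of k] this] show F: "integrable lborel F" by simp
  show "(\<lambda>k. \<integral>x. f k x \<partial>lborel) \<longlonglongrightarrow> (\<integral>x. F x \<partial>lborel)"
    by (rule tendsto_L1_int[OF f F]) (use lim in simp)
qed

section \<open>Integrability and integration by parts for functions of the energy space\<close>

lemma sob_exp_ge:
  assumes "1 < p" "p < real DIM('a::euclidean_space)"
  shows "sob_exp TYPE('a) p \<ge> p"
proof -
  have "p * (real DIM('a) - p) \<le> p * real DIM('a)" using assms by (intro mult_left_mono) auto
  then show ?thesis using assms by (simp add: sob_exp_def field_simps)
qed

lemma local_integrable_powr: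
  fixes f :: "'a::euclidean_space \<Rightarrow> real"
  assumes [measurable]: "f \<in> borel_measurable lborel" and fin: "(\<integral>\<^sup>+ x. ennreal (\<bar>f x\<bar> powr r) \<partial>lborel) < \<infinity>"
    and s: "0 < s" "s \<le> r"
  shows "integrable lborel (\<lambda>x. indicator (cball 0 R) x * \<bar>f x\<bar> powr s)"
proof (rule Bochner_Integration.integrable_bound)
  have "integrable lborel (\<lambda>x. \<bar>f x\<bar> powr r)" using fin by (intro integrableI_bounded) auto
  then show "integrable lborel (\<lambda>x. indicator (cball 0 R) x + \<bar>f x\<bar> powr r)"
    by (intro Bochner_Integration.integrable_add integrable_real_indicator)
      (auto simp: emeasure_bounded_finite[unfolded infinity_ennreal_def])
  show "AE x in lborel. norm (indicator (cball 0 R) x * \<bar>f x\<bar> powr s) \<le> norm (indicator (cball 0 R) x + \<bar>f x\<bar> powr r)"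
  proof (intro AE_I2)
    fix x
    show "norm (indicator (cball 0 R) x * \<bar>f x\<bar> powr s) \<le> norm (indicator (cball 0 R) x + \<bar>f x\<bar> powr r)"
      using powr_interpolate[of s r 1 "\<bar>f x\<bar>"] s by (auto split: split_indicator)
  qed
qed measurable

text \<open>A single test function at finite distance from \<open>u\<close> suffices: it is bounded
  with bounded support, and |u| is at most twice the larger of it and the difference.\<close>

lemma D1p_Lsob:
  assumes D: "D1p_grad p (u :: 'a::euclidean_space \<Rightarrow> real) g" and p: "1 < p" "p < real DIM('a)"
  shows "(\<integral>\<^sup>+ x. ennreal (\<bar>u x\<bar> powr sob_exp TYPE('a) p) \<partial>lborel) < \<infinity>"
proof -
  define q where "q = sob_exp TYPE('a) p"
  have q: "q > 1" using sob_exp_ge[OF p] p by (simp add: q_def)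
  from D obtain \<phi> :: "nat \<Rightarrow> 'a \<Rightarrow> real" where \<phi>: "\<And>k. test_fun (\<phi> k)"
    and lim: "(\<lambda>k. \<integral>\<^sup>+ x. ennreal (\<bar>\<phi> k x - u x\<bar> powr q) \<partial>lborel) \<longlonglongrightarrow> 0"
    and [measurable]: "u \<in> borel_measurable lborel"
    unfolding D1p_grad_def q_def by blast
  have [measurable]: "\<phi> k \<in> borel_measurable lborel" for k using test_fun_measurable[OF \<phi>] by simp
  have "\<forall>\<^sub>F k in sequentially. (\<integral>\<^sup>+ x. ennreal (\<bar>\<phi> k x - u x\<bar> powr q) \<partial>lborel) < 1"
    using order_tendstoD(2)[OF lim] by simp
  then obtain k where k: "(\<integral>\<^sup>+ x. ennreal (\<bar>\<phi> k x - u x\<bar> powr q) \<partial>lborel) < 1"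
    using eventually_happens by fastforce
  obtain R L where RL: "lipschitz_support (\<phi> k) L R" using test_fun_facts[OF \<phi>] by blast
  obtain C where C: "\<And>x. \<bar>\<phi> k x\<bar> \<le> C" using lipschitz_support_bounded[OF RL] by blast
  have i1: "integrable lborel (\<lambda>x. \<bar>\<phi> k x\<bar> powr q)"
    by (rule integrable_bounded_support[of _ "C powr q" R])
      (use C RL q in \<open>auto simp: lipschitz_support_def intro!: powr_mono2\<close>)
  have i2: "integrable lborel (\<lambda>x. \<bar>\<phi> k x - u x\<bar> powr q)"
    using k by (intro integrableI_bounded) (auto intro: order.strict_trans)
  have "integrable lborel (\<lambda>x. \<bar>u x\<bar> powr q)"
  proof (rule Bochner_Integration.integrable_bound)
    show "integrable lborel (\<lambda>x. 2 powr q * (\<bar>\<phi> k x\<bar> powr q + \<bar>\<phi> k x - u x\<bar> powr q))" using i1 i2 by auto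
    show "AE x in lborel. norm (\<bar>u x\<bar> powr q) \<le> norm (2 powr q * (\<bar>\<phi> k x\<bar> powr q + \<bar>\<phi> k x - u x\<bar> powr q))"
    proof (intro AE_I2)
      fix x
      define m where "m = max \<bar>\<phi> k x\<bar> \<bar>\<phi> k x - u x\<bar>"
      have "\<bar>u x\<bar> \<le> \<bar>\<phi> k x\<bar> + \<bar>\<phi> k x - u x\<bar>" by linarith
      also have "\<dots> \<le> 2 * m" unfolding m_def by (auto simp: max_def)
      finally have "\<bar>u x\<bar> \<le> 2 * m" .
      then have "\<bar>u x\<bar> powr q \<le> (2 * m) powr q" using q by (intro powr_mono2) auto
      also have "\<dots> = 2 powr q * m powr q" by (simp add: powr_mult m_def)
      also have "m powr q \<le> \<bar>\<phi> k x\<bar> powr q + \<bar>\<phi> k x - u x\<bar> powr q"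
        by (cases "\<bar>\<phi> k x\<bar> \<le> \<bar>\<phi> k x - u x\<bar>") (auto simp: m_def max_def)
      finally show "norm (\<bar>u x\<bar> powr q) \<le> norm (2 powr q * (\<bar>\<phi> k x\<bar> powr q + \<bar>\<phi> k x - u x\<bar> powr q))" by simp
    qed
  qed measurable
  then show ?thesis by (simp add: integrable_iff_bounded q_def)
qed

lemma D1p_local_integrable:
  assumes D: "D1p_grad p (u :: 'a::euclidean_space \<Rightarrow> real) g" and p: "1 < p" "p < real DIM('a)"
  shows "integrable lborel (\<lambda>x. indicator (cball 0 R) x * \<bar>u x\<bar>)"
    "integrable lborel (\<lambda>x. indicator (cball 0 R) x * norm (g x))"
    "integrable lborel (\<lambda>x. indicator (cball 0 R) x * norm (g x) powr (p - 1))"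
proof -
  have [measurable]: "u \<in> borel_measurable lborel" "g \<in> borel_measurable lborel"
    and g: "(\<integral>\<^sup>+ x. ennreal (norm (g x) powr p) \<partial>lborel) < \<infinity>"
    using D unfolding D1p_grad_def by auto
  show "integrable lborel (\<lambda>x. indicator (cball 0 R) x * \<bar>u x\<bar>)"
    using local_integrable_powr[OF _ D1p_Lsob[OF D p], of 1 R] sob_exp_ge[OF p] p by simp
  show "integrable lborel (\<lambda>x. indicator (cball 0 R) x * norm (g x))"
    using local_integrable_powr[of "\<lambda>x. norm (g x)" p 1 R] g p by simp
  show "integrable lborel (\<lambda>x. indicator (cball 0 R) x * norm (g x) powr (p - 1))"
    using local_integrable_powr[of "\<lambda>x. norm (g x)" p "p - 1" R] g p by simp
qed

text \<open>For an approximating test function the product with \<Phi> is Lipschitz with bounded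
  support, so its directional derivative integrates to zero. Both terms of the product rule survive
  the limit because \<Phi> and \<open>d\<close> are bounded and vanish off a ball, on which the
  approximants and their gradients converge in L^1.\<close>

lemma D1p_weak_gradient:
  assumes D: "D1p_grad p (u :: 'a::euclidean_space \<Rightarrow> real) g" and p: "1 < p" "p < real DIM('a)"
    and F: "lipschitz_support \<Phi> L R" and b: "b \<in> Basis"
    and [measurable]: "d \<in> borel_measurable lborel"
    and d: "AE x in lborel. ((\<lambda>h. \<Phi> (x + h *\<^sub>R b)) has_real_derivative d x) (at 0)"
  shows "integrable lborel (\<lambda>x. (g x \<bullet> b) * \<Phi> x)" "integrable lborel (\<lambda>x. u x * d x)"
    "(\<integral>x. (g x \<bullet> b) * \<Phi> x \<partial>lborel) = - (\<integral>x. u x * d x \<partial>lborel)"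
proof -
  from D obtain \<phi> :: "nat \<Rightarrow> 'a \<Rightarrow> real" where \<phi>: "\<And>k. test_fun (\<phi> k)"
    and limg: "(\<lambda>k. \<integral>\<^sup>+ x. ennreal (norm (grad (\<phi> k) x - g x) powr p) \<partial>lborel) \<longlonglongrightarrow> 0"
    and limu: "(\<lambda>k. \<integral>\<^sup>+ x. ennreal (\<bar>\<phi> k x - u x\<bar> powr sob_exp TYPE('a) p) \<partial>lborel) \<longlonglongrightarrow> 0"
    and [measurable]: "u \<in> borel_measurable lborel" "g \<in> borel_measurable lborel"
    unfolding D1p_grad_def by blast
  have [measurable]: "\<phi> k \<in> borel_measurable lborel" "grad (\<phi> k) \<in> borel_measurable lborel" for k
    using test_fun_measurable[OF \<phi>] by auto
  have [measurable]: "\<Phi> \<in> borel_measurable lborel" using lipschitz_support_measurable[OF F] by simp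
  obtain C where C: "C \<ge> 0" "\<And>x. \<bar>\<Phi> x\<bar> \<le> C" using lipschitz_support_bounded[OF F] by blast
  have supp: "\<Phi> x = 0" if "norm x > R" for x using F that by (auto simp: lipschitz_support_def)
  have db: "AE x in lborel. \<bar>d x\<bar> \<le> \<bar>L\<bar> * indicator (cball 0 R) x"
    using d
  proof eventually_elim
    case (elim x)
    show ?case using lipschitz_support_derivative_bound[OF F b elim] by (auto split: split_indicator)
  qed
  have bn: "\<bar>v \<bullet> b\<bar> \<le> norm v" for v using Basis_le_norm[OF b] by simp
  have lg: "(\<lambda>k. \<integral>\<^sup>+ x. ennreal (norm (grad (\<phi> k) x - g x)) * indicator (cball 0 R) x \<partial>lborel) \<longlonglongrightarrow> 0"
    using nn_integral_local_convergence[OF _ _ _ _ limg, of 1 R] p by simp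
  have lu: "(\<lambda>k. \<integral>\<^sup>+ x. ennreal \<bar>\<phi> k x - u x\<bar> * indicator (cball 0 R) x \<partial>lborel) \<longlonglongrightarrow> 0"
    using nn_integral_local_convergence[OF _ _ _ _ limu, of 1 R] sob_exp_ge[OF p] p by simp
  have i1: "integrable lborel (\<lambda>x. (grad (\<phi> k) x \<bullet> b) * \<Phi> x)" for k
  proof -
    obtain R' L' where "\<And>x. norm (grad (\<phi> k) x) \<le> L'" using test_fun_facts[OF \<phi>] by blast
    then have "\<bar>grad (\<phi> k) x \<bullet> b\<bar> \<le> L'" for x using bn order_trans by blast
    then have "\<bar>grad (\<phi> k) x \<bullet> b\<bar> * \<bar>\<Phi> x\<bar> \<le> L' * C" for x using C by (intro mult_mono) (auto intro: order_trans[OF abs_ge_zero])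
    then show ?thesis
      by (intro integrable_bounded_support[of _ "L' * C" R]) (auto simp: abs_mult supp)
  qed
  have i2: "integrable lborel (\<lambda>x. \<phi> k x * d x)" for k
  proof -
    obtain R' L' where RL: "lipschitz_support (\<phi> k) L' R'" using test_fun_facts[OF \<phi>] by blast
    obtain C' where C': "C' \<ge> 0" "\<And>x. \<bar>\<phi> k x\<bar> \<le> C'" using lipschitz_support_bounded[OF RL] by blast
    show ?thesis
    proof (rule integrable_bounded_support[of _ "C' * \<bar>L\<bar>" R])
      show "AE x in lborel. norm (\<phi> k x * d x) \<le> C' * \<bar>L\<bar>"
        using db
      proof eventually_elim
        case (elim x)
        then have "\<bar>d x\<bar> \<le> \<bar>L\<bar>" by (auto split: split_indicator_asm)
        then show ?case using C' by (simp add: abs_mult mult_mono)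
      qed
      show "AE x in lborel. R < norm x \<longrightarrow> \<phi> k x * d x = 0"
        using db by eventually_elim (auto split: split_indicator_asm)
    qed measurable
  qed
  have zero: "(\<integral>x. (grad (\<phi> k) x \<bullet> b) * \<Phi> x \<partial>lborel) + (\<integral>x. \<phi> k x * d x \<partial>lborel) = 0" for k
  proof -
    obtain R' L' where RL: "lipschitz_support (\<phi> k) L' R'" using test_fun_facts[OF \<phi>] by blast
    obtain L'' where L'': "lipschitz_support (\<lambda>x. \<phi> k x * \<Phi> x) L'' R'" using lipschitz_support_mult[OF RL F] by blast
    have sm: "smooth_fun (\<phi> k)" using \<phi>[of k] by (simp add: test_fun_def)
    have "(\<integral>x. (grad (\<phi> k) x \<bullet> b) * \<Phi> x + \<phi> k x * d x \<partial>lborel) = 0"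
    proof (rule integral_directional_derivative_zero(2)[OF L'' b])
      show "AE x in lborel. ((\<lambda>h. \<phi> k (x + h *\<^sub>R b) * \<Phi> (x + h *\<^sub>R b)) has_real_derivative
         (grad (\<phi> k) x \<bullet> b) * \<Phi> x + \<phi> k x * d x) (at 0)"
        using d
      proof eventually_elim
        case (elim x)
        from DERIV_mult[OF has_derivative_directional[OF smooth_fun_grad(1)[OF sm]] elim]
        show ?case by (simp add: mult.commute add.commute)
      qed
    qed measurable
    then show ?thesis by (simp add: Bochner_Integration.integral_add[OF i1 i2])
  qed
  have c1: "(\<lambda>k. \<integral>\<^sup>+ x. ennreal \<bar>(grad (\<phi> k) x \<bullet> b) * \<Phi> x - (g x \<bullet> b) * \<Phi> x\<bar> \<partial>lborel) \<longlonglongrightarrow> 0"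
  proof (rule nn_integral_weighted_null[OF lg _ _ _ C(1)])
    fix k
    show "AE x in lborel. \<bar>(grad (\<phi> k) x \<bullet> b) * \<Phi> x - (g x \<bullet> b) * \<Phi> x\<bar> \<le> C * norm (grad (\<phi> k) x - g x) * indicator (cball 0 R) x"
    proof (intro AE_I2)
      fix x
      have "\<bar>(grad (\<phi> k) x \<bullet> b) * \<Phi> x - (g x \<bullet> b) * \<Phi> x\<bar> = \<bar>\<Phi> x\<bar> * \<bar>(grad (\<phi> k) x - g x) \<bullet> b\<bar>"
        by (simp add: abs_mult[symmetric] algebra_simps)
      also have "\<dots> \<le> C * norm (grad (\<phi> k) x - g x)" using C bn by (intro mult_mono) auto
      finally show "\<bar>(grad (\<phi> k) x \<bullet> b) * \<Phi> x - (g x \<bullet> b) * \<Phi> x\<bar> \<le> C * norm (grad (\<phi> k) x - g x) * indicator (cball 0 R) x"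
        using supp[of x] by (auto split: split_indicator)
    qed
  qed auto
  have c2: "(\<lambda>k. \<integral>\<^sup>+ x. ennreal \<bar>\<phi> k x * d x - u x * d x\<bar> \<partial>lborel) \<longlonglongrightarrow> 0"
  proof (rule nn_integral_weighted_null[OF lu, where C = "\<bar>L\<bar>"])
    fix k
    show "AE x in lborel. \<bar>\<phi> k x * d x - u x * d x\<bar> \<le> \<bar>L\<bar> * \<bar>\<phi> k x - u x\<bar> * indicator (cball 0 R) x"
      using db
    proof eventually_elim
      case (elim x)
      have "\<bar>\<phi> k x * d x - u x * d x\<bar> = \<bar>\<phi> k x - u x\<bar> * \<bar>d x\<bar>" by (simp add: abs_mult[symmetric] algebra_simps)
      also have "\<dots> \<le> \<bar>\<phi> k x - u x\<bar> * (\<bar>L\<bar> * indicator (cball 0 R) x)" using elim by (intro mult_left_mono) auto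
      finally show ?case by (simp add: mult_ac)
    qed
  qed auto
  have m1: "(\<lambda>x. (g x \<bullet> b) * \<Phi> x) \<in> borel_measurable lborel" "(\<lambda>x. u x * d x) \<in> borel_measurable lborel" by measurable
  show "integrable lborel (\<lambda>x. (g x \<bullet> b) * \<Phi> x)" by (rule integral_convergence_L1(1)[OF i1 m1(1) c1])
  show "integrable lborel (\<lambda>x. u x * d x)" by (rule integral_convergence_L1(1)[OF i2 m1(2) c2])
  have "(\<lambda>k. (\<integral>x. (grad (\<phi> k) x \<bullet> b) * \<Phi> x \<partial>lborel) + (\<integral>x. \<phi> k x * d x \<partial>lborel)) \<longlonglongrightarrow>
     (\<integral>x. (g x \<bullet> b) * \<Phi> x \<partial>lborel) + (\<integral>x. u x * d x \<partial>lborel)"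
    by (intro tendsto_add integral_convergence_L1(2)[OF i1 m1(1) c1] integral_convergence_L1(2)[OF i2 m1(2) c2])
  then have "(\<integral>x. (g x \<bullet> b) * \<Phi> x \<partial>lborel) + (\<integral>x. u x * d x \<partial>lborel) = 0"
    by (simp add: zero LIMSEQ_const_iff)
  then show "(\<integral>x. (g x \<bullet> b) * \<Phi> x \<partial>lborel) = - (\<integral>x. u x * d x \<partial>lborel)" by linarith
qed

text \<open>These are the diagonal entries of the Jacobian of x -> \<psi>(|x|) x; their sum over the
  basis is the divergence N \<psi> + r \<psi>'.\<close>

lemma radial_directional_derivative:
  assumes x: "x \<noteq> (0::'a::euclidean_space)" and b: "b \<in> Basis"
    and d: "(\<psi> has_real_derivative \<psi>') (at (norm x))"
  shows "((\<lambda>h. \<psi> (norm (x + h *\<^sub>R b)) * ((x + h *\<^sub>R b) \<bullet> b)) has_real_derivative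
     \<psi> (norm x) + \<psi>' * (x \<bullet> b)\<^sup>2 / norm x) (at 0)"
proof -
  have "(norm has_derivative (\<lambda>h. h \<bullet> sgn x)) (at x)" using has_derivative_norm[OF x] by (simp add: inner_commute)
  from has_derivative_directional[OF this, of b]
  have n: "((\<lambda>h. norm (x + h *\<^sub>R b)) has_real_derivative sgn x \<bullet> b) (at 0)" .
  have c: "((\<lambda>h. \<psi> (norm (x + h *\<^sub>R b))) has_real_derivative \<psi>' * (sgn x \<bullet> b)) (at 0)"
    by (rule DERIV_chain2[OF _ n]) (use d in simp)
  have l: "((\<lambda>h. (x + h *\<^sub>R b) \<bullet> b) has_real_derivative 1) (at 0)"
    using b by (auto intro!: derivative_eq_intros simp: inner_add_left inner_Basis)
  show ?thesis
    by (rule DERIV_cong[OF DERIV_mult[OF c l]]) (simp add: sgn_div_norm power2_eq_square divide_inverse)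
qed

text \<open>The difference of the products is split so that the increment of \<psi> is multiplied by
  x . b. This factor is bounded only for x in the ball of radius \<open>R\<close>, which may be
  assumed by symmetry, since both terms vanish when both points lie outside.\<close>

lemma radial_field_lipschitz:
  assumes lip: "\<And>r s. 0 \<le> r \<Longrightarrow> 0 \<le> s \<Longrightarrow> \<bar>\<psi> r - \<psi> s\<bar> \<le> L * \<bar>r - s\<bar>"
    and R: "R \<ge> 0" "\<And>r. r > R \<Longrightarrow> \<psi> r = (0::real)" and b: "b \<in> (Basis :: 'a::euclidean_space set)"
  shows "\<exists>L'. lipschitz_support (\<lambda>x::'a. \<psi> (norm x) * (x \<bullet> b)) L' R"
proof -
  have L0: "L \<ge> 0" using lip[of 0 1] by simp
  \<comment> \<open>\<psi> vanishes at \<open>R + 1\<close>, so its values are bounded by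
    \<open>L\<close> times the distance to that radius.\<close>
  define M where "M = L * (R + 1)"
  have M: "\<bar>\<psi> r\<bar> \<le> M" if "r \<ge> 0" for r
  proof (cases "r > R")
    case False
    have "\<bar>\<psi> r - \<psi> (R + 1)\<bar> \<le> L * \<bar>r - (R + 1)\<bar>" using that R by (intro lip) auto
    also have "\<dots> \<le> M" unfolding M_def using that False L0 by (intro mult_left_mono) auto
    finally show ?thesis using R(2)[of "R + 1"] by simp
  qed (use R L0 in \<open>simp add: M_def\<close>)
  have le: "\<bar>\<psi> (norm x) * (x \<bullet> b) - \<psi> (norm y) * (y \<bullet> b)\<bar> \<le> (L * R + M) * norm (x - y)"
    if x: "norm x \<le> R" for x y :: 'a
  proof -
    have "\<bar>\<psi> (norm x) * (x \<bullet> b) - \<psi> (norm y) * (y \<bullet> b)\<bar> =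
       \<bar>(\<psi> (norm x) - \<psi> (norm y)) * (x \<bullet> b) + \<psi> (norm y) * ((x - y) \<bullet> b)\<bar>" by (simp add: algebra_simps)
    also have "\<dots> \<le> \<bar>\<psi> (norm x) - \<psi> (norm y)\<bar> * \<bar>x \<bullet> b\<bar> + \<bar>\<psi> (norm y)\<bar> * \<bar>(x - y) \<bullet> b\<bar>"
      by (simp add: abs_mult[symmetric] abs_triangle_ineq)
    also have "\<dots> \<le> (L * norm (x - y)) * R + M * norm (x - y)"
    proof (intro add_mono mult_mono M)
      have "\<bar>\<psi> (norm x) - \<psi> (norm y)\<bar> \<le> L * \<bar>norm x - norm y\<bar>" by (rule lip) auto
      also have "\<dots> \<le> L * norm (x - y)" using L0 by (intro mult_left_mono norm_triangle_ineq3) auto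
      finally show "\<bar>\<psi> (norm x) - \<psi> (norm y)\<bar> \<le> L * norm (x - y)" .
      show "\<bar>x \<bullet> b\<bar> \<le> R" using Basis_le_norm[OF b, of x] x by simp
      show "\<bar>(x - y) \<bullet> b\<bar> \<le> norm (x - y)" by (rule Basis_le_norm[OF b])
    qed (use L0 R in \<open>auto simp: M_def\<close>)
    finally show ?thesis by (simp add: algebra_simps)
  qed
  have "\<bar>\<psi> (norm x) * (x \<bullet> b) - \<psi> (norm y) * (y \<bullet> b)\<bar> \<le> (L * R + M) * norm (x - y)" for x y :: 'a
  proof (cases "norm x \<le> R")
    case False
    show ?thesis
    proof (cases "norm y \<le> R")
      case True
      from le[OF True, of x] show ?thesis by (simp add: norm_minus_commute abs_minus_commute)
    next
      case nf: False
      then show ?thesis using False R L0 by (simp add: M_def)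
    qed
  qed (rule le)
  then show ?thesis using R(2) unfolding lipschitz_support_def by auto
qed

text \<open>The componentwise identities summed over the basis: the divergence of \<psi>(|x|) x
  falls on \<open>u\<close>. The finite set \<open>S\<close> admits profiles with kinks, such as
  truncated parabolas.\<close>

lemma D1p_radial_field:
  assumes D: "D1p_grad p (u :: 'a::euclidean_space \<Rightarrow> real) g" and p: "1 < p" "p < real DIM('a)"
    and lip: "\<And>r s. 0 \<le> r \<Longrightarrow> 0 \<le> s \<Longrightarrow> \<bar>\<psi> r - \<psi> s\<bar> \<le> L * \<bar>r - s\<bar>"
    and R: "R \<ge> 0" "\<And>r. r > R \<Longrightarrow> \<psi> r = (0::real)" and S: "finite S"
    and d: "\<And>r. r > 0 \<Longrightarrow> r \<notin> S \<Longrightarrow> (\<psi> has_real_derivative \<psi>' r) (at r)"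
    and [measurable]: "\<psi> \<in> borel_measurable borel" "\<psi>' \<in> borel_measurable borel"
  shows "integrable lborel (\<lambda>x. \<psi> (norm x) * (g x \<bullet> x))"
    "integrable lborel (\<lambda>x. u x * (real DIM('a) * \<psi> (norm x) + norm x * \<psi>' (norm x)))"
    "(\<integral>x. \<psi> (norm x) * (g x \<bullet> x) \<partial>lborel) =
       - (\<integral>x. u x * (real DIM('a) * \<psi> (norm x) + norm x * \<psi>' (norm x)) \<partial>lborel)"
proof -
  define D where "D b x = \<psi> (norm x) + \<psi>' (norm x) * (x \<bullet> b)\<^sup>2 / norm x" for b x :: 'a
  have [measurable]: "D b \<in> borel_measurable lborel" for b unfolding D_def[abs_def] by measurable
  have AEd: "AE x in lborel. ((\<lambda>h. \<psi> (norm (x + h *\<^sub>R b)) * ((x + h *\<^sub>R b) \<bullet> b)) has_real_derivative D b x) (at 0)"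
    if b: "b \<in> Basis" for b :: 'a
  proof -
    have "AE x in (lborel :: 'a measure). norm x \<notin> insert 0 S" by (rule AE_polar_finite) (use S in simp)
    then show ?thesis
    proof eventually_elim
      case (elim x)
      then show ?case unfolding D_def by (intro radial_directional_derivative b d) auto
    qed
  qed
  have *: "integrable lborel (\<lambda>x. (g x \<bullet> b) * (\<psi> (norm x) * (x \<bullet> b)))" "integrable lborel (\<lambda>x. u x * D b x)"
     "(\<integral>x. (g x \<bullet> b) * (\<psi> (norm x) * (x \<bullet> b)) \<partial>lborel) = - (\<integral>x. u x * D b x \<partial>lborel)" if b: "b \<in> Basis" for b
  proof -
    obtain L' where L': "lipschitz_support (\<lambda>x::'a. \<psi> (norm x) * (x \<bullet> b)) L' R"
      using radial_field_lipschitz[OF lip R b] by blast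
    note w = D1p_weak_gradient[OF assms(1) p L' b _ AEd[OF b]]
    show "integrable lborel (\<lambda>x. (g x \<bullet> b) * (\<psi> (norm x) * (x \<bullet> b)))" "integrable lborel (\<lambda>x. u x * D b x)"
     "(\<integral>x. (g x \<bullet> b) * (\<psi> (norm x) * (x \<bullet> b)) \<partial>lborel) = - (\<integral>x. u x * D b x \<partial>lborel)"
      using w by auto
  qed
  have s1: "(\<Sum>b\<in>Basis. (g x \<bullet> b) * (\<psi> (norm x) * (x \<bullet> b))) = \<psi> (norm x) * (g x \<bullet> x)" for x
    by (subst euclidean_inner[of "g x" x]) (simp add: sum_distrib_left mult_ac)
  have s2: "(\<Sum>b\<in>Basis. u x * D b x) = u x * (real DIM('a) * \<psi> (norm x) + norm x * \<psi>' (norm x))" for x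
  proof -
    have "(\<Sum>b\<in>Basis. (x \<bullet> b)\<^sup>2) = (norm x)\<^sup>2"
      by (subst power2_norm_eq_inner, subst euclidean_inner) (simp only: power2_eq_square)
    then have "(\<Sum>b\<in>Basis. \<psi>' (norm x) * (x \<bullet> b)\<^sup>2 / norm x) = \<psi>' (norm x) * (norm x)\<^sup>2 / norm x"
      by (simp add: sum_distrib_left[symmetric] sum_divide_distrib[symmetric])
    then show ?thesis unfolding D_def
      by (simp add: sum_distrib_left[symmetric] sum.distrib power2_eq_square)
  qed
  show "integrable lborel (\<lambda>x. \<psi> (norm x) * (g x \<bullet> x))"
    unfolding s1[symmetric] by (intro Bochner_Integration.integrable_sum *)
  show "integrable lborel (\<lambda>x. u x * (real DIM('a) * \<psi> (norm x) + norm x * \<psi>' (norm x)))"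
    unfolding s2[symmetric] by (intro Bochner_Integration.integrable_sum *)
  show "(\<integral>x. \<psi> (norm x) * (g x \<bullet> x) \<partial>lborel) =
       - (\<integral>x. u x * (real DIM('a) * \<psi> (norm x) + norm x * \<psi>' (norm x)) \<partial>lborel)"
    unfolding s1[symmetric] s2[symmetric]
    by (simp add: Bochner_Integration.integral_sum * sum_negf)
qed

section \<open>Integrals over balls\<close>

definition ball_int :: "('a::euclidean_space \<Rightarrow> real) \<Rightarrow> real \<Rightarrow> real" where
  "ball_int f s = (\<integral>x. indicator (ball 0 s) x * f x \<partial>lborel)"

lemma ball_int_nonpos: "s \<le> 0 \<Longrightarrow> ball_int f s = 0"
  by (simp add: ball_int_def ball_empty)

text \<open>As the radius moves, the indicators of the balls converge at every point off the
  limiting sphere, which is a null set.\<close>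

lemma isCont_ball_int:
  fixes f :: "'a::euclidean_space \<Rightarrow> real"
  assumes [measurable]: "f \<in> borel_measurable lborel"
    and int: "\<And>b. integrable lborel (\<lambda>x. indicator (ball 0 b) x * f x)"
  shows "isCont (ball_int f) s"
  unfolding isCont_def tendsto_at_iff_sequentially
proof (intro allI impI)
  fix X :: "nat \<Rightarrow> real" assume X: "\<forall>i. X i \<in> UNIV - {s}" "X \<longlonglongrightarrow> s"
  obtain B where B: "\<And>n. X n \<le> B"
    using X(2) by (metis Bseq_def convergent_imp_Bseq convergentI real_norm_def abs_le_D1)
  have "(\<lambda>n. \<integral>x. indicator (ball 0 (X n)) x * f x \<partial>lborel) \<longlonglongrightarrow> (\<integral>x. indicator (ball 0 s) x * f x \<partial>lborel)"
  proof (rule integral_dominated_convergence[where w = "\<lambda>x. \<bar>indicator (ball 0 B) x * f x\<bar>"])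
    show "integrable lborel (\<lambda>x. \<bar>indicator (ball 0 B) x * f x\<bar>)" using int by (intro integrable_abs)
    show "AE x in lborel. norm (indicator (ball 0 (X n)) x * f x) \<le> \<bar>indicator (ball 0 B) x * f x\<bar>" for n
      using B[of n] by (intro AE_I2) (auto split: split_indicator)
    have "AE x in (lborel :: 'a measure). norm x \<notin> {s}" by (rule AE_polar_finite) simp
    then show "AE x in lborel. (\<lambda>n. indicator (ball 0 (X n)) x * f x) \<longlonglongrightarrow> indicator (ball 0 s) x * f x"
    proof eventually_elim
      case (elim x)
      have "\<forall>\<^sub>F n in sequentially. indicator (ball 0 (X n)) x = (indicator (ball 0 s) x :: real)"
      proof (cases "norm x < s")
        case True
        from order_tendstoD(1)[OF X(2) True] show ?thesis by eventually_elim (use True in auto)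
      next
        case False
        then have "s < norm x" using elim by auto
        from order_tendstoD(2)[OF X(2) this] show ?thesis by eventually_elim (use \<open>s < norm x\<close> in auto)
      qed
      then have "\<forall>\<^sub>F n in sequentially. indicator (ball 0 (X n)) x * f x = indicator (ball 0 s) x * f x"
        by eventually_elim simp
      then show ?case by (rule tendsto_eventually)
    qed
  qed measurable
  then show "(ball_int f \<circ> X) \<longlonglongrightarrow> ball_int f s" by (simp add: ball_int_def[abs_def] o_def)
qed

lemma ball_int_tendsto_0:
  fixes f :: "'a::euclidean_space \<Rightarrow> real"
  assumes "f \<in> borel_measurable lborel" "\<And>b. integrable lborel (\<lambda>x. indicator (ball 0 b) x * f x)"
  shows "(ball_int f \<longlongrightarrow> 0) (at_right 0)"
  using isCont_ball_int[OF assms, of 0] ball_int_nonpos[of 0 f]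
  by (auto simp: isCont_def intro: tendsto_mono[OF at_le])

lemma integral_open_interval_square:
  assumes "0 \<le> a"
  shows "integrable lborel (\<lambda>s::real. 2 * s * indicator {a<..<b} s)"
    "(\<integral>s. 2 * s * indicator {a<..<b} s \<partial>lborel) = (if a \<le> b then b\<^sup>2 - a\<^sup>2 else 0)"
proof -
  have "has_bochner_integral lborel (\<lambda>s::real. 2 * s * indicator {a<..<b} s) (if a \<le> b then b\<^sup>2 - a\<^sup>2 else 0)"
  proof (cases "a \<le> b")
    case True
    have "has_bochner_integral lborel (\<lambda>s::real. 2 * s * indicator {a..b} s) (b\<^sup>2 - a\<^sup>2)"
      by (rule has_bochner_integral_FTC_Icc_real[OF True]) (auto intro!: derivative_eq_intros continuous_intros)
    moreover have "AE s in lborel. 2 * s * indicator {a..b} s = 2 * s * indicator {a<..<b} s"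
      using AE_lborel_singleton[of a] AE_lborel_singleton[of b]
      by eventually_elim (auto split: split_indicator)
    ultimately show ?thesis using True
      by (subst has_bochner_integral_cong_AE[symmetric]) auto
  qed (simp add: has_bochner_integral_zero)
  then show "integrable lborel (\<lambda>s::real. 2 * s * indicator {a<..<b} s)"
    "(\<integral>s. 2 * s * indicator {a<..<b} s \<partial>lborel) = (if a \<le> b then b\<^sup>2 - a\<^sup>2 else 0)"
    by (auto simp: has_bochner_integral_iff)
qed

text \<open>Fubini for the layers \<open>b\<^sup>2 - |x|\<^sup>2 = \<integral> 2 s [|x| < s < b] ds\<close>, with the
  outer integral written again as an integral over space.\<close>

lemma integral_layer:
  fixes f :: "'a::euclidean_space \<Rightarrow> real"
  assumes [measurable]: "f \<in> borel_measurable lborel"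
    and int: "\<And>b. integrable lborel (\<lambda>x. indicator (ball 0 b) x * f x)" and b: "b > 0"
  shows "integrable lborel (\<lambda>x. f x * max 0 (b\<^sup>2 - (norm x)\<^sup>2))"
    "integrable lborel (\<lambda>x::'a. indicator (ball 0 b) x *
        (2 * norm x * ball_int f (norm x) / polar_density TYPE('a) (norm x)))"
    "(\<integral>x. f x * max 0 (b\<^sup>2 - (norm x)\<^sup>2) \<partial>lborel) =
      (\<integral>x. indicator (ball (0::'a) b) x * (2 * norm x * ball_int f (norm x) / polar_density TYPE('a) (norm x)) \<partial>lborel)"
proof -
  define H where "H = (\<lambda>(x::'a, s::real). f x * (2 * s * indicator {norm x<..<b} s))"
  have Hm[measurable]: "H \<in> borel_measurable (lborel \<Otimes>\<^sub>M lborel)"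
  proof -
    have "H = (\<lambda>z. f (fst z) * (2 * snd z * (if norm (fst z) < snd z \<and> snd z < b then 1 else 0)))"
      by (auto simp: H_def fun_eq_iff split: split_indicator)
    then show ?thesis by simp
  qed
  have sq: "(if norm x \<le> b then b\<^sup>2 - (norm x)\<^sup>2 else 0) = max 0 (b\<^sup>2 - (norm x)\<^sup>2)" for x :: 'a
    using b by (auto simp: max_def power_mono not_le)
  have inner: "integrable lborel (\<lambda>s. H (x, s))" "(\<integral>s. H (x, s) \<partial>lborel) = f x * max 0 (b\<^sup>2 - (norm x)\<^sup>2)"
    "(\<integral>s. norm (H (x, s)) \<partial>lborel) = \<bar>f x\<bar> * max 0 (b\<^sup>2 - (norm x)\<^sup>2)" for x
  proof -
    note i = integral_open_interval_square[of "norm x" b, unfolded sq]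
    show "integrable lborel (\<lambda>s. H (x, s))" using i(1) by (simp add: H_def)
    show "(\<integral>s. H (x, s) \<partial>lborel) = f x * max 0 (b\<^sup>2 - (norm x)\<^sup>2)" using i(2) by (simp add: H_def)
    have "norm (H (x, s)) = \<bar>f x\<bar> * (2 * s * indicator {norm x<..<b} s)" for s
      using norm_ge_zero[of x] by (auto simp: H_def abs_mult split: split_indicator simp del: norm_ge_zero)
    then show "(\<integral>s. norm (H (x, s)) \<partial>lborel) = \<bar>f x\<bar> * max 0 (b\<^sup>2 - (norm x)\<^sup>2)" using i(2) by simp
  qed
  have fi: "integrable lborel (\<lambda>x. h x * max 0 (b\<^sup>2 - (norm x)\<^sup>2))"
    if [measurable]: "h \<in> borel_measurable lborel" and h: "\<And>x. \<bar>h x\<bar> = \<bar>f x\<bar>" for h :: "'a \<Rightarrow> real"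
  proof (rule Bochner_Integration.integrable_bound)
    show "integrable lborel (\<lambda>x. b\<^sup>2 * (indicator (ball 0 b) x * f x))" using int by simp
    show "AE x in lborel. norm (h x * max 0 (b\<^sup>2 - (norm x)\<^sup>2)) \<le> norm (b\<^sup>2 * (indicator (ball 0 b) x * f x))"
    proof (intro AE_I2)
      fix x :: 'a
      have "max 0 (b\<^sup>2 - (norm x)\<^sup>2) \<le> b\<^sup>2 * indicator (ball 0 b) x"
        using b by (auto simp: power_mono split: split_indicator)
      then have "\<bar>f x\<bar> * max 0 (b\<^sup>2 - (norm x)\<^sup>2) \<le> \<bar>f x\<bar> * (b\<^sup>2 * indicator (ball 0 b) x)" by (intro mult_left_mono) auto
      then show "norm (h x * max 0 (b\<^sup>2 - (norm x)\<^sup>2)) \<le> norm (b\<^sup>2 * (indicator (ball 0 b) x * f x))"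
        by (simp add: abs_mult h mult_ac)
    qed
  qed measurable
  show i1: "integrable lborel (\<lambda>x. f x * max 0 (b\<^sup>2 - (norm x)\<^sup>2))" by (rule fi) auto
  have HI: "integrable (lborel \<Otimes>\<^sub>M lborel) H"
  proof (rule lborel_pair.Fubini_integrable[OF Hm])
    show "integrable lborel (\<lambda>x. \<integral>s. norm (H (x, s)) \<partial>lborel)"
      unfolding inner(3) by (rule fi) auto
    show "AE x in lborel. integrable lborel (\<lambda>s. H (x, s))" using inner(1) by simp
  qed
  have outer: "(\<integral>x. H (x, s) \<partial>lborel) = 2 * s * ball_int f s * indicator {..<b} s" for s
  proof -
    have "H (x, s) = 2 * s * indicator {..<b} s * (indicator (ball 0 s) x * f x)" for x
      by (auto simp: H_def split: split_indicator)
    then show ?thesis by (simp add: ball_int_def)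
  qed
  have [measurable]: "ball_int f \<in> borel_measurable borel"
    using isCont_ball_int[OF assms(1) int] by (intro borel_measurable_continuous_onI continuous_at_imp_continuous_on) auto
  define F where "F r = indicator {..<b} r * (2 * r * ball_int f r / polar_density TYPE('a) r)" for r
  have [measurable]: "F \<in> borel_measurable borel" unfolding F_def[abs_def] by measurable
  have Fr: "polar_density TYPE('a) r * F r = 2 * r * ball_int f r * indicator {..<b} r" for r
    using polar_density_pos[of r, where 'a = 'a] ball_int_nonpos[of r f] by (cases "r > 0") (auto simp: F_def)
  have Fx: "F (norm x) = indicator (ball 0 b) x * (2 * norm x * ball_int f (norm x) / polar_density TYPE('a) (norm x))" for x :: 'a
    by (auto simp: F_def split: split_indicator)
  have i2: "integrable lborel (\<lambda>r. polar_density TYPE('a) r * F r)"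
    unfolding Fr outer[symmetric] by (rule lborel_pair.integrable_snd[where f = "\<lambda>x s. H (x, s)"]) (use HI in simp)
  then show "integrable lborel (\<lambda>x::'a. indicator (ball 0 b) x *
        (2 * norm x * ball_int f (norm x) / polar_density TYPE('a) (norm x)))"
    unfolding Fx[symmetric] by (subst integrable_polar) auto
  have "(\<integral>x. f x * max 0 (b\<^sup>2 - (norm x)\<^sup>2) \<partial>lborel) = (\<integral>x. (\<integral>s. H (x, s) \<partial>lborel) \<partial>lborel)"
    by (simp add: inner)
  also have "\<dots> = (\<integral>s. (\<integral>x. H (x, s) \<partial>lborel) \<partial>lborel)"
    using lborel_pair.Fubini_integral[of "\<lambda>x s. H (x, s)"] HI by simp
  also have "\<dots> = (\<integral>x. F (norm x) \<partial>(lborel :: 'a measure))"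
    by (subst integral_polar) (auto simp: outer Fr)
  finally show "(\<integral>x. f x * max 0 (b\<^sup>2 - (norm x)\<^sup>2) \<partial>lborel) =
      (\<integral>x. indicator (ball (0::'a) b) x * (2 * norm x * ball_int f (norm x) / polar_density TYPE('a) (norm x)) \<partial>lborel)"
    by (simp add: Fx)
qed

text \<open>Increments of the ball integral are ordinary integrals of the continuous function
  \<open>polar_density\<close> times \<open>F\<close>, to which the fundamental theorem of calculus
  applies.\<close>

lemma ball_int_derivative:
  fixes f :: "'a::euclidean_space \<Rightarrow> real"
  assumes [measurable]: "f \<in> borel_measurable lborel"
    and int: "\<And>b. integrable lborel (\<lambda>x. indicator (ball 0 b) x * f x)"
    and f: "AE x in lborel. f x = F (norm x)" and [measurable]: "F \<in> borel_measurable borel"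
    and F: "continuous_on {0<..} F" and r: "r > 0"
  shows "(ball_int f has_real_derivative polar_density TYPE('a) r * F r) (at r)"
proof -
  define G where "G s = polar_density TYPE('a) s * F s" for s
  have [measurable]: "G \<in> borel_measurable borel" unfolding G_def[abs_def] by measurable
  have eq: "ball_int f s = (\<integral>x. indicator {..<s} (norm x) * F (norm x) \<partial>(lborel :: 'a measure))" for s
    unfolding ball_int_def using f by (intro integral_cong_AE) (auto elim!: eventually_mono split: split_indicator)
  have ii: "integrable (lborel :: 'a measure) (\<lambda>x. indicator {..<s} (norm x) * F (norm x))" for s
  proof (subst integrable_cong_AE[symmetric, OF _ _ _])
    show "AE x in lborel. indicator (ball 0 s) x * f x = indicator {..<s} (norm x) * F (norm x)"
      using f by eventually_elim (auto split: split_indicator)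
  qed (use int in auto)
  have i2: "integrable lborel (\<lambda>t. polar_density TYPE('a) t * (indicator {..<s} t * F t))" for s
    using ii[of s] by (subst (asm) integrable_polar) auto
  have eq2: "ball_int f s = (\<integral>t. polar_density TYPE('a) t * (indicator {..<s} t * F t) \<partial>lborel)" for s
    unfolding eq by (rule integral_polar) auto
  \<comment> \<open>\<open>F\<close> is continuous only off the origin, so increments are taken from
    a base radius strictly between 0 and r.\<close>
  define c where "c = r / 2"
  have c: "0 < c" "c < r" using r by (auto simp: c_def)
  have contG: "continuous_on {c..2 * r} G"
    unfolding G_def polar_density_def using c
    by (intro continuous_intros continuous_on_subset[OF F]) (auto intro!: continuous_on_eq[of _ "\<lambda>s. real DIM('a) * unit_ball_vol (real DIM('a)) * s ^ (DIM('a) - 1)"] continuous_intros)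
  have diff: "ball_int f t = ball_int f c + integral {c..t} G" if t: "c \<le> t" "t \<le> 2 * r" for t
  proof -
    have "ball_int f t - ball_int f c = (\<integral>s. polar_density TYPE('a) s * (indicator {..<t} s * F s) - polar_density TYPE('a) s * (indicator {..<c} s * F s) \<partial>lborel)"
      unfolding eq2 by (rule Bochner_Integration.integral_diff[symmetric, OF i2 i2])
    also have "\<dots> = (\<integral>s. indicator {c..t} s *\<^sub>R G s \<partial>lborel)"
    proof (rule integral_cong_AE)
      show "AE s in lborel. polar_density TYPE('a) s * (indicator {..<t} s * F s) - polar_density TYPE('a) s * (indicator {..<c} s * F s) = indicator {c..t} s *\<^sub>R G s"
        using AE_lborel_singleton[of t] by eventually_elim (use t in \<open>auto simp: G_def split: split_indicator\<close>)
    qed auto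
    also have "\<dots> = integral {c..t} G"
    proof -
      have "set_integrable lborel {c..t} G"
        by (rule borel_integrable_compact[unfolded set_integrable_def[symmetric]]) (use t in \<open>auto intro: continuous_on_subset[OF contG]\<close>)
      from set_borel_integral_eq_integral(2)[OF this] show ?thesis by (simp add: set_lebesgue_integral_def)
    qed
    finally show ?thesis by simp
  qed
  have "((\<lambda>t. integral {c..t} G) has_real_derivative G r) (at r within {c..2 * r})"
    by (rule integral_has_real_derivative[OF contG]) (use c in auto)
  then have "((\<lambda>t. integral {c..t} G) has_real_derivative G r) (at r)"
    using c by (subst (asm) at_within_interior) (auto simp: interior_atLeastAtMost_real)
  then have "((\<lambda>t. ball_int f c + integral {c..t} G) has_real_derivative G r) (at r)"
    by (auto intro!: derivative_eq_intros)
  then have "(ball_int f has_real_derivative G r) (at r)"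
    by (rule has_field_derivative_transform_within_open[of _ _ _ "{c<..<2 * r}"]) (use c in \<open>auto intro!: diff[symmetric]\<close>)
  then show ?thesis by (simp add: G_def)
qed

section \<open>The radial differential equation\<close>

lemma DERIV_powr_const:
  fixes f :: "real \<Rightarrow> real"
  assumes "(f has_real_derivative f') (at x)" "f x > 0"
  shows "((\<lambda>x. f x powr a) has_real_derivative a * (f x powr a) * f' / f x) (at x)"
proof -
  have "((\<lambda>x. f x powr a) has_real_derivative a * f x powr (a - 1) * f') (at x)"
    by (rule DERIV_chain2[OF has_real_derivative_powr assms(1)]) (use assms in auto)
  then show ?thesis using assms(2) by (simp add: powr_diff mult_ac)
qed

lemma DERIV_zero_const_pos:
  fixes f :: "real \<Rightarrow> real"
  assumes "\<And>r. r > 0 \<Longrightarrow> (f has_real_derivative 0) (at r)"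
  shows "\<exists>c. \<forall>r>0. f r = c"
proof -
  have "\<exists>c. \<forall>x\<in>{0<..}. f x = c"
    by (rule has_field_derivative_zero_constant) (use assms in \<open>auto intro: has_field_derivative_at_within\<close>)
  then show ?thesis by auto
qed

text \<open>\<open>dV\<close> is the relation r^{N-1} |V'|^{p-1} = m and \<open>dm\<close> is the
  equation in divergence form, with m the ball integral of the source divided by the area of the
  unit sphere. \<open>limy\<close> and \<open>limm\<close> are the only information at the origin.
  The final relation between A and B ties two parameters together, so that one free parameter, the
  scale, remains.\<close>

lemma critical_ode:
  fixes N p \<alpha> :: real and V m :: "real \<Rightarrow> real"
  defines "q \<equiv> p * (N + \<alpha>) / (N - p)"
  assumes p: "1 < p" "p < N" "0 < \<alpha>"
    and Vpos: "\<And>r. r > 0 \<Longrightarrow> V r > 0" and mpos: "\<And>r. r > 0 \<Longrightarrow> m r > 0"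
    and dV: "\<And>r. r > 0 \<Longrightarrow> (V has_real_derivative - ((m r * r powr (1 - N)) powr (1 / (p - 1)))) (at r)"
    and dm: "\<And>r. r > 0 \<Longrightarrow> (m has_real_derivative r powr (N - 1 + \<alpha>) * V r powr (q - 1)) (at r)"
    and limy: "((\<lambda>r. r powr ((N - p) / p) * V r) \<longlongrightarrow> 0) (at_right 0)"
    and limm: "(m \<longlongrightarrow> 0) (at_right 0)"
  shows "\<exists>A>0. \<exists>B>0. (\<forall>r>0. V r = (A + B * r powr ((p + \<alpha>) / (p - 1))) powr (- ((N - p) / (p + \<alpha>))))
           \<and> (N + \<alpha>) * ((N - p) / (p - 1)) powr (p - 1) * A * B powr (p - 1) = 1"
proof -
  define \<gamma> where "\<gamma> = (N - p) / p"
  define s where "s = (p + \<alpha>) / (p - 1)"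
  define m0 where "m0 = (N - p) / (p + \<alpha>)"
  define \<kappa> where "\<kappa> = (N + \<alpha>) * (p - 1) / (N - p)"
  define \<beta> where "\<beta> r = (m r * r powr (1 - N)) powr (1 / (p - 1))" for r
  define w where "w r = r powr (N - 1 + \<alpha>) * V r powr (q - 1)" for r
  have pos: "\<gamma> > 0" "s > 0" "m0 > 0" "q > 1"
  proof -
    have "1 * (N + \<alpha>) \<le> p * (N + \<alpha>)" using p by (intro mult_right_mono) auto
    moreover have "N - p < 1 * (N + \<alpha>)" using p by simp
    ultimately have "N - p < p * (N + \<alpha>)" by (rule less_le_trans[rotated])
    then show "q > 1" using p by (simp add: q_def)
  qed (use p in \<open>auto simp: \<gamma>_def s_def m0_def\<close>)
  \<comment> \<open>Criticality of the exponent: the term r^{N+\<alpha>} V^q is invariant under the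
    scaling, being the q-th power of r^\<gamma> V.\<close>
  have gq: "\<gamma> * q = N + \<alpha>" using p by (simp add: \<gamma>_def q_def)
  have \<beta>pos: "\<beta> r > 0" if "r > 0" for r using mpos[OF that] that by (simp add: \<beta>_def)
  have dV': "(V has_real_derivative - \<beta> r) (at r)" if "r > 0" for r using dV[OF that] by (simp add: \<beta>_def)
  have dm': "(m has_real_derivative w r) (at r)" if "r > 0" for r using dm[OF that] by (simp add: w_def)
  have d\<beta>: "(\<beta> has_real_derivative \<beta> r / (p - 1) * (w r / m r + (1 - N) / r)) (at r)" if r: "r > 0" for r
  proof -
    have "((\<lambda>r. m r * r powr (1 - N)) has_real_derivative
       m r * r powr (1 - N) * (w r / m r + (1 - N) / r)) (at r)"
      by (rule DERIV_cong[OF DERIV_mult[OF dm'[OF r] DERIV_powr_const[OF DERIV_ident]]])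
         (use r mpos[OF r] in \<open>auto simp: field_simps\<close>)
    from DERIV_powr_const[OF this, of "1 / (p - 1)"] show ?thesis
      unfolding \<beta>_def using r mpos[OF r] by (auto elim!: DERIV_cong)
  qed
  \<comment> \<open>the Pohozaev quantity\<close>
  define P where "P r = (p - 1) / p * (m r * \<beta> r * r) + r powr (N + \<alpha>) * V r powr q / q - \<gamma> * (m r * V r)" for r
  have wV: "r powr (N + \<alpha>) * V r powr q = r * V r * w r" if "r > 0" for r
    using that Vpos[OF that] by (simp add: w_def powr_diff powr_add)
  have dT: "((\<lambda>r. r powr (N + \<alpha>) * V r powr q) has_real_derivative (N + \<alpha>) * V r * w r - q * r * w r * \<beta> r) (at r)"
    if r: "r > 0" for r
    by (rule DERIV_cong[OF DERIV_mult[OF DERIV_powr_const[OF DERIV_ident] DERIV_powr_const[OF dV']]])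
       (use r Vpos[OF r] in \<open>auto simp: w_def powr_diff powr_add field_simps\<close>)
  have dmb: "((\<lambda>r. m r * \<beta> r * r) has_real_derivative p / (p - 1) * w r * \<beta> r * r - (N - p) / (p - 1) * m r * \<beta> r) (at r)"
    if r: "r > 0" for r
  proof (rule DERIV_cong[OF DERIV_mult[OF DERIV_mult[OF dm'[OF r] d\<beta>[OF r]] DERIV_ident]])
    have 1: "p / (p - 1) = 1 + 1 / (p - 1)" "(N - p) / (p - 1) = (N - 1) / (p - 1) - 1"
      using p by (auto simp: field_simps)
    have 2: "\<beta> r / (p - 1) * (w r / m r + (1 - N) / r) * m r * r = 1 / (p - 1) * w r * \<beta> r * r - (N - 1) / (p - 1) * m r * \<beta> r"
    proof -
      have "(w r / m r + (1 - N) / r) * m r * r = w r * r + (1 - N) * m r"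
        using r mpos[OF r] by (simp add: field_simps)
      then have "\<beta> r / (p - 1) * (w r / m r + (1 - N) / r) * m r * r = \<beta> r / (p - 1) * (w r * r + (1 - N) * m r)"
        by (simp only: mult.assoc)
      then show ?thesis by (simp add: algebra_simps divide_inverse)
    qed
    show "(w r * \<beta> r + \<beta> r / (p - 1) * (w r / m r + (1 - N) / r) * m r) * r + 1 * (m r * \<beta> r) =
      p / (p - 1) * w r * \<beta> r * r - (N - p) / (p - 1) * m r * \<beta> r"
      unfolding 1 using 2 by (simp add: algebra_simps)
  qed
  have dmV: "((\<lambda>r. m r * V r) has_real_derivative w r * V r - m r * \<beta> r) (at r)" if r: "r > 0" for r
    by (rule DERIV_cong[OF DERIV_mult[OF dm'[OF r] dV'[OF r]]]) simp
  have "(P has_real_derivative 0) (at r)" if r: "r > 0" for r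
  proof -
    have "(P has_real_derivative (p - 1) / p * (p / (p - 1) * w r * \<beta> r * r - (N - p) / (p - 1) * m r * \<beta> r)
       + ((N + \<alpha>) * V r * w r - q * r * w r * \<beta> r) / q - \<gamma> * (w r * V r - m r * \<beta> r)) (at r)"
      unfolding P_def by (intro DERIV_diff DERIV_add DERIV_cmult DERIV_cdivide dT dmb dmV r)
    moreover have "(p - 1) / p * (p / (p - 1) * w r * \<beta> r * r - (N - p) / (p - 1) * m r * \<beta> r) =
       w r * \<beta> r * r - \<gamma> * m r * \<beta> r"
    proof -
      have e: "(p - 1) / p * (p / (p - 1)) = 1" "(p - 1) / p * ((N - p) / (p - 1)) = \<gamma>"
        using p by (auto simp: \<gamma>_def)
      show ?thesis by (simp only: right_diff_distrib mult.assoc[symmetric] e mult_1_left)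
    qed
    moreover have "((N + \<alpha>) * V r * w r - q * r * w r * \<beta> r) / q = \<gamma> * V r * w r - r * w r * \<beta> r"
      using pos by (simp add: gq[symmetric] field_simps)
    ultimately show ?thesis by (auto elim!: DERIV_cong simp: algebra_simps)
  qed
  then obtain c where c: "\<And>r. r > 0 \<Longrightarrow> P r = c" using DERIV_zero_const_pos[of P] by auto
  \<comment> \<open>Scale invariant unknowns in the style of Emden and Fowler: with y = r^\<gamma> V
    and, below, n = m r^{-\<gamma>}, the Pohozaev quantity becomes (p-1)/p n^{p/(p-1)} + y^q/q -
    \<gamma> n y. It vanishes in the limit once y and n do.\<close>
  define y where "y r = r powr \<gamma> * V r" for r
  have limy': "(y \<longlongrightarrow> 0) (at_right 0)" using limy by (simp add: y_def[abs_def] \<gamma>_def)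
  have ypos: "y r > 0" if "r > 0" for r using Vpos[OF that] that by (simp add: y_def)
  have wy: "w r = r powr (\<gamma> - 1) * y r powr (q - 1)" if r: "r > 0" for r
  proof -
    have "y r powr (q - 1) = r powr (\<gamma> * (q - 1)) * V r powr (q - 1)"
      using r Vpos[OF r] by (simp add: y_def powr_mult powr_powr)
    moreover have "\<gamma> - 1 + \<gamma> * (q - 1) = N - 1 + \<alpha>" using gq by (simp add: algebra_simps)
    ultimately show ?thesis by (simp only: w_def mult.assoc[symmetric] powr_add[symmetric])
  qed
  have limyq: "((\<lambda>r. y r powr a) \<longlongrightarrow> 0) (at_right 0)" if "a > 0" for a
  proof (rule tendsto_zero_powrI[OF limy' tendsto_const])
    show "\<forall>\<^sub>F r in at_right 0. 0 \<le> y r"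
      using ypos by (auto simp: eventually_at_right_field intro!: exI[of _ 1] less_imp_le)
  qed (use that in auto)
  define n where "n r = m r * r powr (- \<gamma>)" for r
  have npos: "n r > 0" if "r > 0" for r using mpos[OF that] that by (simp add: n_def)
  have limn: "(n \<longlongrightarrow> 0) (at_right 0)"
  proof (rule tendstoI)
    fix e :: real assume e: "e > 0"
    define \<epsilon> where "\<epsilon> = e * \<gamma> / 2"
    have \<epsilon>: "\<epsilon> > 0" using e pos by (simp add: \<epsilon>_def)
    have "\<forall>\<^sub>F r in at_right 0. y r powr (q - 1) < \<epsilon>"
      using order_tendstoD(2)[OF limyq[of "q - 1"] \<epsilon>] pos by simp
    then obtain d where d: "d > 0" "\<And>r. 0 < r \<Longrightarrow> r < d \<Longrightarrow> y r powr (q - 1) < \<epsilon>"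
      by (auto simp: eventually_at_right_field)
    \<comment> \<open>Comparison of m with a multiple of r^\<gamma>: since m' = r^{\<gamma>-1}
      y^{q-1}, the difference is nonincreasing where y^{q-1} < \<epsilon>. It tends to 0 at the
      origin, hence is at most 0, that is n <= \<epsilon>/\<gamma>.\<close>
    define E where "E r = m r - \<epsilon> / \<gamma> * r powr \<gamma>" for r
    have dE: "(E has_real_derivative w r - \<epsilon> * r powr (\<gamma> - 1)) (at r)" if "r > 0" for r
    proof -
      have "(E has_real_derivative w r - \<epsilon> / \<gamma> * (\<gamma> * r powr (\<gamma> - 1))) (at r)"
        unfolding E_def by (intro DERIV_diff DERIV_cmult dm' that has_real_derivative_powr)
      then show ?thesis using pos by simp
    qed
    have "E r \<le> 0" if r: "0 < r" "r < d" for r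
    proof -
      have mono: "E r \<le> E t" if t: "0 < t" "t < r" for t
      proof (rule DERIV_nonpos_imp_nonincreasing[where f = E and a = t and b = r])
        show "t \<le> r" using t by simp
        fix x assume "t \<le> x" "x \<le> r"
        then have x: "0 < x" "x < d" using t r by auto
        have "w x - \<epsilon> * x powr (\<gamma> - 1) \<le> 0"
          using d(2)[OF x] x wy[OF x(1)] by (simp add: mult.commute)
        with dE[OF x(1)] show "\<exists>y. (E has_real_derivative y) (at x) \<and> y \<le> 0" by blast
      qed
      have "((\<lambda>r. r powr \<gamma>) \<longlongrightarrow> 0) (at_right (0::real))"
        by (rule tendsto_zero_powrI[where b = \<gamma>]) (use pos in \<open>auto intro!: tendsto_intros simp: eventually_at_right_field intro: exI[of _ 1]\<close>)
      then have "((\<lambda>t. E t) \<longlongrightarrow> 0 - \<epsilon> / \<gamma> * 0) (at_right 0)"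
        unfolding E_def by (intro tendsto_intros limm)
      moreover have "\<forall>\<^sub>F t in at_right 0. E r \<le> E t"
        using mono r by (auto simp: eventually_at_right_field intro!: exI[of _ r])
      ultimately show ?thesis using tendsto_lowerbound[of E "0 - \<epsilon> / \<gamma> * 0"] by fastforce
    qed
    then have "n r \<le> \<epsilon> / \<gamma>" if r: "0 < r" "r < d" for r
      using r by (auto simp: E_def n_def powr_minus field_simps)
    moreover have "\<epsilon> / \<gamma> < e" using e pos by (simp add: \<epsilon>_def)
    ultimately show "\<forall>\<^sub>F x in at_right 0. dist (n x) 0 < e"
      using d(1) npos unfolding eventually_at_right_field by (intro exI[of _ d]) (force simp: abs_of_pos)
  qed
  have limP: "(P \<longlongrightarrow> 0) (at_right 0)"
  proof -
    have "((\<lambda>r. (p - 1) / p * (n r powr (p / (p - 1))) + y r powr q / q - \<gamma> * (n r * y r)) \<longlongrightarrow>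
      (p - 1) / p * 0 + 0 / q - \<gamma> * (0 * 0)) (at_right 0)"
    proof (intro tendsto_intros limn limy' limyq)
      show "((\<lambda>r. n r powr (p / (p - 1))) \<longlongrightarrow> 0) (at_right 0)"
      proof (rule tendsto_zero_powrI[OF limn tendsto_const])
        show "\<forall>\<^sub>F r in at_right 0. 0 \<le> n r"
          using npos by (auto simp: eventually_at_right_field intro!: exI[of _ 1] less_imp_le)
      qed (use p in auto)
    qed (use pos in auto)
    moreover have "\<forall>\<^sub>F r in at_right 0. (p - 1) / p * (n r powr (p / (p - 1))) + y r powr q / q - \<gamma> * (n r * y r) = P r"
      unfolding eventually_at_right_field
    proof (intro exI[of _ 1] conjI allI impI)
      fix r :: real assume r: "0 < r" "r < 1"
      have 1: "y r powr q = r powr (N + \<alpha>) * V r powr q"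
        using r Vpos[OF r(1)] by (simp add: y_def powr_mult powr_powr gq)
      have 2: "n r * y r = m r * V r"
        using r by (simp add: n_def y_def powr_minus)
      have "n r powr (p / (p - 1)) = m r powr (p / (p - 1)) * r powr (- (N - p) / (p - 1))"
        using r mpos[OF r(1)] p by (simp add: n_def powr_mult powr_powr \<gamma>_def)
      moreover have "m r * \<beta> r * r = m r powr (1 + 1 / (p - 1)) * r powr ((1 - N) * (1 / (p - 1)) + 1)"
        using r mpos[OF r(1)] p by (simp add: \<beta>_def powr_mult powr_powr powr_add)
      moreover have "p / (p - 1) = 1 + 1 / (p - 1)" "- (N - p) / (p - 1) = (1 - N) * (1 / (p - 1)) + 1"
        using p by (auto simp: field_simps)
      ultimately have 3: "n r powr (p / (p - 1)) = m r * \<beta> r * r" by simp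
      show "(p - 1) / p * (n r powr (p / (p - 1))) + y r powr q / q - \<gamma> * (n r * y r) = P r"
        by (simp only: P_def 1 2 3)
    qed simp
    ultimately show ?thesis by (auto intro: Lim_transform_eventually)
  qed
  have "((\<lambda>r. c) \<longlongrightarrow> 0) (at_right (0::real))"
    by (rule Lim_transform_eventually[OF limP]) (use c in \<open>auto simp: eventually_at_right_field intro!: exI[of _ 1]\<close>)
  then have "c = 0" by (simp add: tendsto_const_iff)
  then have P0: "(p - 1) / p * (m r * \<beta> r * r) + r * V r * w r / q = \<gamma> * (m r * V r)" if "r > 0" for r
    using c[OF that] wV[OF that] by (simp add: P_def)
  \<comment> \<open>\<open>Q' = q P / (r m V)\<close>, and \<open>Q\<close> is constant exactly along the bubbles\<close>
  define Q where "Q r = ln (m r) - (N + \<alpha>) * ln r - \<kappa> * ln (V r)" for r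
  have "(Q has_real_derivative 0) (at r)" if r: "r > 0" for r
  proof -
    have "(Q has_real_derivative (w r / m r - (N + \<alpha>) * (1 / r) - \<kappa> * (- \<beta> r / V r))) (at r)"
      unfolding Q_def
      apply (intro DERIV_diff DERIV_cmult)
      subgoal by (rule DERIV_cong[OF DERIV_chain2[OF DERIV_ln dm'[OF r]]]) (use r mpos[OF r] in \<open>auto simp: field_simps\<close>)
      subgoal using DERIV_ln[OF r] by (simp add: field_simps)
      subgoal by (rule DERIV_cong[OF DERIV_chain2[OF DERIV_ln dV'[OF r]]]) (use r Vpos[OF r] in \<open>auto simp: field_simps\<close>)
      done
    moreover have "w r / m r - (N + \<alpha>) * (1 / r) - \<kappa> * (- \<beta> r / V r) = 0"
    proof -
      have "q * ((p - 1) / p * (m r * \<beta> r * r) + r * V r * w r / q) = q * (\<gamma> * (m r * V r))"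
        using P0[OF r] by simp
      moreover have "q * ((p - 1) / p) = \<kappa>" using p by (simp add: q_def \<kappa>_def)
      moreover have "q * (\<gamma> * (m r * V r)) = (N + \<alpha>) * (m r * V r)" by (simp only: gq[symmetric] mult_ac)
      moreover have "q * ((p - 1) / p * (m r * \<beta> r * r) + r * V r * w r / q) =
          q * ((p - 1) / p) * (m r * \<beta> r * r) + r * V r * w r"
        using pos by (simp only: distrib_left mult.assoc) simp
      ultimately have "\<kappa> * (m r * \<beta> r * r) + r * V r * w r = (N + \<alpha>) * (m r * V r)"
        by simp
      then show ?thesis using r mpos[OF r] Vpos[OF r] by (simp add: field_simps)
    qed
    ultimately show ?thesis by simp
  qed
  then obtain c' where c': "\<And>r. r > 0 \<Longrightarrow> Q r = c'" using DERIV_zero_const_pos[of Q] by auto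
  define k where "k = exp c'"
  have kpos: "k > 0" by (simp add: k_def)
  have mk: "m r = k * r powr (N + \<alpha>) * V r powr \<kappa>" if r: "r > 0" for r
  proof -
    have "ln (m r) = c' + (N + \<alpha>) * ln r + \<kappa> * ln (V r)" using c'[OF r] by (simp add: Q_def)
    then have "exp (ln (m r)) = exp (c' + (N + \<alpha>) * ln r + \<kappa> * ln (V r))" by simp
    then show ?thesis using r mpos[OF r] Vpos[OF r] by (simp add: k_def exp_add powr_def)
  qed
  define k' where "k' = k powr (1 / (p - 1))"
  have k'pos: "k' > 0" using kpos by (simp add: k'_def)
  have \<beta>k: "\<beta> r = k' * r powr (s - 1) * V r powr (1 / m0 + 1)" if r: "r > 0" for r
  proof -
    have "m r * r powr (1 - N) = k * r powr (1 + \<alpha>) * V r powr \<kappa>"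
      using mk[OF r] r by (simp add: powr_add powr_diff field_simps)
    moreover have "(1 + \<alpha>) * (1 / (p - 1)) = s - 1" using p by (simp add: s_def field_simps)
    moreover have "\<kappa> * (1 / (p - 1)) = 1 / m0 + 1"
    proof -
      have "\<kappa> * (1 / (p - 1)) = (N + \<alpha>) / (N - p)" using p by (simp add: \<kappa>_def)
      also have "\<dots> = 1 / m0 + 1" using p by (simp add: m0_def field_simps)
      finally show ?thesis .
    qed
    ultimately show ?thesis
      using r Vpos[OF r] kpos unfolding \<beta>_def k'_def by (simp add: powr_mult powr_powr)
  qed
  have m0s: "m0 * s = (N - p) / (p - 1)" using p by (simp add: s_def m0_def)
  define B where "B = k' / (m0 * s)"
  have Bpos: "B > 0" using k'pos pos by (simp add: B_def)
  \<comment> \<open>Eliminating m has produced the separable equation V' = -k' r^{s-1} V^{1/m0+1};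
    this power of V turns it into Z' = (k'/m0) r^{s-1}.\<close>
  define Z where "Z r = V r powr (- (1 / m0))" for r
  have Zpos: "Z r > 0" if "r > 0" for r using Vpos[OF that] by (simp add: Z_def)
  have "((\<lambda>r. Z r - B * r powr s) has_real_derivative 0) (at r)" if r: "r > 0" for r
  proof -
    have "(Z has_real_derivative - (1 / m0) * (V r powr (- (1 / m0))) * (- \<beta> r) / V r) (at r)"
      unfolding Z_def by (rule DERIV_powr_const[OF dV'[OF r] Vpos[OF r]])
    moreover have "- (1 / m0) * (V r powr (- (1 / m0))) * (- \<beta> r) / V r = k' / m0 * r powr (s - 1)"
      using \<beta>k[OF r] Vpos[OF r] by (simp add: powr_add powr_minus field_simps)
    ultimately have "((\<lambda>r. Z r - B * r powr s) has_real_derivative k' / m0 * r powr (s - 1) - B * (s * r powr (s - 1))) (at r)"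
      by (intro DERIV_diff DERIV_cmult has_real_derivative_powr r) simp
    then show ?thesis using pos by (simp add: B_def)
  qed
  then obtain A where A: "\<And>r. r > 0 \<Longrightarrow> Z r - B * r powr s = A"
    using DERIV_zero_const_pos[of "\<lambda>r. Z r - B * r powr s"] by auto
  have Zr: "Z r = A + B * r powr s" if "r > 0" for r using A[OF that] by simp
  have VZ: "V r = Z r powr (- m0)" if "r > 0" for r
    using Vpos[OF that] pos by (simp add: Z_def powr_powr)
  have rs0: "((\<lambda>r. r powr s) \<longlongrightarrow> 0) (at_right (0::real))"
    by (rule tendsto_zero_powrI[where b = s]) (use pos in \<open>auto intro!: tendsto_intros simp: eventually_at_right_field intro: exI[of _ 1]\<close>)
  have "A \<ge> 0"
  proof -
    have "((\<lambda>r. A + B * r powr s) \<longlongrightarrow> A + B * 0) (at_right (0::real))" by (intro tendsto_intros rs0)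
    moreover have "\<forall>\<^sub>F r in at_right 0. 0 \<le> A + B * r powr s"
      using Zpos Zr by (fastforce simp: eventually_at_right_field intro!: exI[of _ 1] less_imp_le)
    ultimately show ?thesis using tendsto_lowerbound[of "\<lambda>r. A + B * r powr s" "A + B * 0" "at_right (0::real)" 0] by simp
  qed
  \<comment> \<open>For A = 0 the profile would be a multiple of r^{-(N-p)/(p-1)}, the fundamental
    solution of the p-Laplacian, and y could not tend to 0.\<close>
  moreover have "A \<noteq> 0"
  proof
    assume "A = 0"
    have "B powr (- m0) \<le> y r" if r: "0 < r" "r < 1" for r
    proof -
      have "y r = r powr \<gamma> * (B * r powr s) powr (- m0)" using VZ[OF r(1)] Zr[OF r(1)] \<open>A = 0\<close> by (simp add: y_def)
      also have "\<dots> = B powr (- m0) * r powr (\<gamma> - s * m0)"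
        using r Bpos by (simp add: powr_mult powr_powr powr_add[symmetric] mult.left_commute)
      finally have eq: "y r = B powr (- m0) * r powr (\<gamma> - s * m0)" .
      have "s * m0 = (N - p) / (p - 1)" using p by (simp add: s_def m0_def)
      moreover have "(N - p) / p \<le> (N - p) / (p - 1)" using p by (intro divide_left_mono) auto
      ultimately have "\<gamma> - s * m0 \<le> 0" by (simp add: \<gamma>_def)
      then have "r powr 0 \<le> r powr (\<gamma> - s * m0)" using r by (intro powr_mono') auto
      then show ?thesis using eq Bpos r by simp
    qed
    then have "\<forall>\<^sub>F r in at_right 0. B powr (- m0) \<le> y r" by (auto simp: eventually_at_right_field intro!: exI[of _ 1])
    from tendsto_lowerbound[OF limy' this] have "B powr (- m0) \<le> 0" by simp
    then show False using Bpos by simp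
  qed
  ultimately have Apos: "A > 0" by simp
  \<comment> \<open>The integration constants are not independent: the vanishing Pohozaev identity
    at r = 1, divided by the common factor \<open>a\<close>, reads (p-1)/p k k' + 1/q = \<gamma> k
    (A + B), and \<gamma> B cancels the term with k'.\<close>
  have "(N + \<alpha>) * k * A = 1"
  proof -
    have V1: "V 1 > 0" "Z 1 > 0" using Vpos Zpos by auto
    have b1: "\<beta> 1 = k' * V 1 powr (1 / m0 + 1)" using \<beta>k[of 1] by simp
    have m1: "m 1 = k * V 1 powr \<kappa>" using mk[of 1] by simp
    have w1: "w 1 = V 1 powr (q - 1)" by (simp add: w_def)
    have "q - 1 = (p * (N + \<alpha>) - (N - p)) / (N - p)" using p by (simp add: q_def diff_divide_distrib)
    also have "p * (N + \<alpha>) - (N - p) = (N + \<alpha>) * (p - 1) + (p + \<alpha>)" by (simp add: algebra_simps)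
    also have "\<dots> / (N - p) = \<kappa> + 1 / m0" by (simp add: \<kappa>_def m0_def add_divide_distrib)
    finally have "q - 1 = \<kappa> + 1 / m0" .
    then have w1': "w 1 = V 1 powr \<kappa> * V 1 powr (1 / m0)" using w1 by (simp add: powr_add)
    have Vm: "V 1 powr (1 / m0) = 1 / Z 1" using V1 by (simp add: Z_def powr_minus field_simps)
    have "V 1 powr (1 / m0 + 1) = V 1 / Z 1" using V1 Vm by (simp add: powr_add)
    then have "(p - 1) / p * (k * V 1 powr \<kappa> * (k' * (V 1 / Z 1))) + V 1 * (V 1 powr \<kappa> * (1 / Z 1)) / q = \<gamma> * (k * V 1 powr \<kappa> * V 1)"
      using P0[of 1] b1 m1 w1' Vm by simp
    moreover define a where "a = V 1 powr \<kappa> * V 1 / Z 1"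
    moreover have "V 1 powr \<kappa> * V 1 = a * Z 1" using V1 by (simp add: a_def)
    ultimately have "a * ((p - 1) / p * k * k' + 1 / q) = a * (\<gamma> * k * Z 1)"
      using V1 by (simp add: algebra_simps)
    moreover have "a \<noteq> 0" using V1 by (simp add: a_def)
    ultimately have "(p - 1) / p * k * k' + 1 / q = \<gamma> * k * Z 1" by simp
    moreover have "Z 1 = A + B" using Zr[of 1] by simp
    moreover have "\<gamma> * B = (p - 1) / p * k'" using p by (simp add: B_def m0s \<gamma>_def)
    moreover have "\<gamma> * k * (A + B) = \<gamma> * k * A + k * (\<gamma> * B)" by (simp add: algebra_simps)
    ultimately have "1 / q = \<gamma> * k * A" by (simp add: mult_ac)
    then have "\<gamma> * q * k * A = 1" using pos by (simp add: field_simps)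
    then show ?thesis by (simp add: gq)
  qed
  moreover have "k = ((N - p) / (p - 1)) powr (p - 1) * B powr (p - 1)"
  proof -
    have "(N - p) / (p - 1) * B = k'" using p by (simp add: B_def m0s)
    then have "((N - p) / (p - 1)) powr (p - 1) * B powr (p - 1) = k' powr (p - 1)"
      using p Bpos by (simp add: powr_mult[symmetric])
    also have "\<dots> = k" using kpos p by (simp add: k'_def powr_powr)
    finally show ?thesis by simp
  qed
  ultimately have "(N + \<alpha>) * ((N - p) / (p - 1)) powr (p - 1) * A * B powr (p - 1) = 1" by (simp add: mult_ac)
  moreover have "\<forall>r>0. V r = (A + B * r powr s) powr (- m0)" using VZ Zr by simp
  ultimately show ?thesis using Apos Bpos unfolding s_def m0_def by blast
qed

text \<open>Factoring out A leaves A^{-m0} (1 + (B/A) r^s)^{-m0}, so the scale is determined by l^s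
  = B/A. The relation between A and B amounts to \<Lambda> (B/A)^{p-1} = A^{-p}, and a suitable
  power of it turns A^{-m0} into \<open>C_const\<close> times the power of l.\<close>

lemma bubble_parameters:
  fixes N p \<alpha> A B :: real
  assumes p: "1 < p" "p < N" "0 < \<alpha>" and AB: "A > 0" "B > 0"
    and rel: "(N + \<alpha>) * ((N - p) / (p - 1)) powr (p - 1) * A * B powr (p - 1) = 1"
  defines "l \<equiv> (B / A) powr ((p - 1) / (p + \<alpha>))"
  assumes r: "r \<ge> 0"
  shows "(A + B * r powr ((p + \<alpha>) / (p - 1))) powr (- ((N - p) / (p + \<alpha>))) =
    C_const N p \<alpha> * l powr ((N - p) / p) / (1 + l powr ((p + \<alpha>) / (p - 1)) * r powr ((p + \<alpha>) / (p - 1)))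
       powr ((N - p) / (p + \<alpha>))"
proof -
  define s where "s = (p + \<alpha>) / (p - 1)"
  define m0 where "m0 = (N - p) / (p + \<alpha>)"
  define \<Lambda> where "\<Lambda> = (N + \<alpha>) * ((N - p) / (p - 1)) powr (p - 1)"
  have \<Lambda>: "\<Lambda> > 0" using p by (simp add: \<Lambda>_def)
  have ls: "l powr s = B / A" using AB p by (simp add: l_def s_def powr_powr)
  have rel': "\<Lambda> * B powr (p - 1) = 1 / A" using rel AB by (simp add: \<Lambda>_def field_simps)
  have "C_const N p \<alpha> = \<Lambda> powr (m0 / p)" by (simp add: C_const_def \<Lambda>_def m0_def mult.commute)
  moreover have "l powr ((N - p) / p) = ((B / A) powr (p - 1)) powr (m0 / p)"
  proof -
    have "(p - 1) / (p + \<alpha>) * ((N - p) / p) = (p - 1) * (m0 / p)" using p by (simp add: m0_def)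
    then show ?thesis by (simp add: l_def powr_powr)
  qed
  ultimately have "C_const N p \<alpha> * l powr ((N - p) / p) = (\<Lambda> * (B / A) powr (p - 1)) powr (m0 / p)"
    using \<Lambda> by (simp add: powr_mult)
  also have "\<Lambda> * (B / A) powr (p - 1) = A powr (- p)"
  proof -
    have "\<Lambda> * (B / A) powr (p - 1) = (1 / A) / A powr (p - 1)" using AB rel' by (simp add: powr_divide)
    also have "\<dots> = A powr (- p)" using AB by (simp add: powr_minus powr_diff field_simps)
    finally show ?thesis .
  qed
  also have "(A powr (- p)) powr (m0 / p) = A powr (- m0)" using p by (simp add: powr_powr)
  finally have C: "C_const N p \<alpha> * l powr ((N - p) / p) = A powr (- m0)" .
  have "A + B * r powr s = A * (1 + l powr s * r powr s)" using AB ls by (simp add: field_simps)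
  then have "(A + B * r powr s) powr (- m0) = A powr (- m0) * (1 + l powr s * r powr s) powr (- m0)"
    using AB by (simp add: powr_mult)
  also have "\<dots> = C_const N p \<alpha> * l powr ((N - p) / p) / (1 + l powr s * r powr s) powr m0"
    by (simp only: C) (simp add: powr_minus divide_inverse)
  finally show ?thesis by (simp add: s_def m0_def)
qed

section \<open>The bubbles are weak solutions\<close>

text \<open>Only \<psi> and r \<psi>' are bounded; \<psi>' itself may blow up at the origin, as it
  does for the bubbles when \<alpha> < 1. With |y| <= |x| the mean value point z satisfies |y| <= z,
  so the factor |y| beside the increment of \<psi> absorbs the singularity.\<close>

lemma radial_field_local_lipschitz:
  assumes d: "\<And>r. 0 < r \<Longrightarrow> r \<le> R \<Longrightarrow> (\<psi> has_real_derivative \<psi>' r) (at r)"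
    and M: "\<And>r. 0 \<le> r \<Longrightarrow> r \<le> R \<Longrightarrow> \<bar>\<psi> r\<bar> \<le> M" "\<And>r. 0 < r \<Longrightarrow> r \<le> R \<Longrightarrow> r * \<bar>\<psi>' r\<bar> \<le> M"
    and b: "b \<in> Basis" and xy: "norm (x::'a::euclidean_space) \<le> R" "norm y \<le> R"
  shows "\<bar>\<psi> (norm x) * (x \<bullet> b) - \<psi> (norm y) * (y \<bullet> b)\<bar> \<le> 2 * M * norm (x - y)"
proof -
  have M0: "M \<ge> 0" using M(1)[of "norm x"] xy by fastforce
  have *: "\<bar>\<psi> (norm x) * (x \<bullet> b) - \<psi> (norm y) * (y \<bullet> b)\<bar> \<le> 2 * M * norm (x - y)"
    if xy: "norm y \<le> norm x" "norm x \<le> R" for x y :: 'a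
  proof -
    have k: "\<bar>\<psi> (norm x) - \<psi> (norm y)\<bar> * norm y \<le> M * norm (x - y)"
    proof (cases "y = 0 \<or> norm y = norm x")
      case False
      then have y: "0 < norm y" "norm y < norm x" using xy by auto
      obtain z where z: "norm y < z" "z < norm x" "\<psi> (norm x) - \<psi> (norm y) = (norm x - norm y) * \<psi>' z"
        using MVT2[of "norm y" "norm x" \<psi> \<psi>'] d y xy by auto
      have z0: "z > 0" using z(1) y(1) by linarith
      have "\<bar>\<psi> (norm x) - \<psi> (norm y)\<bar> * norm y = (norm x - norm y) * (norm y * \<bar>\<psi>' z\<bar>)"
        using z y by (simp add: abs_mult)
      also have "\<dots> \<le> (norm x - norm y) * (z * \<bar>\<psi>' z\<bar>)"
        using z y by (intro mult_left_mono mult_right_mono) auto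
      also have "\<dots> \<le> norm (x - y) * M"
        using z y xy M(2)[of z] z0 by (intro mult_mono norm_triangle_ineq2) auto
      finally show ?thesis by (simp add: mult.commute)
    qed (use M0 in auto)
    have "\<bar>\<psi> (norm x) * (x \<bullet> b) - \<psi> (norm y) * (y \<bullet> b)\<bar> =
       \<bar>\<psi> (norm x) * ((x - y) \<bullet> b) + (\<psi> (norm x) - \<psi> (norm y)) * (y \<bullet> b)\<bar>" by (simp add: algebra_simps)
    also have "\<dots> \<le> \<bar>\<psi> (norm x)\<bar> * \<bar>(x - y) \<bullet> b\<bar> + \<bar>\<psi> (norm x) - \<psi> (norm y)\<bar> * \<bar>y \<bullet> b\<bar>"
      by (simp add: abs_mult[symmetric] abs_triangle_ineq)
    also have "\<dots> \<le> M * norm (x - y) + \<bar>\<psi> (norm x) - \<psi> (norm y)\<bar> * norm y"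
      using xy M0 by (intro add_mono mult_mono M Basis_le_norm[OF b]) auto
    finally show ?thesis using k by (simp add: algebra_simps)
  qed
  show ?thesis
  proof (cases "norm y \<le> norm x")
    case False
    with *[of x y] xy show ?thesis by (simp add: norm_minus_commute abs_minus_commute)
  qed (use * xy in auto)
qed

text \<open>When one point lies outside the support ball, the increment of the product reduces to
  the increment of \<open>F\<close> times one value of \<open>Y\<close> inside, so nothing about
  \<open>Y\<close> outside the ball is asked.\<close>

lemma lipschitz_support_mult_local:
  assumes F: "lipschitz_support (F :: 'a::euclidean_space \<Rightarrow> real) L R"
    and Y: "\<And>x y. norm x \<le> R \<Longrightarrow> norm y \<le> R \<Longrightarrow> \<bar>Y x - Y y\<bar> \<le> M * norm (x - y)"
    and B: "\<And>x. norm x \<le> R \<Longrightarrow> \<bar>Y x\<bar> \<le> B"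
  shows "\<exists>L'. lipschitz_support (\<lambda>x. F x * Y x) L' R"
proof -
  obtain C where C: "C \<ge> 0" "\<And>x. \<bar>F x\<bar> \<le> C" using lipschitz_support_bounded[OF F] by blast
  have lip: "\<bar>F x - F y\<bar> \<le> \<bar>L\<bar> * norm (x - y)" for x y
    using F unfolding lipschitz_support_def by (meson abs_ge_self mult_right_mono norm_ge_zero order_trans)
  have supp: "F x = 0" if "norm x > R" for x using F that by (auto simp: lipschitz_support_def)
  define K where "K = C * \<bar>M\<bar> + \<bar>L\<bar> * \<bar>B\<bar>"
  have K0: "K \<ge> 0" using C by (simp add: K_def)
  have *: "\<bar>F x * Y x - F y * Y y\<bar> \<le> K * norm (x - y)" if x: "norm x \<le> R" for x y
  proof (cases "norm y \<le> R")
    case True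
    have "\<bar>Y x - Y y\<bar> \<le> M * norm (x - y)" by (rule Y[OF x True])
    also have "\<dots> \<le> \<bar>M\<bar> * norm (x - y)" by (intro mult_right_mono) auto
    finally have 1: "\<bar>Y x - Y y\<bar> \<le> \<bar>M\<bar> * norm (x - y)" .
    have 2: "\<bar>Y x\<bar> \<le> \<bar>B\<bar>" using B[OF x] by linarith
    have "\<bar>F x * Y x - F y * Y y\<bar> = \<bar>F y * (Y x - Y y) + (F x - F y) * Y x\<bar>" by (simp add: algebra_simps)
    also have "\<dots> \<le> \<bar>F y\<bar> * \<bar>Y x - Y y\<bar> + \<bar>F x - F y\<bar> * \<bar>Y x\<bar>"
      by (simp add: abs_mult[symmetric] abs_triangle_ineq)
    also have "\<dots> \<le> C * (\<bar>M\<bar> * norm (x - y)) + (\<bar>L\<bar> * norm (x - y)) * \<bar>B\<bar>"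
      by (intro add_mono mult_mono 1 2 C lip) (use C in auto)
    finally show ?thesis by (simp add: K_def algebra_simps)
  next
    case False
    have 2: "\<bar>Y x\<bar> \<le> \<bar>B\<bar>" using B[OF x] by linarith
    have "\<bar>F x * Y x - F y * Y y\<bar> = \<bar>F x - F y\<bar> * \<bar>Y x\<bar>" using supp[of y] False by (simp add: abs_mult)
    also have "\<dots> \<le> (\<bar>L\<bar> * norm (x - y)) * \<bar>B\<bar>" by (intro mult_mono lip 2) auto
    also have "\<dots> \<le> K * norm (x - y)" using C by (simp add: K_def algebra_simps)
    finally show ?thesis .
  qed
  have "\<bar>F x * Y x - F y * Y y\<bar> \<le> K * norm (x - y)" for x y
  proof (cases "norm x \<le> R")
    case False
    show ?thesis
    proof (cases "norm y \<le> R")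
      case True
      from *[OF True, of x] show ?thesis by (simp add: norm_minus_commute abs_minus_commute)
    qed (use False supp K0 in auto)
  qed (rule *)
  then show ?thesis using supp unfolding lipschitz_support_def by auto
qed

text \<open>The divergence theorem for \<phi> times the radial field: each component is Lipschitz
  with bounded support, its derivative in its own direction has integral zero, and the sum over the
  basis contains the divergence \<open>W\<close> of the field.\<close>

lemma integral_test_fun_radial_field:
  assumes \<phi>: "test_fun (\<phi> :: 'a::euclidean_space \<Rightarrow> real)"
    and [measurable]: "\<psi> \<in> borel_measurable borel" "\<psi>' \<in> borel_measurable borel" "W \<in> borel_measurable borel"
    and d: "\<And>r. 0 < r \<Longrightarrow> (\<psi> has_real_derivative \<psi>' r) (at r)"
    and M: "\<And>R. \<exists>M. (\<forall>r. 0 \<le> r \<longrightarrow> r \<le> R \<longrightarrow> \<bar>\<psi> r\<bar> \<le> M) \<and> (\<forall>r. 0 < r \<longrightarrow> r \<le> R \<longrightarrow> r * \<bar>\<psi>' r\<bar> \<le> M)"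
    and W: "\<And>r. 0 < r \<Longrightarrow> real DIM('a) * \<psi> r + r * \<psi>' r = W r"
  shows "integrable lborel (\<lambda>x. \<psi> (norm x) * (grad \<phi> x \<bullet> x))" "integrable lborel (\<lambda>x. W (norm x) * \<phi> x)"
    "(\<integral>x. \<psi> (norm x) * (grad \<phi> x \<bullet> x) \<partial>lborel) = - (\<integral>x. W (norm x) * \<phi> x \<partial>lborel)"
proof -
  obtain R L where RL: "lipschitz_support \<phi> L R" "\<And>x. norm (grad \<phi> x) \<le> L" "\<And>x. norm x > R \<Longrightarrow> grad \<phi> x = 0"
    using test_fun_facts[OF \<phi>] by blast
  have [measurable]: "\<phi> \<in> borel_measurable lborel" "grad \<phi> \<in> borel_measurable lborel"
    using test_fun_measurable[OF \<phi>] by auto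
  have sm: "smooth_fun \<phi>" using \<phi> by (simp add: test_fun_def)
  obtain C where C: "C \<ge> 0" "\<And>x. \<bar>\<phi> x\<bar> \<le> C" using lipschitz_support_bounded[OF RL(1)] by blast
  have supp: "\<phi> x = 0" if "norm x > R" for x using RL that by (auto simp: lipschitz_support_def)
  obtain M where M: "\<And>r. 0 \<le> r \<Longrightarrow> r \<le> \<bar>R\<bar> \<Longrightarrow> \<bar>\<psi> r\<bar> \<le> M" "\<And>r. 0 < r \<Longrightarrow> r \<le> \<bar>R\<bar> \<Longrightarrow> r * \<bar>\<psi>' r\<bar> \<le> M"
    using assms(6)[of "\<bar>R\<bar>"] by blast
  have M0: "M \<ge> 0" using M(1)[of 0] by simp
  have L0: "L \<ge> 0" using RL(2)[of 0] norm_ge_zero order_trans by blast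
  have AE0: "AE x in (lborel :: 'a measure). norm x \<notin> {0}" by (rule AE_polar_finite) simp
  show i1: "integrable lborel (\<lambda>x. \<psi> (norm x) * (grad \<phi> x \<bullet> x))"
  proof (rule integrable_bounded_support[of _ "M * (L * \<bar>R\<bar>)" R])
    show "AE x in lborel. norm (\<psi> (norm x) * (grad \<phi> x \<bullet> x)) \<le> M * (L * \<bar>R\<bar>)"
    proof (intro AE_I2)
      fix x :: 'a
      show "norm (\<psi> (norm x) * (grad \<phi> x \<bullet> x)) \<le> M * (L * \<bar>R\<bar>)"
      proof (cases "norm x > R")
        case False
        have "\<bar>grad \<phi> x \<bullet> x\<bar> \<le> norm (grad \<phi> x) * norm x" by (rule Cauchy_Schwarz_ineq2)
        also have "\<dots> \<le> L * \<bar>R\<bar>" using RL(2) L0 False by (intro mult_mono) auto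
        finally show ?thesis using M(1)[of "norm x"] False M0 by (simp add: abs_mult mult_mono)
      qed (use RL M0 L0 in auto)
    qed
  qed (use RL in auto)
  show i2: "integrable lborel (\<lambda>x. W (norm x) * \<phi> x)"
  proof (rule integrable_bounded_support[of _ "(real DIM('a) * M + M) * C" R])
    show "AE x in lborel. norm (W (norm x) * \<phi> x) \<le> (real DIM('a) * M + M) * C"
      using AE0
    proof eventually_elim
      case (elim x)
      then have x: "norm x > 0" by simp
      show ?case
      proof (cases "norm x > R")
        case False
        have "\<bar>W (norm x)\<bar> \<le> real DIM('a) * \<bar>\<psi> (norm x)\<bar> + norm x * \<bar>\<psi>' (norm x)\<bar>"
          using W[OF x] by (metis abs_mult abs_norm_cancel abs_of_nat abs_triangle_ineq)
        also have "\<dots> \<le> real DIM('a) * M + M" using M[of "norm x"] x False by (intro add_mono mult_left_mono) auto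
        finally show ?thesis using C M0 by (simp add: abs_mult mult_mono)
      qed (use supp M0 C in auto)
    qed
  qed (use supp in auto)
  define D where "D b x = (grad \<phi> x \<bullet> b) * (\<psi> (norm x) * (x \<bullet> b)) + \<phi> x * (\<psi> (norm x) + \<psi>' (norm x) * (x \<bullet> b)\<^sup>2 / norm x)" for b x :: 'a
  have [measurable]: "D b \<in> borel_measurable lborel" for b unfolding D_def[abs_def] by measurable
  have z: "integrable lborel (D b)" "(\<integral>x. D b x \<partial>lborel) = 0" if b: "b \<in> Basis" for b
  proof -
    have "\<exists>L'. lipschitz_support (\<lambda>x. \<phi> x * (\<psi> (norm x) * (x \<bullet> b))) L' R"
    proof (rule lipschitz_support_mult_local[OF RL(1)])
      fix x y :: 'a assume xy: "norm x \<le> R" "norm y \<le> R"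
      show "\<bar>\<psi> (norm x) * (x \<bullet> b) - \<psi> (norm y) * (y \<bullet> b)\<bar> \<le> 2 * M * norm (x - y)"
        by (rule radial_field_local_lipschitz[of "\<bar>R\<bar>", OF d M b]) (use xy in auto)
    next
      fix x :: 'a assume x: "norm x \<le> R"
      show "\<bar>\<psi> (norm x) * (x \<bullet> b)\<bar> \<le> M * \<bar>R\<bar>"
        unfolding abs_mult using M(1)[of "norm x"] x M0 Basis_le_norm[OF b, of x] by (intro mult_mono) auto
    qed
    then obtain L' where L': "lipschitz_support (\<lambda>x. \<phi> x * (\<psi> (norm x) * (x \<bullet> b))) L' R" by blast
    have "AE x in lborel. ((\<lambda>h. \<phi> (x + h *\<^sub>R b) * (\<psi> (norm (x + h *\<^sub>R b)) * ((x + h *\<^sub>R b) \<bullet> b))) has_real_derivative D b x) (at 0)"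
      using AE0
    proof eventually_elim
      case (elim x)
      then have x: "x \<noteq> 0" by simp
      from DERIV_mult[OF has_derivative_directional[OF smooth_fun_grad(1)[OF sm]] radial_directional_derivative[OF x b d]] x
      show ?case by (simp add: D_def mult.commute add.commute)
    qed
    from integral_directional_derivative_zero[OF L' b _ this]
    show "integrable lborel (D b)" "(\<integral>x. D b x \<partial>lborel) = 0" by auto
  qed
  have s: "(\<Sum>b\<in>Basis. D b x) = \<psi> (norm x) * (grad \<phi> x \<bullet> x) + W (norm x) * \<phi> x" if x: "x \<noteq> 0" for x
  proof -
    have 1: "(\<Sum>b\<in>Basis. (grad \<phi> x \<bullet> b) * (\<psi> (norm x) * (x \<bullet> b))) = \<psi> (norm x) * (grad \<phi> x \<bullet> x)"
      by (subst euclidean_inner[of "grad \<phi> x" x]) (simp add: sum_distrib_left mult_ac)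
    have "(\<Sum>b\<in>Basis. (x \<bullet> b)\<^sup>2) = (norm x)\<^sup>2"
      by (subst power2_norm_eq_inner, subst euclidean_inner) (simp only: power2_eq_square)
    then have "(\<Sum>b\<in>Basis. \<psi>' (norm x) * (x \<bullet> b)\<^sup>2 / norm x) = \<psi>' (norm x) * (norm x)\<^sup>2 / norm x"
      by (simp add: sum_distrib_left[symmetric] sum_divide_distrib[symmetric])
    then have "(\<Sum>b\<in>Basis. \<phi> x * (\<psi> (norm x) + \<psi>' (norm x) * (x \<bullet> b)\<^sup>2 / norm x)) = \<phi> x * (real DIM('a) * \<psi> (norm x) + norm x * \<psi>' (norm x))"
      by (simp add: sum_distrib_left[symmetric] sum.distrib power2_eq_square)
    then show ?thesis unfolding D_def sum.distrib 1 using W[of "norm x"] x by simp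
  qed
  have "(\<integral>x. (\<Sum>b\<in>Basis. D b x) \<partial>lborel) = 0" using z by (simp add: Bochner_Integration.integral_sum)
  also have "(\<integral>x. (\<Sum>b\<in>Basis. D b x) \<partial>lborel) = (\<integral>x. \<psi> (norm x) * (grad \<phi> x \<bullet> x) + W (norm x) * \<phi> x \<partial>lborel)"
    by (rule integral_cong_AE) (use AE0 in \<open>auto elim!: eventually_mono simp: s\<close>)
  also have "\<dots> = (\<integral>x. \<psi> (norm x) * (grad \<phi> x \<bullet> x) \<partial>lborel) + (\<integral>x. W (norm x) * \<phi> x \<partial>lborel)"
    by (rule Bochner_Integration.integral_add[OF i1 i2])
  finally show "(\<integral>x. \<psi> (norm x) * (grad \<phi> x \<bullet> x) \<partial>lborel) = - (\<integral>x. W (norm x) * \<phi> x \<partial>lborel)" by linarith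
qed

section \<open>The bubbles lie in the energy space\<close>

lemma bubble_envelope:
  fixes c s a :: real
  assumes "c > 0" "s > 0" "a > 0"
  shows "\<exists>M>0. \<forall>\<rho>\<ge>0. (1 + c * \<rho> powr s) powr (- a) \<le> M * (1 + \<rho>) powr (- (s * a))"
proof -
  define \<delta> where "\<delta> = min 1 c * 2 powr (- s)"
  have \<delta>: "\<delta> > 0" using assms by (simp add: \<delta>_def)
  have "(1 + c * \<rho> powr s) powr (- a) \<le> \<delta> powr (- a) * (1 + \<rho>) powr (- (s * a))" if \<rho>: "\<rho> \<ge> 0" for \<rho>
  proof -
    \<comment> \<open>From 1 + \<rho> <= 2 max(1, \<rho>); this is the origin of the factor 2^{-s}
      in \<delta>, while min(1, c) accounts for the coefficient of \<rho>^s.\<close>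
    have "(1 + \<rho>) powr s \<le> (2 * max 1 \<rho>) powr s" using \<rho> assms by (intro powr_mono2) auto
    also have "\<dots> = 2 powr s * max 1 \<rho> powr s" by (simp add: powr_mult)
    also have "max 1 \<rho> powr s \<le> 1 + \<rho> powr s" by (simp add: max_def)
    finally have "2 powr (- s) * (1 + \<rho>) powr s \<le> 2 powr (- s) * (2 powr s * (1 + \<rho> powr s))"
      by (intro mult_left_mono) auto
    then have 1: "2 powr (- s) * (1 + \<rho>) powr s \<le> 1 + \<rho> powr s" by (simp add: powr_minus field_simps)
    have "\<delta> * (1 + \<rho>) powr s \<le> min 1 c * (1 + \<rho> powr s)"
      unfolding \<delta>_def mult.assoc using 1 assms by (intro mult_left_mono) auto
    also have "\<dots> \<le> 1 + c * \<rho> powr s"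
    proof -
      have "min 1 c * \<rho> powr s \<le> c * \<rho> powr s" by (intro mult_right_mono) auto
      then show ?thesis by (simp add: distrib_left add_mono)
    qed
    finally have "(1 + c * \<rho> powr s) powr (- a) \<le> (\<delta> * (1 + \<rho>) powr s) powr (- a)"
      using assms \<delta> \<rho> by (intro powr_mono2') auto
    also have "\<dots> = \<delta> powr (- a) * (1 + \<rho>) powr (- (s * a))" using \<delta> \<rho> by (simp add: powr_mult powr_powr)
    finally show ?thesis .
  qed
  then show ?thesis using \<delta> by (intro exI[of _ "\<delta> powr (- a)"]) auto
qed

text \<open>Radial test functions are written in terms of |x|^2, which unlike |x| is smooth at the
  origin.\<close>

lemma has_derivative_radial_square:
  assumes "(H has_real_derivative H') (at ((norm (x::'a::euclidean_space))\<^sup>2))"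
  shows "((\<lambda>x. H ((norm x)\<^sup>2)) has_derivative (\<lambda>h. h \<bullet> ((2 * H') *\<^sub>R x))) (at x)"
proof -
  have "((\<lambda>x::'a. x \<bullet> x) has_derivative (\<lambda>h. x \<bullet> h + h \<bullet> x)) (at x)"
    by (rule has_derivative_inner[OF has_derivative_ident has_derivative_ident])
  then have "((\<lambda>x::'a. (norm x)\<^sup>2) has_derivative (\<lambda>h. 2 * (h \<bullet> x))) (at x)"
    unfolding power2_norm_eq_inner by (rule has_derivative_eq_rhs) (auto simp: inner_commute)
  from has_derivative_compose[OF this assms[unfolded has_field_derivative_def]]
  show ?thesis by (rule has_derivative_eq_rhs) (auto simp: fun_eq_iff)
qed

text \<open>The approximants replace |x|^2 by 1/n + |x|^2, which restores smoothness at the origin,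
  and carry a cutoff at radius n. On the support of the cutoff its gradient is of order |x|/n^2 <=
  2/(1 + |x|), so multiplied by the bubble it decays no slower than the gradient of the bubble. One
  power of 1 + |x| thus dominates all gradients, another one all functions, and dominated
  convergence gives both limits.\<close>

lemma bubble_D1p:
  fixes p s m0 c C0 :: real
  assumes p: "1 < p" "p < real DIM('a::euclidean_space)" and s: "s > 1" and m0: "m0 > 0"
    and ms: "m0 * s = (real DIM('a) - p) / (p - 1)" and c: "c > 0" and C0: "C0 > 0"
  defines "K \<equiv> C0 * m0 * c * s"
  shows "D1p_grad p (\<lambda>x::'a. C0 * (1 + c * norm x powr s) powr (- m0))
     (\<lambda>x. - (K * norm x powr (s - 2) * (1 + c * norm x powr s) powr (- m0 - 1)) *\<^sub>R x)"
proof -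
  define N where "N = real DIM('a)"
  define u where "u = (\<lambda>x::'a. C0 * (1 + c * norm x powr s) powr (- m0))"
  define g where "g = (\<lambda>x::'a. - (K * norm x powr (s - 2) * (1 + c * norm x powr s) powr (- m0 - 1)) *\<^sub>R x)"
  \<comment> \<open>The decay rate of the gradient; it equals (N-1)/(p-1), and \<tau> p > N is
    equivalent to p < N.\<close>
  define \<tau> where "\<tau> = m0 * s + 1"
  have K: "K > 0" using C0 m0 c s by (simp add: K_def)
  obtain M1 where M1: "M1 > 0" "\<And>\<rho>. \<rho> \<ge> 0 \<Longrightarrow> (1 + c * \<rho> powr s) powr (- m0) \<le> M1 * (1 + \<rho>) powr (- (s * m0))"
    using bubble_envelope[of c s m0] c s m0 by auto
  obtain M2 where M2: "M2 > 0" "\<And>\<rho>. \<rho> \<ge> 0 \<Longrightarrow> (1 + c * \<rho> powr s) powr (- (m0 + 1)) \<le> M2 * (1 + \<rho>) powr (- (s * (m0 + 1)))"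
    using bubble_envelope[of c s "m0 + 1"] c s m0 by auto
  have E2: "\<rho> powr (s - 1) * (1 + c * \<rho> powr s) powr (- m0 - 1) \<le> M2 * (1 + \<rho>) powr (- \<tau>)" if "\<rho> \<ge> 0" for \<rho>
  proof -
    have "\<rho> powr (s - 1) * (1 + c * \<rho> powr s) powr (- m0 - 1) \<le>
       (1 + \<rho>) powr (s - 1) * (M2 * (1 + \<rho>) powr (- (s * (m0 + 1))))"
      using M2(2)[OF that] that s by (intro mult_mono powr_mono2) auto
    also have "\<dots> = M2 * (1 + \<rho>) powr (s - 1 + - (s * (m0 + 1)))" by (simp only: powr_add mult_ac)
    also have "s - 1 + - (s * (m0 + 1)) = - \<tau>" by (simp add: \<tau>_def algebra_simps)
    finally show ?thesis .
  qed
  have \<tau>0: "\<tau> > 0" using s m0 by (simp add: \<tau>_def add_pos_pos)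
  have \<tau>e: "- (s * m0) + - 1 = - \<tau>" by (simp add: \<tau>_def mult.commute)
  define n where "n k = real (Suc k)" for k
  have n: "n k \<ge> 1" for k by (simp add: n_def)
  have nlim: "(\<lambda>k. 1 / n k) \<longlonglongrightarrow> 0"
    using LIMSEQ_inverse_real_of_nat by (simp add: n_def inverse_eq_divide)
  define W where "W k t = 1 + c * (1 / n k + t) powr (s / 2)" for k t
  have W1: "W k t \<ge> 1" for k t using c by (simp add: W_def)
  \<comment> \<open>The factor e normalises the cutoff: \<open>bump 1\<close> is 1/e, so the cutoff
    tends to 1 as n grows. In the derivative below, \<open>T1\<close> comes from the regularised
    bubble and \<open>T2\<close> from the cutoff.\<close>
  define H where "H k t = C0 * W k t powr (- m0) * (exp 1 * bump (1 - t / (n k)\<^sup>2))" for k t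
  define T1 where "T1 k t = C0 * m0 * c * (s / 2) * (1 / n k + t) powr (s / 2 - 1) * W k t powr (- m0 - 1) * (exp 1 * bump (1 - t / (n k)\<^sup>2))" for k t
  define T2 where "T2 k t = C0 * W k t powr (- m0) * (exp 1 * bump_deriv (Suc 0) (1 - t / (n k)\<^sup>2) * (1 / (n k)\<^sup>2))" for k t
  have dH: "(H k has_real_derivative - T1 k t - T2 k t) (at t)" if t: "t \<ge> 0" for k t
  proof -
    have pos: "1 / n k + t > 0" using n[of k] t by (simp add: add_pos_nonneg)
    have 1: "((\<lambda>t. (1 / n k + t) powr (s / 2)) has_real_derivative (s / 2) * (1 / n k + t) powr (s / 2 - 1)) (at t)"
      by (rule DERIV_cong[OF DERIV_chain2[where f = "\<lambda>z. z powr (s / 2)" and g = "\<lambda>t. 1 / n k + t" and x = t,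
            OF has_real_derivative_powr[OF pos] DERIV_add[OF DERIV_const DERIV_ident]]]) simp
    have 2: "(W k has_real_derivative c * ((s / 2) * (1 / n k + t) powr (s / 2 - 1))) (at t)"
      unfolding W_def[abs_def] by (rule DERIV_cong[OF DERIV_add[OF DERIV_const DERIV_cmult[OF 1]]]) simp
    have 3: "((\<lambda>t. W k t powr (- m0)) has_real_derivative - m0 * W k t powr (- m0 - 1) * (c * ((s / 2) * (1 / n k + t) powr (s / 2 - 1)))) (at t)"
      by (rule DERIV_chain2[OF has_real_derivative_powr 2]) (use W1[of k t] in linarith)
    have 4: "((\<lambda>t. bump (1 - t / (n k)\<^sup>2)) has_real_derivative bump_deriv (Suc 0) (1 - t / (n k)\<^sup>2) * (- (1 / (n k)\<^sup>2))) (at t)"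
      by (rule DERIV_chain2[OF bump_has_deriv DERIV_cong[OF DERIV_diff[OF DERIV_const DERIV_cdivide[OF DERIV_ident]]]]) simp
    show ?thesis unfolding H_def[abs_def]
      by (rule DERIV_cong[OF DERIV_mult[OF DERIV_cmult[OF 3] DERIV_cmult[OF 4]]]) (simp add: T1_def T2_def algebra_simps)
  qed
  define \<phi> where "\<phi> k x = H k ((norm x)\<^sup>2)" for k and x :: 'a
  have grad\<phi>: "grad (\<phi> k) x = (2 * (- T1 k ((norm x)\<^sup>2) - T2 k ((norm x)\<^sup>2))) *\<^sub>R x" for k x
    unfolding \<phi>_def[abs_def] by (rule grad_eqI[OF has_derivative_radial_square[OF dH]]) simp
  have bz: "bump (1 - (norm x)\<^sup>2 / (n k)\<^sup>2) = 0" "bump_deriv (Suc 0) (1 - (norm x)\<^sup>2 / (n k)\<^sup>2) = 0" if "norm x \<ge> n k" for k and x :: 'a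
  proof -
    have "(n k)\<^sup>2 \<le> (norm x)\<^sup>2" using that n[of k] by (intro power_mono) auto
    then have "1 - (norm x)\<^sup>2 / (n k)\<^sup>2 \<le> 0" using n[of k] by (simp add: field_simps)
    then show "bump (1 - (norm x)\<^sup>2 / (n k)\<^sup>2) = 0" "bump_deriv (Suc 0) (1 - (norm x)\<^sup>2 / (n k)\<^sup>2) = 0"
      by (auto simp: bump_def bump_deriv_1)
  qed
  have test: "test_fun (\<phi> k)" for k
    unfolding test_fun_def
  proof
    have "smooth_fun (\<lambda>x::'a. 1 / n k + 1 * (norm x)\<^sup>2)" by (rule smooth_fun_affine[OF smooth_fun_norm_sq])
    then have "smooth_fun (\<lambda>x::'a. 1 / n k + (norm x)\<^sup>2)" by simp
    then have "smooth_fun (\<lambda>x::'a. (1 / n k + (norm x)\<^sup>2) powr (s / 2))"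
      by (rule smooth_fun_powr) (use n[of k] in \<open>simp add: add_pos_nonneg\<close>)
    then have "smooth_fun (\<lambda>x::'a. W k ((norm x)\<^sup>2))" unfolding W_def by (rule smooth_fun_affine)
    then have 1: "smooth_fun (\<lambda>x::'a. W k ((norm x)\<^sup>2) powr (- m0))"
      by (rule smooth_fun_powr) (use W1 in \<open>metis less_le_trans zero_less_one\<close>)
    have "smooth_fun (\<lambda>x::'a. 1 + (- 1 / (n k)\<^sup>2) * (norm x)\<^sup>2)" by (rule smooth_fun_affine[OF smooth_fun_norm_sq])
    then have "smooth_fun (\<lambda>x::'a. 1 - (norm x)\<^sup>2 / (n k)\<^sup>2)" by simp
    then have 2: "smooth_fun (\<lambda>x::'a. bump (1 - (norm x)\<^sup>2 / (n k)\<^sup>2))" by (rule smooth_fun_bump_comp)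
    show "smooth_fun (\<phi> k)" unfolding \<phi>_def H_def
      by (intro smooth_fun_mult smooth_fun_const 1 2)
    have "{x. \<phi> k x \<noteq> 0} \<subseteq> cball 0 (n k)" using bz(1) by (force simp: \<phi>_def H_def not_le)
    then show "bounded {x. \<phi> k x \<noteq> 0}" using bounded_subset bounded_cball by blast
  qed
  have e1: "exp 1 * bump (1 - t / (n k)\<^sup>2) \<le> 1" if "t \<ge> 0" for t k using that by (intro bump_bounds) auto
  have \<phi>b: "0 \<le> \<phi> k x" "\<phi> k x \<le> C0 * M1 * (1 + norm x) powr (- (s * m0))" for k x
  proof -
    show "0 \<le> \<phi> k x" using C0 bump_bounds(1) by (simp add: \<phi>_def H_def)
    have "\<phi> k x \<le> C0 * W k ((norm x)\<^sup>2) powr (- m0) * 1" unfolding \<phi>_def H_def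
      using e1 C0 by (intro mult_left_mono) auto
    also have "\<dots> \<le> C0 * (M1 * (1 + norm x) powr (- (s * m0)))"
    proof -
      have "norm x powr s = ((norm x)\<^sup>2) powr (s / 2)" by (simp add: powr_numeral[symmetric] powr_powr del: powr_numeral)
      also have "\<dots> \<le> (1 / n k + (norm x)\<^sup>2) powr (s / 2)" using s n[of k] by (intro powr_mono2) auto
      finally have "1 + c * norm x powr s \<le> W k ((norm x)\<^sup>2)" using c by (simp add: W_def)
      then have "W k ((norm x)\<^sup>2) powr (- m0) \<le> (1 + c * norm x powr s) powr (- m0)"
        using m0 c by (intro powr_mono2') (auto intro: add_pos_nonneg)
      also have "\<dots> \<le> M1 * (1 + norm x) powr (- (s * m0))" by (rule M1) simp
      finally show ?thesis using C0 by simp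
    qed
    finally show "\<phi> k x \<le> C0 * M1 * (1 + norm x) powr (- (s * m0))" by simp
  qed
  have ub: "0 \<le> u x" "u x \<le> C0 * M1 * (1 + norm x) powr (- (s * m0))" for x
    using M1(2)[of "norm x"] C0 by (auto simp: u_def mult.assoc)
  have gb: "norm (g x) \<le> K * M2 * (1 + norm x) powr (- \<tau>)" for x
  proof (cases "x = 0")
    case False
    then have "norm (g x) = K * (norm x powr (s - 1) * (1 + c * norm x powr s) powr (- m0 - 1))"
      using K by (simp add: g_def powr_diff field_simps power2_eq_square)
    also have "\<dots> \<le> K * (M2 * (1 + norm x) powr (- \<tau>))" using E2[of "norm x"] K by simp
    finally show ?thesis by simp
  qed (use K M2 in \<open>simp add: g_def\<close>)
  \<comment> \<open>16 = 2 * 4 * 2: the factor from differentiating |x|^2, the bound on the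
    derivative of \<open>bump\<close>, and the constant in |x|/n^2 <= 2/(1 + |x|).\<close>
  define K3 where "K3 = K * M2 + 16 * exp 1 * C0 * M1"
  have Gb: "norm (grad (\<phi> k) x) \<le> K3 * (1 + norm x) powr (- \<tau>)" for k x
  proof -
    define t where "t = (norm x)\<^sup>2"
    \<comment> \<open>The regularised radius. Up to the factor |x|/\<rho> <= 1 and the cutoff,
      \<open>T1\<close> yields the gradient length of the bubble at radius \<rho>, so its decay
      bound at \<rho> applies, and \<rho> >= |x| makes it a bound at |x|.\<close>
    define \<rho> where "\<rho> = sqrt (1 / n k + t)"
    have t: "t \<ge> 0" by (simp add: t_def)
    have pos: "1 / n k + t > 0" using n[of k] t by (simp add: add_pos_nonneg)
    have \<rho>: "\<rho> > 0" "norm x \<le> \<rho>" "1 / n k + t = \<rho> powr 2"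
    proof -
      show "\<rho> > 0" using pos by (simp add: \<rho>_def)
      show "norm x \<le> \<rho>" unfolding \<rho>_def using n[of k] by (intro real_le_rsqrt) (simp add: t_def)
      show "1 / n k + t = \<rho> powr 2" using pos by (simp add: \<rho>_def)
    qed
    have Wr: "W k t = 1 + c * \<rho> powr s" by (simp add: W_def \<rho>(3) powr_powr)
    have t1: "0 \<le> T1 k t" "2 * T1 k t * norm x \<le> K * M2 * (1 + norm x) powr (- \<tau>)"
    proof -
      show "0 \<le> T1 k t" using C0 m0 c s bump_bounds(1) by (simp add: T1_def)
      have "2 * T1 k t * norm x = K * \<rho> powr (s - 2) * W k t powr (- m0 - 1) * norm x * (exp 1 * bump (1 - t / (n k)\<^sup>2))"
        by (simp add: T1_def \<rho>(3) powr_powr K_def right_diff_distrib)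
      also have "\<dots> \<le> K * \<rho> powr (s - 2) * W k t powr (- m0 - 1) * norm x * 1"
        using e1[OF t] K by (intro mult_left_mono) auto
      also have "\<dots> \<le> K * \<rho> powr (s - 2) * W k t powr (- m0 - 1) * \<rho>"
        using \<rho> K by (simp add: mult_left_mono)
      also have "\<dots> = K * (\<rho> powr (s - 1) * (1 + c * \<rho> powr s) powr (- m0 - 1))"
        using \<rho>(1) by (simp add: Wr powr_diff field_simps power2_eq_square)
      also have "\<dots> \<le> K * (M2 * (1 + \<rho>) powr (- \<tau>))" using E2[of \<rho>] \<rho>(1) K by simp
      also have "\<dots> \<le> K * (M2 * (1 + norm x) powr (- \<tau>))"
        using \<rho> K M2 \<tau>0 by (intro mult_left_mono powr_mono2') (auto intro: add_pos_nonneg)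
      finally show "2 * T1 k t * norm x \<le> K * M2 * (1 + norm x) powr (- \<tau>)" by simp
    qed
    have t2: "0 \<le> T2 k t" "2 * T2 k t * norm x \<le> 16 * exp 1 * C0 * M1 * (1 + norm x) powr (- \<tau>)"
    proof -
      show "0 \<le> T2 k t" using C0 bump_deriv1_bounds(1) by (simp add: T2_def)
      show "2 * T2 k t * norm x \<le> 16 * exp 1 * C0 * M1 * (1 + norm x) powr (- \<tau>)"
      proof (cases "norm x \<ge> n k")
        case True
        then show ?thesis using bz(2)[OF True] C0 M1 by (simp add: T2_def t_def)
      next
        case False
        have nx: "1 / (n k)\<^sup>2 * norm x \<le> 2 / (1 + norm x)"
        proof -
          have "norm x * (1 + norm x) \<le> n k * (2 * n k)" using False n[of k] by (intro mult_mono) auto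
          then have "norm x * (1 + norm x) \<le> 2 * (n k)\<^sup>2" by (simp add: power2_eq_square)
          then show ?thesis using n[of k] by (simp add: field_simps add_pos_nonneg)
        qed
        have Wm: "W k t powr (- m0) \<le> M1 * (1 + norm x) powr (- (s * m0))"
        proof -
          have "W k t powr (- m0) \<le> M1 * (1 + \<rho>) powr (- (s * m0))" unfolding Wr by (rule M1) (use \<rho> in simp)
          also have "\<dots> \<le> M1 * (1 + norm x) powr (- (s * m0))"
            using \<rho> M1 s m0 by (intro mult_left_mono powr_mono2') (auto intro: add_pos_nonneg)
          finally show ?thesis .
        qed
        have "2 * T2 k t * norm x = 2 * exp 1 * C0 * (W k t powr (- m0) * bump_deriv (Suc 0) (1 - t / (n k)\<^sup>2) * (1 / (n k)\<^sup>2 * norm x))"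
          by (simp add: T2_def)
        also have "\<dots> \<le> 2 * exp 1 * C0 * (M1 * (1 + norm x) powr (- (s * m0)) * 4 * (2 / (1 + norm x)))"
          using C0 M1 by (intro mult_left_mono mult_mono Wm nx bump_deriv1_bounds) (auto intro: bump_deriv1_bounds)
        also have "\<dots> = 16 * exp 1 * C0 * M1 * ((1 + norm x) powr (- (s * m0)) * (1 + norm x) powr (- 1))"
          by (simp add: powr_minus powr_one divide_inverse)
        also have "\<dots> = 16 * exp 1 * C0 * M1 * (1 + norm x) powr (- \<tau>)"
          by (simp only: powr_add[symmetric] \<tau>e)
        finally show ?thesis .
      qed
    qed
    have "norm (grad (\<phi> k) x) = 2 * T1 k t * norm x + 2 * T2 k t * norm x"
    proof -
      have "\<bar>2 * (- T1 k t - T2 k t)\<bar> = 2 * T1 k t + 2 * T2 k t" using t1(1) t2(1) by simp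
      then show ?thesis by (simp only: grad\<phi> t_def[symmetric] norm_scaleR distrib_right)
    qed
    then show ?thesis using add_mono[OF t1(2) t2(2)] by (simp only: K3_def distrib_right)
  qed
  have um: "u \<in> borel_measurable lborel" unfolding u_def by measurable
  have gm: "g \<in> borel_measurable lborel" unfolding g_def by measurable
  note [measurable] = um gm
  have [measurable]: "\<phi> k \<in> borel_measurable lborel" "grad (\<phi> k) \<in> borel_measurable lborel" for k
    using test_fun_measurable[OF test] by auto
  have Np: "N > p" "p > 1" using p by (auto simp: N_def)
  have \<tau>p: "\<tau> * p > N"
  proof -
    have "\<tau> = (N - 1) / (p - 1)" using ms Np by (simp add: \<tau>_def N_def field_simps)
    moreover have "N * (p - 1) < (N - 1) * p" using Np by (simp add: algebra_simps)
    then have "N < (N - 1) * p / (p - 1)" using Np by (simp add: pos_less_divide_eq)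
    ultimately show ?thesis by simp
  qed
  have sq: "(s * m0) * sob_exp TYPE('a) p > N"
  proof -
    have "(s * m0) * sob_exp TYPE('a) p = N * p / (p - 1)"
      using ms Np by (simp add: sob_exp_def N_def[symmetric] mult.commute)
    moreover have "N < N * p / (p - 1)" using Np by (simp add: pos_less_divide_eq right_diff_distrib)
    ultimately show ?thesis by simp
  qed
  have q1: "sob_exp TYPE('a) p > 0" using sob_exp_ge[OF p] p by simp
  have dom: "(\<integral>\<^sup>+ x. ennreal ((B * (1 + norm x) powr (- a)) powr r) \<partial>(lborel :: 'a measure)) < \<infinity>"
    if "a * r > N" "B \<ge> 0" for a r B
  proof -
    have "integrable (lborel :: 'a measure) (\<lambda>x. B powr r * (1 + norm x) powr (- (a * r)))"
      using that by (intro integrable_mult_right integrable_decay) (simp add: N_def)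
    moreover have "(B * (1 + norm x) powr (- a)) powr r = B powr r * (1 + norm x) powr (- (a * r))" for x :: 'a
      using that by (simp add: powr_mult powr_powr)
    ultimately have "integrable (lborel :: 'a measure) (\<lambda>x. (B * (1 + norm x) powr (- a)) powr r)" by simp
    then show ?thesis unfolding integrable_iff_bounded by simp
  qed
  have gfin: "(\<integral>\<^sup>+ x. ennreal (norm (g x) powr p) \<partial>lborel) < \<infinity>"
  proof (rule order.strict_trans1[OF _ dom[of \<tau> p "K * M2"]])
    show "(\<integral>\<^sup>+ x. ennreal (norm (g x) powr p) \<partial>lborel) \<le> (\<integral>\<^sup>+ x. ennreal ((K * M2 * (1 + norm x) powr (- \<tau>)) powr p) \<partial>(lborel :: 'a measure))"
      using gb Np by (intro nn_integral_mono ennreal_leI powr_mono2) auto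
  qed (use \<tau>p K M2 in auto)
  have L1: "(\<lambda>k. bump (1 - t / (n k)\<^sup>2)) \<longlonglongrightarrow> exp (- 1)" "(\<lambda>k. bump_deriv (Suc 0) (1 - t / (n k)\<^sup>2)) \<longlonglongrightarrow> bump_deriv (Suc 0) 1" for t
  proof -
    have "(\<lambda>k. 1 - t * (1 / n k)\<^sup>2) \<longlonglongrightarrow> 1 - t * 0\<^sup>2" by (intro tendsto_intros nlim)
    then have l: "(\<lambda>k. 1 - t / (n k)\<^sup>2) \<longlonglongrightarrow> 1" by (simp add: power_divide)
    have "isCont bump 1" "isCont (bump_deriv (Suc 0)) 1"
      using bump_has_deriv bump_deriv_Suc DERIV_isCont by blast+
    from isCont_tendsto_compose[OF this(1) l] isCont_tendsto_compose[OF this(2) l]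
    show "(\<lambda>k. bump (1 - t / (n k)\<^sup>2)) \<longlonglongrightarrow> exp (- 1)" "(\<lambda>k. bump_deriv (Suc 0) (1 - t / (n k)\<^sup>2)) \<longlonglongrightarrow> bump_deriv (Suc 0) 1"
      by (auto simp: bump_def)
  qed
  have Wlim: "(\<lambda>k. W k ((norm x)\<^sup>2) powr a) \<longlonglongrightarrow> (1 + c * norm x powr s) powr a"
    and Plim: "(\<lambda>k. (1 / n k + (norm x)\<^sup>2) powr (s / 2 - 1)) \<longlonglongrightarrow> norm x powr (s - 2)" if x: "x \<noteq> 0" for a and x :: 'a
  proof -
    have l: "(\<lambda>k. 1 / n k + (norm x)\<^sup>2) \<longlonglongrightarrow> 0 + (norm x)\<^sup>2" by (intro tendsto_intros nlim)
    have nn: "(0 + (norm x)\<^sup>2) powr b = norm x powr (2 * b)" for b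
      using x by (simp add: powr_numeral[symmetric] powr_powr del: powr_numeral)
    have "(\<lambda>k. (1 / n k + (norm x)\<^sup>2) powr b) \<longlonglongrightarrow> norm x powr (2 * b)" for b
      unfolding nn[symmetric] by (rule tendsto_powr[OF l tendsto_const]) (use x in simp)
    from this[of "s / 2"] this[of "s / 2 - 1"]
    have l2: "(\<lambda>k. (1 / n k + (norm x)\<^sup>2) powr (s / 2)) \<longlonglongrightarrow> norm x powr s"
      and "(\<lambda>k. (1 / n k + (norm x)\<^sup>2) powr (s / 2 - 1)) \<longlonglongrightarrow> norm x powr (s - 2)" by (auto simp: right_diff_distrib)
    then show "(\<lambda>k. (1 / n k + (norm x)\<^sup>2) powr (s / 2 - 1)) \<longlonglongrightarrow> norm x powr (s - 2)" by simp
    have "1 + c * norm x powr s > 0" using c by (intro add_pos_nonneg) auto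
    then show "(\<lambda>k. W k ((norm x)\<^sup>2) powr a) \<longlonglongrightarrow> (1 + c * norm x powr s) powr a"
      unfolding W_def by (intro tendsto_powr tendsto_intros l2) auto
  qed
  have AE0: "AE x in (lborel :: 'a measure). norm x \<notin> {0}" by (rule AE_polar_finite) simp
  have \<phi>lim: "(\<lambda>k. \<phi> k x) \<longlonglongrightarrow> u x" if "x \<noteq> 0" for x
  proof -
    have "(\<lambda>k. \<phi> k x) \<longlonglongrightarrow> C0 * (1 + c * norm x powr s) powr (- m0) * (exp 1 * exp (- 1))"
      unfolding \<phi>_def H_def by (intro tendsto_intros Wlim that L1)
    then show ?thesis by (simp add: u_def exp_minus)
  qed
  have Glim: "(\<lambda>k. grad (\<phi> k) x) \<longlonglongrightarrow> g x" if "x \<noteq> 0" for x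
  proof -
    have "(\<lambda>k. (2 * (- T1 k ((norm x)\<^sup>2) - T2 k ((norm x)\<^sup>2))) *\<^sub>R x) \<longlonglongrightarrow>
      (2 * (- (C0 * m0 * c * (s / 2) * norm x powr (s - 2) * (1 + c * norm x powr s) powr (- m0 - 1) * (exp 1 * exp (- 1)))
        - C0 * (1 + c * norm x powr s) powr (- m0) * (exp 1 * bump_deriv (Suc 0) 1 * 0\<^sup>2))) *\<^sub>R x"
      unfolding T1_def T2_def power_one_over[symmetric]
      by (intro tendsto_intros Wlim Plim that L1 nlim)
    then show ?thesis by (simp add: grad\<phi> g_def K_def exp_minus)
  qed
  have clim: "(\<lambda>k. \<integral>\<^sup>+ x. ennreal (f k x powr r) \<partial>(lborel :: 'a measure)) \<longlonglongrightarrow> 0"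
    if [measurable]: "\<And>k. f k \<in> borel_measurable lborel" and r: "r > 0" and ar: "a * r > N" and B: "B \<ge> 0"
      and le: "\<And>k x. 0 \<le> f k x" "\<And>k x. f k x \<le> B * (1 + norm x) powr (- a)" and lim: "\<And>x. x \<noteq> 0 \<Longrightarrow> (\<lambda>k. f k x) \<longlonglongrightarrow> 0"
    for f :: "nat \<Rightarrow> 'a \<Rightarrow> real" and r a B
  proof -
    have "(\<lambda>k. \<integral>\<^sup>+ x. ennreal (f k x powr r) \<partial>(lborel :: 'a measure)) \<longlonglongrightarrow> (\<integral>\<^sup>+ x. 0 \<partial>(lborel :: 'a measure))"
    proof (rule nn_integral_dominated_convergence[OF _ _ _ _ dom[OF ar B]])
      show "AE x in lborel. ennreal (f k x powr r) \<le> ennreal ((B * (1 + norm x) powr (- a)) powr r)" for k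
        using le r by (intro AE_I2 ennreal_leI powr_mono2) auto
      show "AE x in lborel. (\<lambda>k. ennreal (f k x powr r)) \<longlonglongrightarrow> 0"
        using AE0
      proof eventually_elim
        case (elim x)
        then have "(\<lambda>k. f k x) \<longlonglongrightarrow> 0" using lim[of x] by simp
        then have "(\<lambda>k. f k x powr r) \<longlonglongrightarrow> 0" by (rule tendsto_zero_powrI[OF _ tendsto_const]) (use r le in auto)
        from tendsto_ennrealI[OF this] show ?case by simp
      qed
    qed measurable
    then show ?thesis by simp
  qed
  have "D1p_grad p u g"
    unfolding D1p_grad_def
  proof (intro conjI exI[of _ \<phi>] allI test um gm gfin)
    show "(\<lambda>k. \<integral>\<^sup>+ x. ennreal (norm (grad (\<phi> k) x - g x) powr p) \<partial>lborel) \<longlonglongrightarrow> 0"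
    proof (rule clim[where a = \<tau> and B = "K3 + K * M2"])
      show "norm (grad (\<phi> k) x - g x) \<le> (K3 + K * M2) * (1 + norm x) powr (- \<tau>)" for k x
        using norm_triangle_ineq4[of "grad (\<phi> k) x" "g x"] Gb[of k x] gb[of x] by (simp add: distrib_right)
      show "(\<lambda>k. norm (grad (\<phi> k) x - g x)) \<longlonglongrightarrow> 0" if "x \<noteq> 0" for x
        using Glim[OF that] by (intro tendsto_norm_zero) (simp add: LIM_zero)
      show "K3 + K * M2 \<ge> 0" using K M1 M2 C0 by (simp add: K3_def)
    qed (use \<tau>p Np in auto)
    show "(\<lambda>k. \<integral>\<^sup>+ x. ennreal (\<bar>\<phi> k x - u x\<bar> powr sob_exp TYPE('a) p) \<partial>lborel) \<longlonglongrightarrow> 0"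
    proof (rule clim[where a = "s * m0" and B = "C0 * M1"])
      show "\<bar>\<phi> k x - u x\<bar> \<le> C0 * M1 * (1 + norm x) powr (- (s * m0))" for k x
        using \<phi>b[of k x] ub[of x] by simp
      show "(\<lambda>k. \<bar>\<phi> k x - u x\<bar>) \<longlonglongrightarrow> 0" if "x \<noteq> 0" for x
        using \<phi>lim[OF that] by (intro tendsto_rabs_zero) (simp add: LIM_zero)
    qed (use sq q1 C0 M1 in auto)
  qed
  then show ?thesis unfolding u_def g_def .
qed

text \<open>The flux of the bubble is -\<psi>(|x|) x with \<psi> = K^{p-1} r^\<alpha> D^{-e}, and
  its negative has divergence N \<psi> + r \<psi>' = (N + \<alpha>) K^{p-1} r^\<alpha> D^{-(e+1)}.
  This is the source r^\<alpha> U^{q-1} because m0 (q-1) = e + 1 matches the powers of D and (N +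
  \<alpha>) K^{p-1} = C0^{q-1} the constants.\<close>

lemma U_fun_weak_solution:
  fixes p \<alpha> l :: real
  assumes p: "1 < p" "p < real DIM('a::euclidean_space)" and \<alpha>: "\<alpha> > 0" and l: "l > 0"
  shows "weak_solution p \<alpha> (U_fun p \<alpha> l :: 'a \<Rightarrow> real)"
proof -
  define N where "N = real DIM('a)"
  define s where "s = (p + \<alpha>) / (p - 1)"
  define m0 where "m0 = (N - p) / (p + \<alpha>)"
  define q where "q = p * (N + \<alpha>) / (N - p)"
  define \<kappa> where "\<kappa> = (N - p) / (p - 1)"
  define \<Lambda> where "\<Lambda> = (N + \<alpha>) * \<kappa> powr (p - 1)"
  define c where "c = l powr s"
  define C0 where "C0 = C_const N p \<alpha> * l powr ((N - p) / p)"
  define K where "K = C0 * m0 * c * s"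
  define e where "e = (m0 + 1) * (p - 1)"
  have Np: "1 < p" "p < N" "0 < \<alpha>" using p \<alpha> by (auto simp: N_def)
  have \<Lambda>: "\<Lambda> > 0" using Np by (simp add: \<Lambda>_def \<kappa>_def)
  have pos: "s > 1" "m0 > 0" "c > 0" "C0 > 0" "\<kappa> > 0" "e > 0"
  proof -
    show "C0 > 0" using \<Lambda> l by (simp add: C0_def C_const_def \<Lambda>_def[symmetric] \<kappa>_def[symmetric])
    show "e > 0" using Np by (simp add: e_def m0_def add_pos_pos)
  qed (use Np l in \<open>auto simp: s_def m0_def c_def \<kappa>_def\<close>)
  have ms: "m0 * s = \<kappa>" using Np by (simp add: m0_def s_def \<kappa>_def)
  have K: "K > 0" using pos by (simp add: K_def)
  have es: "e * s = N + \<alpha>"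
  proof -
    have "(p - 1) * s = p + \<alpha>" using Np by (simp add: s_def)
    moreover have "(m0 + 1) * (p + \<alpha>) = N + \<alpha>" using Np by (simp add: m0_def field_simps)
    ultimately show ?thesis by (simp add: e_def mult.assoc)
  qed
  have sp: "(s - 1) * (p - 1) = 1 + \<alpha>" using Np by (simp add: s_def field_simps)
  have mq: "m0 * (q - 1) = e + 1"
  proof -
    have "m0 * q = p * (N + \<alpha>) / (p + \<alpha>)" using Np by (simp add: m0_def q_def)
    moreover have "(m0 + 1) * p = p * (N + \<alpha>) / (p + \<alpha>)" using Np by (simp add: m0_def field_simps)
    ultimately show ?thesis by (simp add: e_def algebra_simps)
  qed
  \<comment> \<open>The equation that determines the constant of the bubble: since K = C0 \<kappa> c
    it says C0^{q-p} = \<Lambda> c^{p-1}, and q - p = p (p + \<alpha>)/(N - p) explains the exponent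
    in \<open>C_const\<close>.\<close>
  have Kq: "K powr (p - 1) * (N + \<alpha>) = C0 powr (q - 1)"
  proof -
    have "(N - p) / (p * (p + \<alpha>)) * (p * (p + \<alpha>) / (N - p)) = 1" using Np by simp
    moreover have "(N - p) / p * (p * (p + \<alpha>) / (N - p)) = s * (p - 1)" using Np by (simp add: s_def)
    moreover have "q - p = p * (p + \<alpha>) / (N - p)" using Np by (simp add: q_def field_simps)
    ultimately have "C0 powr (q - p) = \<Lambda> * c powr (p - 1)"
      using \<Lambda> l unfolding C0_def C_const_def \<kappa>_def[symmetric] \<Lambda>_def[symmetric] c_def
      by (simp add: powr_mult powr_powr)
    moreover have "C0 powr (q - 1) = C0 powr (q - p) * C0 powr (p - 1)" by (simp add: powr_add[symmetric])
    moreover have "K = C0 * \<kappa> * c" by (simp add: K_def ms[symmetric])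
    ultimately show ?thesis using pos by (simp add: powr_mult \<Lambda>_def)
  qed
  define D where "D r = 1 + c * r powr s" for r
  have D1: "D r \<ge> 1" for r using pos by (simp add: D_def)
  have D0: "D r > 0" for r using D1[of r] by linarith
  define u where "u = (\<lambda>x::'a. C0 * D (norm x) powr (- m0))"
  define g where "g = (\<lambda>x::'a. - (K * norm x powr (s - 2) * D (norm x) powr (- m0 - 1)) *\<^sub>R x)"
  have Uu: "(U_fun p \<alpha> l :: 'a \<Rightarrow> real) = u"
    unfolding U_fun_def[abs_def] u_def D_def c_def s_def m0_def C0_def N_def
    by (simp add: powr_minus divide_inverse)
  have dg: "D1p_grad p u g"
    unfolding u_def g_def K_def D_def
    by (rule bubble_D1p) (use p pos ms in \<open>auto simp: \<kappa>_def N_def\<close>)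
  define \<psi> where "\<psi> r = K powr (p - 1) * r powr \<alpha> * D r powr (- e)" for r
  define \<psi>' where "\<psi>' r = \<psi> r / r * (\<alpha> - e * s * (c * r powr s / D r))" for r
  define W where "W r = r powr \<alpha> * (C0 * D r powr (- m0)) powr (q - 1)" for r
  have [measurable]: "D \<in> borel_measurable borel" unfolding D_def[abs_def] by measurable
  have [measurable]: "\<psi> \<in> borel_measurable borel" unfolding \<psi>_def[abs_def] by measurable
  have [measurable]: "\<psi>' \<in> borel_measurable borel" "W \<in> borel_measurable borel"
    unfolding \<psi>'_def[abs_def] W_def[abs_def] by measurable
  have A: "norm (g x) powr (p - 2) * (g x \<bullet> v) = - (\<psi> (norm x) * (v \<bullet> x))" for x v
  proof (cases "x = 0")
    case False
    define r where "r = norm x"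
    have r: "r > 0" using False by (simp add: r_def)
    define z where "z = K * r powr (s - 2) * D r powr (- m0 - 1)"
    have z: "z > 0" using K r D0[of r] by (simp add: z_def)
    have ng: "norm (g x) = z * r" using z by (simp add: g_def z_def r_def)
    have zr: "z * r = K * r powr (s - 1) * D r powr (- m0 - 1)" using r by (simp add: z_def powr_diff power2_eq_square)
    have "(z * r) powr (p - 2) * z = (z * r) powr (p - 1) / r"
      using z r by (simp add: powr_diff power2_eq_square)
    also have "(z * r) powr (p - 1) = K powr (p - 1) * r powr (1 + \<alpha>) * D r powr (- e)"
    proof -
      have "(- m0 - 1) * (p - 1) = - e" by (simp add: e_def algebra_simps)
      then show ?thesis unfolding zr using K r D0[of r] by (simp add: powr_mult powr_powr sp)
    qed
    also have "\<dots> / r = \<psi> r" using r by (simp add: \<psi>_def powr_add)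
    finally have "(z * r) powr (p - 2) * z = \<psi> r" .
    moreover have "g x \<bullet> v = - z * (v \<bullet> x)" by (simp add: g_def z_def r_def inner_commute)
    ultimately show ?thesis by (simp add: ng r_def[symmetric] mult.assoc[symmetric])
  qed (simp add: g_def)
  have d\<psi>: "(\<psi> has_real_derivative \<psi>' r) (at r)" if r: "r > 0" for r
  proof -
    have 1: "((\<lambda>r. r powr \<alpha>) has_real_derivative \<alpha> * r powr \<alpha> * 1 / r) (at r)"
      by (rule DERIV_powr_const[OF DERIV_ident r])
    have "((\<lambda>r. r powr s) has_real_derivative s * r powr s * 1 / r) (at r)"
      by (rule DERIV_powr_const[OF DERIV_ident r])
    then have 2: "(D has_real_derivative c * (s * r powr s * 1 / r)) (at r)"
      unfolding D_def[abs_def] by (intro DERIV_cong[OF DERIV_add[OF DERIV_const DERIV_cmult]]) auto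
    have 3: "((\<lambda>r. D r powr (- e)) has_real_derivative - e * D r powr (- e) * (c * (s * r powr s * 1 / r)) / D r) (at r)"
      by (rule DERIV_powr_const[OF 2 D0])
    have "((\<lambda>r. K powr (p - 1) * (r powr \<alpha> * D r powr (- e))) has_real_derivative \<psi>' r) (at r)"
      by (rule DERIV_cong[OF DERIV_cmult[OF DERIV_mult[OF 1 3]]]) (simp add: \<psi>'_def \<psi>_def algebra_simps diff_divide_distrib)
    then show ?thesis unfolding \<psi>_def[abs_def] by (simp add: mult.assoc)
  qed
  have WW: "N * \<psi> r + r * \<psi>' r = W r" if r: "r > 0" for r
  proof -
    have "N * \<psi> r + r * \<psi>' r = \<psi> r * (N + \<alpha> - (N + \<alpha>) * (c * r powr s / D r))"
      using r by (simp add: \<psi>'_def es algebra_simps)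
    also have "N + \<alpha> - (N + \<alpha>) * (c * r powr s / D r) = (N + \<alpha>) / D r"
      using D0[of r] by (simp add: D_def field_simps)
    also have "\<psi> r * ((N + \<alpha>) / D r) = C0 powr (q - 1) * r powr \<alpha> * D r powr (- (e + 1))"
    proof -
      have "D r powr (- (e + 1)) = D r powr (- e) / D r" using powr_diff[of "D r" "- e" 1] D0[of r] by simp
      then show ?thesis by (simp add: \<psi>_def Kq[symmetric] mult_ac)
    qed
    also have "\<dots> = W r" using pos D0[of r] by (simp add: W_def powr_mult powr_powr mq[symmetric])
    finally show ?thesis .
  qed
  have \<psi>0: "\<psi> r \<ge> 0" for r by (simp add: \<psi>_def)
  have M: "\<exists>M. (\<forall>r. 0 \<le> r \<longrightarrow> r \<le> R \<longrightarrow> \<bar>\<psi> r\<bar> \<le> M) \<and> (\<forall>r. 0 < r \<longrightarrow> r \<le> R \<longrightarrow> r * \<bar>\<psi>' r\<bar> \<le> M)" for R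
  proof -
    define B where "B = K powr (p - 1) * \<bar>R\<bar> powr \<alpha>"
    have B0: "B \<ge> 0" by (simp add: B_def)
    have B: "\<bar>\<psi> r\<bar> \<le> B" if "0 \<le> r" "r \<le> R" for r
    proof -
      have "D r powr (- e) \<le> 1 powr (- e)" using D1[of r] pos by (intro powr_mono2') auto
      then have "\<psi> r \<le> K powr (p - 1) * r powr \<alpha> * 1" unfolding \<psi>_def by (intro mult_left_mono) auto
      also have "\<dots> \<le> B" unfolding B_def using that \<alpha> by (auto intro!: mult_left_mono powr_mono2)
      finally show ?thesis using \<psi>0 by simp
    qed
    have "r * \<bar>\<psi>' r\<bar> \<le> B * (\<alpha> + e * s)" if r: "0 < r" "r \<le> R" for r
    proof -
      have f: "0 \<le> c * r powr s / D r" "c * r powr s / D r \<le> 1" using D0[of r] pos by (auto simp: D_def field_simps)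
      have "r * \<bar>\<psi>' r\<bar> = \<psi> r * \<bar>\<alpha> - e * s * (c * r powr s / D r)\<bar>"
        using r \<psi>0[of r] by (simp add: \<psi>'_def abs_mult)
      also have "\<dots> \<le> B * (\<alpha> + e * s)"
      proof (intro mult_mono)
        have "e * s * (c * r powr s / D r) \<le> e * s * 1" using f pos by (intro mult_left_mono) auto
        moreover have "e * s * (c * r powr s / D r) \<ge> 0" by (intro mult_nonneg_nonneg f) (use pos in auto)
        ultimately show "\<bar>\<alpha> - e * s * (c * r powr s / D r)\<bar> \<le> \<alpha> + e * s" using \<alpha> by linarith
      qed (use B[of r] r B0 in auto)
      finally show ?thesis .
    qed
    moreover have "B \<le> B * (1 + \<alpha> + e * s)" "B * (\<alpha> + e * s) \<le> B * (1 + \<alpha> + e * s)"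
      using B0 \<alpha> pos by (auto simp: algebra_simps)
    ultimately show ?thesis using B by (intro exI[of _ "B * (1 + \<alpha> + e * s)"]) (meson order_trans)
  qed
  have qe: "crit_exp TYPE('a) p \<alpha> = q" by (simp add: crit_exp_def q_def N_def)
  have Wx: "norm x powr \<alpha> * u x powr (q - 1) * \<phi> x = W (norm x) * \<phi> x" for x and \<phi> :: "'a \<Rightarrow> real"
    by (simp add: W_def u_def)
  show ?thesis
    unfolding weak_solution_def Uu qe
  proof (intro exI[of _ g] conjI dg allI impI)
    fix \<phi> :: "'a \<Rightarrow> real" assume \<phi>: "test_fun \<phi>"
    have T: "integrable lborel (\<lambda>x. \<psi> (norm x) * (grad \<phi> x \<bullet> x))" "integrable lborel (\<lambda>x. W (norm x) * \<phi> x)"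
      "(\<integral>x. \<psi> (norm x) * (grad \<phi> x \<bullet> x) \<partial>lborel) = - (\<integral>x. W (norm x) * \<phi> x \<partial>lborel)"
      using integral_test_fun_radial_field[OF \<phi> _ _ _ d\<psi> M, of W] WW by (auto simp: N_def)
    show "integrable lborel (\<lambda>x. norm (g x) powr (p - 2) * (g x \<bullet> grad \<phi> x))" unfolding A using T(1) by simp
    show "integrable lborel (\<lambda>x. norm x powr \<alpha> * u x powr (q - 1) * \<phi> x)" unfolding Wx by (rule T(2))
    show "(\<integral>x. norm (g x) powr (p - 2) * (g x \<bullet> grad \<phi> x) \<partial>lborel) = (\<integral>x. norm x powr \<alpha> * u x powr (q - 1) * \<phi> x \<partial>lborel)"
      unfolding A Wx using T(3) by simp
  qed
qed

section \<open>Radial solutions are bubbles\<close>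

text \<open>\<open>J\<close> is the monotonicity product of the p-Laplacian for \<open>g\<close> and
  -\<beta> x/|x|, a vector whose flux is -b x/|x|: the difference of the fluxes times the difference
  of the vectors. It splits into one nonnegative term comparing the lengths |g| and \<beta> and one
  measuring how far \<open>g\<close> is from pointing towards the origin; if both vanish the vectors
  agree.\<close>

lemma p_laplace_strict_monotone:
  fixes g x :: "'a::euclidean_space" and p b :: real
  assumes p: "p > 1" and b: "b \<ge> 0" and x: "x \<noteq> 0"
  defines "\<beta> \<equiv> b powr (1 / (p - 1))"
  defines "J \<equiv> norm g powr (p - 2) * (g \<bullet> g) + b / norm x * (g \<bullet> x) +
      \<beta> / norm x * (norm g powr (p - 2) * (g \<bullet> x)) + \<beta> * b"
  shows "J \<ge> 0" "J = 0 \<Longrightarrow> g = - (\<beta> / norm x) *\<^sub>R x"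
proof -
  define G where "G = norm g"
  define t where "t = (g \<bullet> x) / norm x"
  have \<beta>0: "\<beta> \<ge> 0" by (simp add: \<beta>_def)
  have b\<beta>: "b = \<beta> powr (p - 1)" using p b by (cases "b = 0") (auto simp: \<beta>_def powr_powr)
  have tG: "- G \<le> t"
  proof -
    have "\<bar>g \<bullet> x\<bar> \<le> G * norm x" unfolding G_def by (rule Cauchy_Schwarz_ineq2)
    then have "- (G * norm x) \<le> g \<bullet> x" by linarith
    then show ?thesis using x by (simp add: t_def field_simps)
  qed
  have G0: "G \<ge> 0" by (simp add: G_def)
  \<comment> \<open>Valid also for G = 0 with p < 2, since \<open>0 powr a\<close> is 0 and the
    product with G then vanishes on both sides.\<close>
  have Gp: "G powr (p - 2) * G\<^sup>2 = G powr (p - 1) * G" "G powr (p - 2) * G = G powr (p - 1)"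
    using p by (cases "G = 0"; auto simp: powr_diff power2_eq_square G_def)+
  have J: "J = (G powr (p - 1) - \<beta> powr (p - 1)) * (G - \<beta>) + (b + \<beta> * G powr (p - 2)) * (t + G)"
  proof -
    have "J = G powr (p - 2) * G\<^sup>2 + b * t + \<beta> * G powr (p - 2) * t + \<beta> * b"
      by (simp add: J_def G_def t_def power2_norm_eq_inner)
    also have "\<dots> = G powr (p - 1) * G + b * t + \<beta> * G powr (p - 2) * t + \<beta> * b" by (simp only: Gp)
    also have "\<dots> = (G powr (p - 1) - b) * (G - \<beta>) + (b + \<beta> * G powr (p - 2)) * (t + G) + \<beta> * (G powr (p - 1) - G powr (p - 2) * G)"
      by (simp add: algebra_simps)
    finally show ?thesis using b\<beta> Gp(2) by simp
  qed
  have n1: "(G powr (p - 1) - \<beta> powr (p - 1)) * (G - \<beta>) \<ge> 0"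
  proof (cases "G \<le> \<beta>")
    case True
    then have "G powr (p - 1) \<le> \<beta> powr (p - 1)" using p G0 by (intro powr_mono2) auto
    then show ?thesis using True by (simp add: mult_nonpos_nonpos)
  next
    case False
    then have "\<beta> powr (p - 1) \<le> G powr (p - 1)" using p \<beta>0 by (intro powr_mono2) auto
    then show ?thesis using False by simp
  qed
  have n2: "(b + \<beta> * G powr (p - 2)) * (t + G) \<ge> 0" using b \<beta>0 tG by simp
  show "J \<ge> 0" using J n1 n2 by simp
  assume J0: "J = 0"
  then have z: "(G powr (p - 1) - \<beta> powr (p - 1)) * (G - \<beta>) = 0" "(b + \<beta> * G powr (p - 2)) * (t + G) = 0"
    using J n1 n2 by linarith+
  have GB: "G = \<beta>"
  proof (rule ccontr)
    assume ne: "G \<noteq> \<beta>"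
    then have "G powr (p - 1) = \<beta> powr (p - 1)" using z(1) by simp
    then show False using ne p G0 \<beta>0
      by (metis diff_gt_0_iff_gt linorder_neqE powr_less_mono2 less_irrefl)
  qed
  show "g = - (\<beta> / norm x) *\<^sub>R x"
  proof (cases "\<beta> = 0")
    case True
    then show ?thesis using GB by (simp add: G_def)
  next
    case False
    then have "b \<noteq> 0" by (auto simp: \<beta>_def)
    then have "b + \<beta> * G powr (p - 2) > 0" using b \<beta>0 by (intro add_pos_nonneg) auto
    then have tt: "t = - G" using z(2) by simp
    have gx: "g \<bullet> x = - G * norm x" using tt x by (simp add: t_def field_simps)
    have "(norm (g + (\<beta> / norm x) *\<^sub>R x))\<^sup>2 = G\<^sup>2 + 2 * (\<beta> / norm x) * (g \<bullet> x) + (\<beta> / norm x)\<^sup>2 * (norm x)\<^sup>2"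
      unfolding power2_norm_eq_inner G_def
      by (simp add: inner_add_left inner_add_right inner_commute power2_eq_square algebra_simps)
    also have "\<dots> = 0" using x by (simp add: gx GB[symmetric] power2_eq_square)
    finally have "g + (\<beta> / norm x) *\<^sub>R x = 0" by simp
    then show ?thesis by (simp add: eq_neg_iff_add_eq_0)
  qed
qed

lemma AE_open_not_empty:
  fixes S :: "'a::euclidean_space set"
  assumes "open S" "AE x in lborel. x \<notin> S"
  shows "S = {}"
proof (rule ccontr)
  assume ne: "S \<noteq> {}"
  have "S \<in> null_sets lborel" using assms by (simp add: AE_iff_null_sets)
  then have "negligible S" by (simp add: negligible_iff_null_sets null_sets_completionI)
  then show False using open_not_negligible[OF assms(1) ne] by simp
qed

text \<open>A radius with W < 0 would, by continuity, produce a nonempty open set of bad points,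
  which is not null.\<close>

lemma radial_AE_nonneg:
  assumes W: "continuous_on {0<..} W" and ae: "AE x in (lborel :: 'a::euclidean_space measure). W (norm x) \<ge> (0::real)" and r: "r > 0"
  shows "W r \<ge> 0"
proof (rule ccontr)
  assume neg: "\<not> W r \<ge> 0"
  have c: "continuous_on (- {0}) (\<lambda>x::'a. W (norm x))"
    by (rule continuous_on_compose2[OF W]) (auto intro!: continuous_intros)
  define S where "S = {x \<in> - {0::'a}. W (norm x) < 0}"
  have "open S" unfolding S_def
    using continuous_open_preimage[OF c _ open_lessThan[of 0]] by (simp add: vimage_def Int_def open_Compl)
  moreover have "AE x in lborel. x \<notin> S" using ae by eventually_elim (auto simp: S_def)
  ultimately have "S = {}" by (rule AE_open_not_empty)
  moreover obtain b :: 'a where "b \<in> Basis" using SOME_Basis by blast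
  then have "r *\<^sub>R b \<in> S" using r neg by (auto simp: S_def)
  ultimately show False by simp
qed

text \<open>The profile \<open>v\<close> need not be measurable; a compact set of positive measure on which \<open>u\<close> and
  \<open>W (norm x)\<close> differ is therefore projected to a compact set of radii.\<close>

lemma radial_eq_of_ball_integrals:
  fixes u :: "'a::euclidean_space \<Rightarrow> real"
  assumes [measurable]: "u \<in> borel_measurable lborel" "W \<in> borel_measurable borel"
    and rad: "AE x in lborel. u x = v (norm x)"
    and wpos: "\<And>r. r > 0 \<Longrightarrow> w r > 0" and [measurable]: "w \<in> borel_measurable borel"
    and int: "\<And>b. integrable lborel (\<lambda>x. indicator (ball 0 b) x * (w (norm x) * (u x - W (norm x))))"
    and zero: "\<And>b. b > 0 \<Longrightarrow> (\<integral>x. indicator (ball 0 b) x * (w (norm x) * (u x - W (norm x))) \<partial>lborel) = 0"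
  shows "AE x in lborel. u x = W (norm x)"
proof -
  define k where "k x = w (norm x) * (u x - W (norm x))" for x
  have [measurable]: "k \<in> borel_measurable lborel" unfolding k_def by measurable
  obtain Z where Z: "Z \<in> null_sets lborel" "\<And>x. x \<notin> Z \<Longrightarrow> u x = v (norm x)"
    using AE_E3[OF rad] by auto
  have *: "AE x in lborel. \<not> (\<sigma> * (u x - W (norm x)) > 0)" if \<sigma>: "\<bar>\<sigma>\<bar> = 1" for \<sigma>
  proof -
    define A where "A n = {x. \<sigma> * (u x - W (norm x)) > 0 \<and> x \<noteq> 0 \<and> x \<notin> Z \<and> x \<in> cball 0 (real n)}" for n
    have [measurable]: "Z \<in> sets borel" using Z(1) by (auto simp: null_sets_def)
    have Am: "A n \<in> sets borel" for n unfolding A_def by measurable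
    have An: "A n \<in> null_sets lborel" for n
    proof (rule ccontr)
      assume "A n \<notin> null_sets lborel"
      then have Apos: "emeasure lborel (A n) > 0" using Am[of n] by (simp add: null_sets_def zero_less_iff_neq_zero)
      have Afin: "emeasure lborel (A n) < \<infinity>"
        by (rule emeasure_bounded_finite) (rule bounded_subset[of "cball 0 (real n)"], auto simp: A_def)
      obtain a where a: "emeasure lborel (A n) = ennreal a" "a > 0" using Apos Afin by (cases "emeasure lborel (A n)") auto
      obtain T where T: "closed T" "T \<subseteq> A n" "emeasure lebesgue (A n - T) < ennreal a"
        using sets_lebesgue_inner_closed[OF sets_completionI_sets[of "A n" lborel] a(2)] Am[of n] by (metis sets_lborel)
      have [measurable]: "T \<in> sets borel" using T by auto
      have Tpos: "T \<notin> null_sets lborel"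
      proof
        assume "T \<in> null_sets lborel"
        then have "emeasure lborel (A n - T) = emeasure lborel (A n)" by (intro emeasure_Diff_null_set) (use Am in auto)
        moreover have "emeasure lborel (A n - T) < ennreal a" using T(3) Am[of n] by (simp add: emeasure_completion)
        ultimately show False using a by simp
      qed
      have comp: "compact T"
      proof -
        have "bounded T" by (rule bounded_subset[of "cball 0 (real n)"]) (use T(2) in \<open>auto simp: A_def\<close>)
        then show ?thesis using T(1) by (simp add: compact_eq_bounded_closed)
      qed
      define P where "P = norm ` T"
      have [measurable]: "P \<in> sets borel" unfolding P_def
        by (intro borel_compact compact_continuous_image comp continuous_intros)
      have Pn: "r \<le> real n" if "r \<in> P" for r using that T(2) by (auto simp: P_def A_def)
      have Fk: "integrable lborel (\<lambda>x. indicator P (norm x) * k x)"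
      proof (rule Bochner_Integration.integrable_bound[OF int[of "real n + 1"]])
        show "AE x in lborel. norm (indicator P (norm x) * k x) \<le> norm (indicator (ball 0 (real n + 1)) x * (w (norm x) * (u x - W (norm x))))"
          using Pn by (intro AE_I2) (force simp: k_def split: split_indicator)
      qed measurable
      have z: "(\<integral>x. indicator P (norm x) * k x \<partial>lborel) = 0"
        by (rule radial_integral_eq_zero[OF _ _ _ _ Fk]) (use int zero in \<open>auto simp: k_def\<close>)
      have "AE x in lborel. x \<notin> Z" using Z(1) by (rule AE_not_in)
      then have pos: "AE x in lborel. 0 \<le> \<sigma> * (indicator P (norm x) * k x) \<and> (norm x \<in> P \<longrightarrow> 0 < \<sigma> * (indicator P (norm x) * k x))"
      proof eventually_elim
        case (elim x)
        show ?case
        proof (cases "norm x \<in> P")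
          case True
          \<comment> \<open>Outside \<open>Z\<close> the value of \<open>u\<close> depends on the
            radius alone, so \<open>x\<close> inherits the strict inequality from a point of
            \<open>T\<close> on the same sphere. Hence \<open>k\<close> has one strict sign almost
            everywhere on the shell over \<open>P\<close>, and its vanishing integral forces the
            shell, and with it \<open>T\<close>, to be null.\<close>
          then obtain y where y: "y \<in> T" "norm y = norm x" by (auto simp: P_def)
          then have yA: "y \<in> A n" using T(2) by auto
          have "u x = u y" using Z(2)[of x] Z(2)[of y] elim yA y(2) by (simp add: A_def)
          then have "\<sigma> * (u x - W (norm x)) > 0" using yA y(2) by (simp add: A_def)
          moreover have "w (norm x) > 0" using yA y(2) by (intro wpos) (auto simp: A_def)
          ultimately have "w (norm x) * (\<sigma> * (u x - W (norm x))) > 0" by simp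
          then show ?thesis using True by (simp add: k_def mult.left_commute)
        qed auto
      qed
      have "(\<integral>x. \<sigma> * (indicator P (norm x) * k x) \<partial>lborel) = 0" using z by simp
      moreover have "integrable lborel (\<lambda>x. \<sigma> * (indicator P (norm x) * k x))" using Fk by simp
      ultimately have "AE x in lborel. \<sigma> * (indicator P (norm x) * k x) = 0"
        using pos by (subst (asm) integral_nonneg_eq_0_iff_AE) (auto elim: eventually_mono)
      with pos have "AE x in (lborel :: 'a measure). norm x \<notin> P" by eventually_elim auto
      then have "AE x in lborel. x \<notin> T" by eventually_elim (auto simp: P_def)
      then have "T \<in> null_sets lborel" by (subst (asm) AE_iff_null_sets[symmetric]) auto
      then show False using Tpos by simp
    qed
    have "AE x in lborel. \<forall>n. x \<notin> A n" using An AE_not_in by (auto simp: AE_all_countable)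
    moreover have "AE x in lborel. x \<notin> Z" using Z(1) by (rule AE_not_in)
    moreover have "AE x in (lborel :: 'a measure). norm x \<notin> {0}" by (rule AE_polar_finite) simp
    ultimately show ?thesis
    proof eventually_elim
      case (elim x)
      obtain n where "norm x \<le> real n" using real_arch_simple by blast
      then show ?case using elim by (auto simp: A_def)
    qed
  qed
  from *[of 1] *[of "- 1"] show ?thesis by (auto elim: eventually_elim2)
qed

text \<open>\<open>\<Theta> ((norm x)\<^sup>2)\<close> is a smooth stand-in for the positive part of
  b - |x|^2: the step function in its derivative is replaced by \<open>bump (n * (b - t))\<close>,
  which tends to it as n grows. The level b is a squared radius.\<close>

lemma bump_layer:
  fixes b n :: real
  assumes b: "b > 0" and n: "n > 0"
  shows "\<exists>\<Theta>. test_fun (\<lambda>x::'a::euclidean_space. \<Theta> ((norm x)\<^sup>2)) \<and>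
     (\<forall>t\<ge>0. (\<Theta> has_real_derivative - bump (n * (b - t))) (at t)) \<and>
     (\<forall>t\<ge>0. \<Theta> t = (\<integral>s. indicator {t..b} s * bump (n * (b - s)) \<partial>lborel))"
proof -
  define B where "B t = bump (n * (b - t))" for t
  have Bd: "(bump_deriv k has_real_derivative bump_deriv (Suc k) y) (at y)" for k y by (rule bump_deriv_Suc)
  have dB: "((\<lambda>t. bump_deriv k (n * (b - t))) has_real_derivative bump_deriv (Suc k) (n * (b - t)) * (- n)) (at t)" for k t
    by (rule DERIV_chain2[OF Bd]) (auto intro!: derivative_eq_intros)
  have contB: "continuous_on S B" for S
  proof -
    have "isCont B t" for t unfolding B_def[abs_def] using dB[of 0 t] DERIV_isCont by (auto simp: bump_deriv_0)
    then show ?thesis by (simp add: continuous_at_imp_continuous_on)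
  qed
  \<comment> \<open>The base point -1 makes \<Theta> differentiable on an open set containing t = 0,
    as the smoothness of the composition with |x|^2 demands.\<close>
  define \<Theta> where "\<Theta> t = integral {-1..b} B - integral {-1..t} B" for t
  have d\<Theta>: "(\<Theta> has_real_derivative - B t) (at t)" if t: "t > -1" for t
  proof -
    have "((\<lambda>t. integral {-1..t} B) has_real_derivative B t) (at t within {-1..t + 1})"
      by (rule integral_has_real_derivative[OF contB]) (use t in auto)
    then have "((\<lambda>t. integral {-1..t} B) has_real_derivative B t) (at t)"
      using t by (subst (asm) at_within_interior) (auto simp: interior_atLeastAtMost_real)
    then show ?thesis unfolding \<Theta>_def[abs_def] by (auto intro!: derivative_eq_intros)
  qed
  have B0: "B s = 0" if "s \<ge> b" for s using that n by (auto simp: B_def intro!: bump_zero mult_nonneg_nonpos)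
  have int: "B integrable_on {x..y}" for x y by (rule integrable_continuous_real[OF contB])
  have \<Theta>0: "\<Theta> t = 0" if t: "t \<ge> b" for t
  proof -
    have "integral {-1..b} B + integral {b..t} B = integral {-1..t} B"
      by (rule Henstock_Kurzweil_Integration.integral_combine) (use t b int in auto)
    moreover have "integral {b..t} B = integral {b..t} (\<lambda>s. 0)" by (rule integral_cong) (use B0 in auto)
    ultimately show ?thesis by (simp add: \<Theta>_def)
  qed
  have \<Theta>1: "\<Theta> t = integral {t..b} B" if t: "0 \<le> t" "t \<le> b" for t
  proof -
    have "integral {-1..t} B + integral {t..b} B = integral {-1..b} B"
      by (rule Henstock_Kurzweil_Integration.integral_combine) (use t int in auto)
    then show ?thesis by (simp add: \<Theta>_def)
  qed
  define D where "D k = (case k of 0 \<Rightarrow> \<Theta> | Suc j \<Rightarrow> (\<lambda>t. - ((- n) ^ j) * bump_deriv j (n * (b - t))))" for k :: nat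
  have dD: "(D k has_real_derivative D (Suc k) y) (at y)" if "y \<in> {-1<..}" for k y
  proof (cases k)
    case 0
    then show ?thesis using d\<Theta>[of y] that by (simp add: D_def B_def bump_deriv_0)
  next
    case (Suc j)
    have "((\<lambda>t. - ((- n) ^ j) * bump_deriv j (n * (b - t))) has_real_derivative - ((- n) ^ j) * (bump_deriv (Suc j) (n * (b - y)) * (- n))) (at y)"
      by (rule DERIV_cmult[OF dB])
    then show ?thesis using Suc by (simp add: D_def mult_ac)
  qed
  have "smooth_fun (\<lambda>x::'a. D 0 ((norm x)\<^sup>2))"
    by (rule smooth_fun_comp[OF smooth_fun_norm_sq, where T = "{-1<..}"]) (use dD in \<open>auto intro: less_le_trans[of _ 0]\<close>)
  then have sm: "smooth_fun (\<lambda>x::'a. \<Theta> ((norm x)\<^sup>2))" by (simp add: D_def)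
  have "{x::'a. \<Theta> ((norm x)\<^sup>2) \<noteq> 0} \<subseteq> cball 0 (sqrt b)"
  proof
    fix x :: 'a assume "x \<in> {x. \<Theta> ((norm x)\<^sup>2) \<noteq> 0}"
    then have "\<not> (norm x)\<^sup>2 \<ge> b" using \<Theta>0[of "(norm x)\<^sup>2"] by blast
    then have "(norm x)\<^sup>2 \<le> b" by simp
    then show "x \<in> cball 0 (sqrt b)" by (simp add: real_le_rsqrt)
  qed
  then have "bounded {x::'a. \<Theta> ((norm x)\<^sup>2) \<noteq> 0}" using bounded_subset bounded_cball by blast
  with sm have "test_fun (\<lambda>x::'a. \<Theta> ((norm x)\<^sup>2))" by (simp add: test_fun_def)
  moreover have "\<Theta> t = (\<integral>s. indicator {t..b} s * B s \<partial>lborel)" if t: "t \<ge> 0" for t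
  proof (cases "t \<le> b")
    case True
    have "set_integrable lborel {t..b} B"
      by (rule borel_integrable_compact[unfolded set_integrable_def[symmetric]]) (use contB in auto)
    from set_borel_integral_eq_integral(2)[OF this] show ?thesis
      using \<Theta>1[OF t True] by (simp add: set_lebesgue_integral_def)
  next
    case False
    then show ?thesis using \<Theta>0[of t] by simp
  qed
  ultimately show ?thesis using d\<Theta> by (intro exI[of _ \<Theta>]) (auto simp: B_def[symmetric])
qed

section \<open>A fixed positive radial weak solution and its radial quantities\<close>

locale radial_solution =
  fixes p \<alpha> :: real and u :: "'a::euclidean_space \<Rightarrow> real" and g :: "'a \<Rightarrow> 'a" and v :: "real \<Rightarrow> real"
  assumes p: "1 < p" "p < real DIM('a)" and \<alpha>: "\<alpha> > 0"
    and D1p: "D1p_grad p u g"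
    and weak: "\<And>\<phi>. test_fun \<phi> \<Longrightarrow>
        integrable lborel (\<lambda>x. norm (g x) powr (p - 2) * (g x \<bullet> grad \<phi> x)) \<and>
        integrable lborel (\<lambda>x. norm x powr \<alpha> * u x powr (crit_exp TYPE('a) p \<alpha> - 1) * \<phi> x) \<and>
        (\<integral>x. norm (g x) powr (p - 2) * (g x \<bullet> grad \<phi> x) \<partial>lborel) =
        (\<integral>x. norm x powr \<alpha> * u x powr (crit_exp TYPE('a) p \<alpha> - 1) * \<phi> x \<partial>lborel)"
    and radial: "AE x in lborel. u x = v (norm x)"
    and positive: "AE x in lborel. u x > 0"
begin

text \<open>Testing the weak gradient with the fields \<open>(b\<^sup>2 - |x|\<^sup>2)\<^sub>+ x\<close> expresses \<open>r\<^sup>N\<close> times the profile of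
  \<open>u\<close> through the integrals of \<open>f\<close> over balls; this is where the formula for \<open>V\<close> comes from. In the
  same way \<open>- b0 r\<close> is the mean of the radial part of \<open>flux\<close> over the sphere of radius \<open>r\<close>.\<close>

definition "N = real DIM('a)"
definition "q = crit_exp TYPE('a) p \<alpha>"
definition pd :: "real \<Rightarrow> real" where "pd = polar_density TYPE('a)"
definition f where "f x = g x \<bullet> x + N * u x" for x
definition V where "V r = ball_int f r / (r * pd r)" for r
definition h where "h x = norm x powr \<alpha> * u x powr (q - 1)" for x
definition b0 where "b0 r = ball_int h r / pd r" for r
definition flux where "flux x y = norm (g x) powr (p - 2) * (g x \<bullet> y)" for x y :: 'a

lemma measurables [measurable]:
  "u \<in> borel_measurable borel" "g \<in> borel_measurable borel" "pd \<in> borel_measurable borel"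
  using D1p unfolding D1p_grad_def pd_def by auto

lemma f_measurable [measurable]: "f \<in> borel_measurable borel"
  unfolding f_def[abs_def] by measurable

lemma h_measurable [measurable]: "h \<in> borel_measurable borel"
  unfolding h_def[abs_def] by measurable

lemma flux_measurable [measurable]: "F \<in> borel_measurable borel \<Longrightarrow> (\<lambda>x. flux x (F x)) \<in> borel_measurable borel"
  unfolding flux_def[abs_def] by measurable

lemma pd_pos: "r > 0 \<Longrightarrow> pd r > 0" by (simp add: pd_def polar_density_pos)

lemma pd_eq: "r > 0 \<Longrightarrow> pd r = pd 1 * r powr (N - 1)"
  by (simp add: pd_def polar_density_def N_def powr_realpow[symmetric] of_nat_diff DIM_positive Suc_leI)

lemma q_gt_1: "q > 1"
proof -
  have "1 * (N + \<alpha>) \<le> p * (N + \<alpha>)" using p \<alpha> by (intro mult_right_mono) (auto simp: N_def)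
  moreover have "N - p < 1 * (N + \<alpha>)" using p \<alpha> by simp
  ultimately have "N - p < p * (N + \<alpha>)" by (rule less_le_trans[rotated])
  then show ?thesis using p by (simp add: q_def crit_exp_def N_def)
qed

lemma flux_abs: "\<bar>flux x y\<bar> \<le> norm (g x) powr (p - 1) * norm y"
proof -
  have "\<bar>flux x y\<bar> \<le> norm (g x) powr (p - 2) * (norm (g x) * norm y)"
    unfolding flux_def abs_mult using Cauchy_Schwarz_ineq2[of "g x" y] by (simp add: mult_left_mono)
  also have "\<dots> = norm (g x) powr (p - 1) * norm y"
    by (cases "g x = 0") (auto simp: powr_diff power2_eq_square)
  finally show ?thesis .
qed

lemma test_equation:
  assumes "test_fun \<phi>"
  shows "integrable lborel (\<lambda>x. flux x (grad \<phi> x))" "integrable lborel (\<lambda>x. h x * \<phi> x)"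
    "(\<integral>x. flux x (grad \<phi> x) \<partial>lborel) = (\<integral>x. h x * \<phi> x \<partial>lborel)"
  using weak[OF assms] by (auto simp: flux_def h_def q_def)

lemma u_ball_integrable: "integrable lborel (\<lambda>x. indicator (ball 0 b) x * u x)"
  by (rule Bochner_Integration.integrable_bound[OF D1p_local_integrable(1)[OF D1p p, of b]], measurable)
    (auto split: split_indicator)

lemma gx_ball_integrable: "integrable lborel (\<lambda>x. indicator (ball 0 b) x * (g x \<bullet> x))"
proof (rule Bochner_Integration.integrable_bound)
  show "integrable lborel (\<lambda>x. b * (indicator (cball 0 b) x * norm (g x)))"
    using D1p_local_integrable(2)[OF D1p p, of b] by simp
  show "AE x in lborel. norm (indicator (ball 0 b) x * (g x \<bullet> x)) \<le> norm (b * (indicator (cball 0 b) x * norm (g x)))"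
  proof (intro AE_I2)
    fix x
    show "norm (indicator (ball 0 b) x * (g x \<bullet> x)) \<le> norm (b * (indicator (cball 0 b) x * norm (g x)))"
    proof (cases "norm x < b")
      case True
      have "\<bar>g x \<bullet> x\<bar> \<le> norm (g x) * norm x" by (rule Cauchy_Schwarz_ineq2)
      also have "\<dots> \<le> norm (g x) * b" using True by (intro mult_left_mono) auto
      finally have le: "\<bar>g x \<bullet> x\<bar> \<le> norm (g x) * b" .
      have "b > 0" using True norm_ge_zero[of x] by linarith
      then show ?thesis using True le by (simp add: abs_mult mult.commute)
    qed simp
  qed
qed measurable

lemma f_ball_integrable: "integrable lborel (\<lambda>x. indicator (ball 0 b) x * f x)"
proof -
  have "indicator (ball 0 b) x * f x = indicator (ball 0 b) x * (g x \<bullet> x) + N * (indicator (ball 0 b) x * u x)" for x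
    by (simp add: f_def algebra_simps)
  then show ?thesis using gx_ball_integrable u_ball_integrable by simp
qed

lemma flux_ball_integrable: "integrable lborel (\<lambda>x. indicator (ball 0 b) x * flux x x)"
proof (rule Bochner_Integration.integrable_bound)
  show "integrable lborel (\<lambda>x. b * (indicator (cball 0 b) x * norm (g x) powr (p - 1)))"
    using D1p_local_integrable(3)[OF D1p p, of b] by simp
  show "AE x in lborel. norm (indicator (ball 0 b) x * flux x x) \<le> norm (b * (indicator (cball 0 b) x * norm (g x) powr (p - 1)))"
  proof (intro AE_I2)
    fix x
    show "norm (indicator (ball 0 b) x * flux x x) \<le> norm (b * (indicator (cball 0 b) x * norm (g x) powr (p - 1)))"
    proof (cases "norm x < b")
      case True
      have "\<bar>flux x x\<bar> \<le> norm (g x) powr (p - 1) * norm x" by (rule flux_abs)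
      also have "\<dots> \<le> norm (g x) powr (p - 1) * b" using True by (intro mult_left_mono) auto
      finally have le: "\<bar>flux x x\<bar> \<le> norm (g x) powr (p - 1) * b" .
      have "b > 0" using True norm_ge_zero[of x] by linarith
      then show ?thesis using True le by (simp add: abs_mult mult.commute)
    qed simp
  qed
qed measurable

lemma h_nonneg: "h x \<ge> 0" by (simp add: h_def)

text \<open>The equation gives integrability of \<open>h\<close> against test functions only; a
  nonnegative one with values at least 1/e on the ball transfers it to the ball. The radius |b| + 1
  keeps the argument of \<open>bump\<close> at least 1 there.\<close>

lemma h_ball_integrable: "integrable lborel (\<lambda>x. indicator (ball 0 b) x * h x)"
proof -
  define \<phi> where "\<phi> x = bump ((\<bar>b\<bar> + 1)\<^sup>2 + (-1) * (norm x)\<^sup>2)" for x :: 'a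
  have "smooth_fun \<phi>" unfolding \<phi>_def[abs_def] by (intro smooth_fun_bump_comp smooth_fun_affine smooth_fun_norm_sq)
  moreover have "bounded {x. \<phi> x \<noteq> 0}"
  proof (rule bounded_subset[OF bounded_cball[of 0 "\<bar>b\<bar> + 1"]], rule subsetI)
    fix x assume "x \<in> {x. \<phi> x \<noteq> 0}"
    then have "\<not> (\<bar>b\<bar> + 1)\<^sup>2 + (-1) * (norm x)\<^sup>2 \<le> 0" using bump_zero unfolding \<phi>_def by blast
    then have "(norm x)\<^sup>2 \<le> (\<bar>b\<bar> + 1)\<^sup>2" by simp
    then show "x \<in> cball 0 (\<bar>b\<bar> + 1)" using power2_le_imp_le[of "norm x" "\<bar>b\<bar> + 1"] by simp
  qed
  ultimately have i: "integrable lborel (\<lambda>x. exp 1 * (h x * \<phi> x))"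
    using test_equation(2)[of \<phi>] by (simp add: test_fun_def)
  show ?thesis
  proof (rule Bochner_Integration.integrable_bound[OF i])
    show "AE x in lborel. norm (indicator (ball 0 b) x * h x) \<le> norm (exp 1 * (h x * \<phi> x))"
    proof (intro AE_I2)
      fix x :: 'a
      have \<phi>0: "\<phi> x \<ge> 0" by (simp add: \<phi>_def bump_bounds)
      show "norm (indicator (ball 0 b) x * h x) \<le> norm (exp 1 * (h x * \<phi> x))"
      proof (cases "norm x < b")
        case True
        then have "(norm x)\<^sup>2 \<le> \<bar>b\<bar>\<^sup>2" by (intro power_mono) auto
        then have t: "1 \<le> (\<bar>b\<bar> + 1)\<^sup>2 + (-1) * (norm x)\<^sup>2" by (simp add: power2_sum)
        then have "exp (- 1) \<le> \<phi> x" by (simp add: \<phi>_def bump_def)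
        then have "1 \<le> exp 1 * \<phi> x" by (simp add: exp_minus field_simps)
        then have "h x * 1 \<le> h x * (exp 1 * \<phi> x)" using h_nonneg by (intro mult_left_mono) auto
        then show ?thesis using True h_nonneg[of x] \<phi>0 by (simp add: mult_ac)
      qed simp
    qed
  qed measurable
qed

lemma ball_int_f_cont: "isCont (ball_int f) r"
  by (rule isCont_ball_int) (use f_ball_integrable in auto)

lemma ball_int_h_cont: "isCont (ball_int h) r"
  by (rule isCont_ball_int) (use h_ball_integrable in auto)

lemma ball_int_measurable [measurable]:
  "ball_int f \<in> borel_measurable borel" "ball_int h \<in> borel_measurable borel"
  using ball_int_f_cont ball_int_h_cont
  by (auto intro!: borel_measurable_continuous_onI continuous_at_imp_continuous_on)

lemma V_measurable [measurable]: "V \<in> borel_measurable borel"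
  unfolding V_def[abs_def] by measurable

lemma b0_measurable [measurable]: "b0 \<in> borel_measurable borel"
  unfolding b0_def[abs_def] by measurable

lemma pd_cont: "continuous_on {0<..} pd"
proof (rule continuous_on_eq)
  show "continuous_on {0<..} (\<lambda>r. pd 1 * r powr (N - 1))" by (intro continuous_intros) auto
qed (simp add: pd_eq[symmetric])

lemma V_cont: "continuous_on {0<..} V"
  unfolding V_def
proof (intro continuous_intros pd_cont)
  show "continuous_on {0<..} (ball_int f)" using ball_int_f_cont by (simp add: continuous_at_imp_continuous_on)
  show "\<forall>r\<in>{0<..}. r * pd r \<noteq> 0" using pd_pos by (auto simp: less_le)
qed

lemma b0_cont: "continuous_on {0<..} b0"
  unfolding b0_def
proof (intro continuous_intros pd_cont)
  show "continuous_on {0<..} (ball_int h)" using ball_int_h_cont by (simp add: continuous_at_imp_continuous_on)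
  show "\<forall>r\<in>{0<..}. pd r \<noteq> 0" using pd_pos by (auto simp: less_le)
qed

lemma AE_nonzero: "AE x in lborel. x \<noteq> (0::'a)"
  using AE_polar_finite[of "{0}", where 'a = 'a] by simp

text \<open>The field with \<psi> = (b^2 - r^2)_+ has divergence N \<psi> - 2 r^2 inside the ball,
  so the weak gradient identity equates the integral of \<open>f\<close> times \<psi> with that of 2
  |x|^2 u over the ball. The layer formula evaluates the former as the integral of 2 |x|^2 V over
  the same ball.\<close>

lemma u_layer:
  assumes b: "b > 0"
  shows "integrable lborel (\<lambda>x. indicator (ball 0 b) x * (2 * (norm x)\<^sup>2 * (u x - V (norm x))))"
    "(\<integral>x. indicator (ball 0 b) x * (2 * (norm x)\<^sup>2 * (u x - V (norm x))) \<partial>lborel) = 0"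
proof -
  define \<psi> where "\<psi> r = max 0 (b\<^sup>2 - r\<^sup>2)" for r :: real
  define \<psi>' where "\<psi>' r = (if r < b then - 2 * r else 0)" for r :: real
  have [measurable]: "\<psi> \<in> borel_measurable borel" "\<psi>' \<in> borel_measurable borel"
    unfolding \<psi>_def[abs_def] \<psi>'_def[abs_def] by measurable
  have \<psi>min: "\<psi> r = b\<^sup>2 - (min b r)\<^sup>2" if "r \<ge> 0" for r
    using that b by (auto simp: \<psi>_def min_def max_def power_mono)
  have lip: "\<bar>\<psi> r - \<psi> s\<bar> \<le> 2 * b * \<bar>r - s\<bar>" if "0 \<le> r" "0 \<le> s" for r s
  proof -
    have "\<psi> r - \<psi> s = (min b s - min b r) * (min b s + min b r)"
      using that by (simp add: \<psi>min power2_eq_square algebra_simps)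
    then have "\<bar>\<psi> r - \<psi> s\<bar> = \<bar>min b s - min b r\<bar> * \<bar>min b s + min b r\<bar>" by (simp add: abs_mult)
    also have "\<dots> \<le> \<bar>r - s\<bar> * (2 * b)" using that b by (intro mult_mono) (auto simp: min_def)
    finally show ?thesis by (simp add: mult.commute)
  qed
  have d: "(\<psi> has_real_derivative \<psi>' r) (at r)" if "r > 0" "r \<notin> {b}" for r
  proof (cases "r < b")
    case True
    have "((\<lambda>r. b\<^sup>2 - r\<^sup>2) has_real_derivative \<psi>' r) (at r)"
      using True by (auto intro!: derivative_eq_intros simp: \<psi>'_def)
    then show ?thesis
    proof (rule has_field_derivative_transform_within_open[of _ _ _ "{0<..<b}"])
      fix x assume "x \<in> {0<..<b}"
      then have "x\<^sup>2 \<le> b\<^sup>2" by (intro power_mono) auto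
      then show "b\<^sup>2 - x\<^sup>2 = \<psi> x" by (simp add: \<psi>_def)
    qed (use that True in auto)
  next
    case False
    have "((\<lambda>r. 0) has_real_derivative \<psi>' r) (at r)" using False by (simp add: \<psi>'_def)
    then show ?thesis
    proof (rule has_field_derivative_transform_within_open[of _ _ _ "{b<..}"])
      fix x assume "x \<in> {b<..}"
      then have "b\<^sup>2 \<le> x\<^sup>2" using b by (intro power_mono) auto
      then show "0 = \<psi> x" by (simp add: \<psi>_def)
    qed (use that False in auto)
  qed
  have R: "\<psi> r = 0" if "r > b" for r using that b by (simp add: \<psi>_def power_mono)
  note F = D1p_radial_field[OF D1p p lip less_imp_le[OF b] R, of "{b}" \<psi>']
  have F1: "integrable lborel (\<lambda>x. \<psi> (norm x) * (g x \<bullet> x))"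
    and F2: "integrable lborel (\<lambda>x. u x * (N * \<psi> (norm x) + norm x * \<psi>' (norm x)))"
    and F3: "(\<integral>x. \<psi> (norm x) * (g x \<bullet> x) \<partial>lborel) = - (\<integral>x. u x * (N * \<psi> (norm x) + norm x * \<psi>' (norm x)) \<partial>lborel)"
    using F d by (auto simp: N_def)
  note L = integral_layer[OF _ f_ball_integrable b, folded pd_def]
  have L1: "integrable lborel (\<lambda>x. f x * \<psi> (norm x))"
    and L2: "integrable lborel (\<lambda>x::'a. indicator (ball 0 b) x * (2 * norm x * ball_int f (norm x) / pd (norm x)))"
    and L3: "(\<integral>x. f x * \<psi> (norm x) \<partial>lborel) = (\<integral>x. indicator (ball (0::'a) b) x * (2 * norm x * ball_int f (norm x) / pd (norm x)) \<partial>lborel)"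
    using L by (auto simp: \<psi>_def)
  have eV: "2 * norm x * ball_int f (norm x) / pd (norm x) = 2 * (norm x)\<^sup>2 * V (norm x)" for x :: 'a
    by (cases "x = 0") (auto simp: V_def power2_eq_square)
  have e2: "f x * \<psi> (norm x) - \<psi> (norm x) * (g x \<bullet> x) - u x * (N * \<psi> (norm x) + norm x * \<psi>' (norm x)) = indicator (ball 0 b) x * (2 * (norm x)\<^sup>2 * u x)" for x
    by (auto simp: f_def \<psi>'_def algebra_simps power2_eq_square split: split_indicator)
  have i3: "integrable lborel (\<lambda>x. indicator (ball 0 b) x * (2 * (norm x)\<^sup>2 * u x))"
    unfolding e2[symmetric] by (intro Bochner_Integration.integrable_diff L1 F1 F2)
  have "(\<integral>x. indicator (ball 0 b) x * (2 * (norm x)\<^sup>2 * u x) \<partial>lborel) = (\<integral>x. f x * \<psi> (norm x) \<partial>lborel)"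
    unfolding e2[symmetric] using F3 by (simp add: L1 F1 F2)
  moreover have e4: "indicator (ball 0 b) x * (2 * (norm x)\<^sup>2 * (u x - V (norm x))) =
     indicator (ball 0 b) x * (2 * (norm x)\<^sup>2 * u x) - indicator (ball 0 b) x * (2 * norm x * ball_int f (norm x) / pd (norm x))" for x
    unfolding eV by (simp add: algebra_simps)
  ultimately show "integrable lborel (\<lambda>x. indicator (ball 0 b) x * (2 * (norm x)\<^sup>2 * (u x - V (norm x))))"
    "(\<integral>x. indicator (ball 0 b) x * (2 * (norm x)\<^sup>2 * (u x - V (norm x))) \<partial>lborel) = 0"
    unfolding e4 using L3 L2 i3 by auto
qed

lemma u_eq_V: "AE x in lborel. u x = V (norm x)"
proof (rule radial_eq_of_ball_integrals[where w = "\<lambda>r. 2 * r\<^sup>2", OF _ _ radial])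
  show "integrable lborel (\<lambda>x. indicator (ball 0 b) x * (2 * (norm x)\<^sup>2 * (u x - V (norm x))))" for b
    using u_layer(1)[of b] by (cases "b > 0") (auto simp: ball_empty not_less)
qed (use u_layer(2) in auto)

lemma V_nonneg: "r > 0 \<Longrightarrow> V r \<ge> 0"
proof (rule radial_AE_nonneg[OF V_cont])
  show "AE x in (lborel :: 'a measure). 0 \<le> V (norm x)"
    using u_eq_V positive by eventually_elim simp
qed

text \<open>The equation is tested with smooth approximations of (b^2 - |x|^2)_+, whose gradient
  tends to -2 x inside the ball. In the limit the left side is -2 times the ball integral of
  \<open>flux x x\<close>; the layer formula turns the right side into the ball integral of 2 |x|
  \<open>b0\<close>.\<close>

lemma flux_layer:
  assumes b: "b > 0"
  shows "integrable lborel (\<lambda>x. indicator (ball 0 b) x * (flux x x + norm x * b0 (norm x)))"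
    "(\<integral>x. indicator (ball 0 b) x * (flux x x + norm x * b0 (norm x)) \<partial>lborel) = 0"
proof -
  define n where "n k = real (Suc k)" for k
  have "\<forall>k. \<exists>\<Theta>. test_fun (\<lambda>x::'a. \<Theta> ((norm x)\<^sup>2)) \<and>
     (\<forall>t\<ge>0. (\<Theta> has_real_derivative - bump (n k * (b\<^sup>2 - t))) (at t)) \<and>
     (\<forall>t\<ge>0. \<Theta> t = (\<integral>s. indicator {t..b\<^sup>2} s * bump (n k * (b\<^sup>2 - s)) \<partial>lborel))"
    by (intro allI bump_layer) (use b in \<open>auto simp: n_def\<close>)
  from choice[OF this] obtain \<Theta> where \<Theta>: "\<And>k. test_fun (\<lambda>x::'a. \<Theta> k ((norm x)\<^sup>2))"
     "\<And>k t. t \<ge> 0 \<Longrightarrow> (\<Theta> k has_real_derivative - bump (n k * (b\<^sup>2 - t))) (at t)"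
     "\<And>k t. t \<ge> 0 \<Longrightarrow> \<Theta> k t = (\<integral>s. indicator {t..b\<^sup>2} s * bump (n k * (b\<^sup>2 - s)) \<partial>lborel)" by blast
  have G: "grad (\<lambda>x::'a. \<Theta> k ((norm x)\<^sup>2)) x = (2 * (- bump (n k * (b\<^sup>2 - (norm x)\<^sup>2)))) *\<^sub>R x" for k x
    by (rule grad_eqI[OF has_derivative_radial_square[OF \<Theta>(2)]]) simp
  have fl: "flux x (c *\<^sub>R x) = c * flux x x" for x c by (simp add: flux_def)
  have FG: "flux x (grad (\<lambda>x. \<Theta> k ((norm x)\<^sup>2)) x) = - 2 * (bump (n k * (b\<^sup>2 - (norm x)\<^sup>2)) * flux x x)" for k x
    by (simp only: G fl)
  have ii: "integrable lborel (indicator {t..b\<^sup>2} :: real \<Rightarrow> real)" for t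
    by (intro integrable_real_indicator) (auto simp: emeasure_lborel_Icc_eq)
  have bl: "(\<lambda>k. bump (n k * t)) \<longlonglongrightarrow> (if t > 0 then 1 else 0)" for t
  proof (cases "t > 0")
    case True
    have "(\<lambda>k. exp (- (1 / t * inverse (n k)))) \<longlonglongrightarrow> exp (- (1 / t * 0))"
      unfolding n_def by (intro tendsto_intros LIMSEQ_inverse_real_of_nat)
    moreover have "bump (n k * t) = exp (- (1 / t * inverse (n k)))" for k
    proof -
      have "n k * t > 0" using True by (simp add: n_def)
      then show ?thesis by (simp add: bump_def inverse_eq_divide mult.commute)
    qed
    ultimately show ?thesis using True by simp
  next
    case False
    then have "bump (n k * t) = 0" for k by (intro bump_zero) (simp add: n_def mult_nonneg_nonpos)
    then show ?thesis using False by simp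
  qed
  have blb: "(\<lambda>k. bump (n k * (b\<^sup>2 - (norm x)\<^sup>2))) \<longlonglongrightarrow> indicator (ball 0 b) x" for x :: 'a
  proof -
    have "b\<^sup>2 - (norm x)\<^sup>2 > 0 \<longleftrightarrow> norm x < b"
      using b by (auto intro: power2_less_imp_less power_strict_mono)
    then show ?thesis using bl[of "b\<^sup>2 - (norm x)\<^sup>2"] by (cases "norm x < b") auto
  qed
  have bb: "bump (n k * (b\<^sup>2 - (norm x)\<^sup>2)) \<le> indicator (ball 0 b) x" for k and x :: 'a
  proof (cases "norm x < b")
    case False
    then have "b\<^sup>2 \<le> (norm x)\<^sup>2" using b by (intro power_mono) auto
    then have "bump (n k * (b\<^sup>2 - (norm x)\<^sup>2)) = 0" by (intro bump_zero) (simp add: n_def mult_nonneg_nonpos)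
    then show ?thesis by simp
  qed (simp add: bump_bounds)
  have bm[measurable]: "bump \<in> borel_measurable borel"
    by (intro borel_measurable_continuous_onI continuous_at_imp_continuous_on ballI DERIV_isCont[OF bump_has_deriv])
  have lhs: "(\<lambda>k. \<integral>x. flux x (grad (\<lambda>x. \<Theta> k ((norm x)\<^sup>2)) x) \<partial>lborel) \<longlonglongrightarrow> (\<integral>x. - 2 * (indicator (ball 0 b) x * flux x x) \<partial>lborel)"
  proof (rule integral_dominated_convergence[where w = "\<lambda>x. 2 * \<bar>indicator (ball 0 b) x * flux x x\<bar>"])
    show "integrable lborel (\<lambda>x. 2 * \<bar>indicator (ball 0 b) x * flux x x\<bar>)" using flux_ball_integrable by simp
    show "AE x in lborel. (\<lambda>k. flux x (grad (\<lambda>x. \<Theta> k ((norm x)\<^sup>2)) x)) \<longlonglongrightarrow> - 2 * (indicator (ball 0 b) x * flux x x)"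
    proof (intro AE_I2)
      fix x
      show "(\<lambda>k. flux x (grad (\<lambda>x. \<Theta> k ((norm x)\<^sup>2)) x)) \<longlonglongrightarrow> - 2 * (indicator (ball 0 b) x * flux x x)"
        unfolding FG by (intro tendsto_intros blb)
    qed
    show "AE x in lborel. norm (flux x (grad (\<lambda>x. \<Theta> k ((norm x)\<^sup>2)) x)) \<le> 2 * \<bar>indicator (ball 0 b) x * flux x x\<bar>" for k
      unfolding FG using bb[of k] bump_bounds(1) by (intro AE_I2) (auto simp: abs_mult intro!: mult_right_mono)
  qed (unfold FG, measurable)
  have \<Theta>b: "0 \<le> \<Theta> k t" "\<Theta> k t \<le> max 0 (b\<^sup>2 - t)" if t: "t \<ge> 0" for k t
  proof -
    show "0 \<le> \<Theta> k t" unfolding \<Theta>(3)[OF t] by (intro integral_nonneg_AE AE_I2) (auto simp: bump_bounds)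
    have "\<Theta> k t \<le> (\<integral>s. indicator {t..b\<^sup>2} s \<partial>lborel)" unfolding \<Theta>(3)[OF t]
    proof (rule integral_mono)
      show "integrable lborel (\<lambda>s. indicator {t..b\<^sup>2} s * bump (n k * (b\<^sup>2 - s)))"
        by (rule Bochner_Integration.integrable_bound[OF ii[of t]])
          (auto simp: bump_bounds abs_mult split: split_indicator)
    qed (auto simp: bump_bounds ii split: split_indicator)
    also have "\<dots> = max 0 (b\<^sup>2 - t)" by (auto simp: max_def)
    finally show "\<Theta> k t \<le> max 0 (b\<^sup>2 - t)" .
  qed
  have \<Theta>lim: "(\<lambda>k. \<Theta> k t) \<longlonglongrightarrow> max 0 (b\<^sup>2 - t)" if t: "t \<ge> 0" for t
  proof -
    have "(\<lambda>k. \<integral>s. indicator {t..b\<^sup>2} s * bump (n k * (b\<^sup>2 - s)) \<partial>lborel) \<longlonglongrightarrow> (\<integral>s. indicator {t..b\<^sup>2} s \<partial>lborel)"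
    proof (rule integral_dominated_convergence[where w = "indicator {t..b\<^sup>2}"])
      show "AE s in lborel. (\<lambda>k. indicator {t..b\<^sup>2} s * bump (n k * (b\<^sup>2 - s))) \<longlonglongrightarrow> (indicator {t..b\<^sup>2} s :: real)"
        using AE_lborel_singleton[of "b\<^sup>2"]
      proof eventually_elim
        case (elim s)
        have "(\<lambda>k. indicator {t..b\<^sup>2} s * bump (n k * (b\<^sup>2 - s))) \<longlonglongrightarrow> indicator {t..b\<^sup>2} s * (if b\<^sup>2 - s > 0 then 1 else 0)"
          by (intro tendsto_intros bl)
        moreover have "indicator {t..b\<^sup>2} s * (if b\<^sup>2 - s > 0 then 1 else 0) = (indicator {t..b\<^sup>2} s :: real)"
          using elim by (auto split: split_indicator)
        ultimately show ?case by (simp only:)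
      qed
    qed (auto simp: bump_bounds abs_mult ii split: split_indicator)
    moreover have "(\<integral>s. indicator {t..b\<^sup>2} s \<partial>lborel) = max 0 (b\<^sup>2 - t)" by (auto simp: max_def)
    ultimately show ?thesis by (simp add: \<Theta>(3)[OF t])
  qed
  have [measurable]: "(\<lambda>x::'a. \<Theta> k ((norm x)\<^sup>2)) \<in> borel_measurable borel" for k
    by (rule test_fun_measurable[OF \<Theta>(1)])
  note L = integral_layer[OF _ h_ball_integrable b, folded pd_def]
  have L1: "integrable lborel (\<lambda>x. h x * max 0 (b\<^sup>2 - (norm x)\<^sup>2))"
    and L2: "integrable lborel (\<lambda>x::'a. indicator (ball 0 b) x * (2 * norm x * ball_int h (norm x) / pd (norm x)))"
    and L3: "(\<integral>x. h x * max 0 (b\<^sup>2 - (norm x)\<^sup>2) \<partial>lborel) = (\<integral>x. indicator (ball (0::'a) b) x * (2 * norm x * ball_int h (norm x) / pd (norm x)) \<partial>lborel)"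
    using L by auto
  have rhs: "(\<lambda>k. \<integral>x. h x * \<Theta> k ((norm x)\<^sup>2) \<partial>lborel) \<longlonglongrightarrow> (\<integral>x. h x * max 0 (b\<^sup>2 - (norm x)\<^sup>2) \<partial>lborel)"
  proof (rule integral_dominated_convergence[where w = "\<lambda>x. h x * max 0 (b\<^sup>2 - (norm x)\<^sup>2)"])
    show "AE x in lborel. (\<lambda>k. h x * \<Theta> k ((norm x)\<^sup>2)) \<longlonglongrightarrow> h x * max 0 (b\<^sup>2 - (norm x)\<^sup>2)"
      by (intro AE_I2 tendsto_intros \<Theta>lim) auto
    show "AE x in lborel. norm (h x * \<Theta> k ((norm x)\<^sup>2)) \<le> h x * max 0 (b\<^sup>2 - (norm x)\<^sup>2)" for k
    proof (intro AE_I2)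
      fix x :: 'a
      have "h x * \<Theta> k ((norm x)\<^sup>2) \<le> h x * max 0 (b\<^sup>2 - (norm x)\<^sup>2)"
        using \<Theta>b[of "(norm x)\<^sup>2" k] h_nonneg[of x] by (intro mult_left_mono) auto
      then show "norm (h x * \<Theta> k ((norm x)\<^sup>2)) \<le> h x * max 0 (b\<^sup>2 - (norm x)\<^sup>2)"
        using \<Theta>b(1)[of "(norm x)\<^sup>2" k] h_nonneg[of x] by (simp add: abs_mult)
    qed
  qed (use L1 in measurable)
  have "(\<integral>x. - 2 * (indicator (ball 0 b) x * flux x x) \<partial>lborel) = (\<integral>x. h x * max 0 (b\<^sup>2 - (norm x)\<^sup>2) \<partial>lborel)"
    using LIMSEQ_unique[OF lhs] rhs test_equation(3)[OF \<Theta>(1)] by simp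
  then have eq: "(\<integral>x. indicator (ball (0::'a) b) x * (2 * norm x * ball_int h (norm x) / pd (norm x)) \<partial>lborel) = - 2 * (\<integral>x. indicator (ball 0 b) x * flux x x \<partial>lborel)"
    using L3 by simp
  have e: "indicator (ball 0 b) x * (flux x x + norm x * b0 (norm x)) = indicator (ball 0 b) x * flux x x + 1 / 2 * (indicator (ball 0 b) x * (2 * norm x * ball_int h (norm x) / pd (norm x)))" for x
    by (simp add: b0_def algebra_simps)
  show "integrable lborel (\<lambda>x. indicator (ball 0 b) x * (flux x x + norm x * b0 (norm x)))"
    unfolding e by (intro Bochner_Integration.integrable_add integrable_mult_right flux_ball_integrable L2)
  show "(\<integral>x. indicator (ball 0 b) x * (flux x x + norm x * b0 (norm x)) \<partial>lborel) = 0"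
    unfolding e by (subst Bochner_Integration.integral_add[OF flux_ball_integrable integrable_mult_right[OF L2]],
        subst integral_mult_right_zero, subst eq) simp
qed

end

context radial_solution
begin

lemma flux_radial_zero:
  assumes "F \<in> borel_measurable borel"
    and "integrable lborel (\<lambda>x. F (norm x) * (flux x x + norm x * b0 (norm x)))"
  shows "(\<integral>x. F (norm x) * (flux x x + norm x * b0 (norm x)) \<partial>lborel) = 0"
proof (rule radial_integral_eq_zero[OF _ _ _ assms])
  show "integrable lborel (\<lambda>x. indicator (ball 0 b) x * (flux x x + norm x * b0 (norm x)))" for b
    using flux_layer(1)[of b] by (cases "b > 0") (auto simp: ball_empty not_less)
qed (use flux_layer(2) in auto)

definition hr where "hr r = r powr \<alpha> * V r powr (q - 1)" for r

lemma hr_measurable [measurable]: "hr \<in> borel_measurable borel"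
  unfolding hr_def[abs_def] by measurable

lemma h_eq_hr: "AE x in lborel. h x = hr (norm x)"
  using u_eq_V by eventually_elim (simp add: h_def hr_def)

lemma hr_cont: "continuous_on {0<..} hr"
  unfolding hr_def using V_nonneg q_gt_1 by (intro continuous_intros V_cont continuous_on_powr') auto

lemma ball_int_h_deriv: "r > 0 \<Longrightarrow> (ball_int h has_real_derivative pd r * hr r) (at r)"
  unfolding pd_def by (rule ball_int_derivative[OF _ h_ball_integrable h_eq_hr _ hr_cont]) auto

lemma b0_nonneg: "b0 r \<ge> 0"
  unfolding b0_def ball_int_def pd_def
  by (intro divide_nonneg_nonneg integral_nonneg_AE AE_I2 mult_nonneg_nonneg polar_density_nonneg h_nonneg) auto

text \<open>The length of a gradient whose flux has length \<open>b0\<close>; it is the candidate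
  for -V'.\<close>

definition \<beta> where "\<beta> r = b0 r powr (1 / (p - 1))" for r

lemma \<beta>_measurable [measurable]: "\<beta> \<in> borel_measurable borel"
  unfolding \<beta>_def[abs_def] by measurable

lemma \<beta>_nonneg: "\<beta> r \<ge> 0" by (simp add: \<beta>_def)

lemma \<beta>_cont: "continuous_on {0<..} \<beta>"
  unfolding \<beta>_def using b0_nonneg p by (intro continuous_intros b0_cont continuous_on_powr') auto

lemma bounded_on_annulus:
  assumes F: "continuous_on {0<..} (F :: real \<Rightarrow> real)" and a: "0 < a"
  shows "\<exists>B\<ge>0. \<forall>r>0. a \<le> r\<^sup>2 \<longrightarrow> r\<^sup>2 \<le> c \<longrightarrow> \<bar>F r\<bar> \<le> B"
proof -
  have "compact (F ` {sqrt a..sqrt c})"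
    by (intro compact_continuous_image continuous_on_subset[OF F]) (use a in \<open>auto intro: less_le_trans[of 0 "sqrt a"]\<close>)
  then have "bounded (F ` {sqrt a..sqrt c})" by (rule compact_imp_bounded)
  then obtain B where B: "\<forall>y\<in>F ` {sqrt a..sqrt c}. norm y \<le> B" unfolding bounded_iff by blast
  have "\<bar>F r\<bar> \<le> \<bar>B\<bar>" if "r > 0" "a \<le> r\<^sup>2" "r\<^sup>2 \<le> c" for r
  proof -
    have "sqrt a \<le> r" using that by (simp add: real_le_lsqrt)
    moreover have "r \<le> sqrt c" using that by (simp add: real_le_rsqrt)
    ultimately have "norm (F r) \<le> B" using B by auto
    then show ?thesis by simp
  qed
  then show ?thesis by (intro exI[of _ "\<bar>B\<bar>"]) auto
qed

section \<open>Localisation to an annulus and identification of the gradient\<close>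

context
  fixes a c :: real
  assumes ac: "0 < a" "a < c"
begin

text \<open>A smooth weight in t = |x|^2, positive exactly for a < t < c, where the product of the
  two factors is positive. It keeps away from the origin, where the continuity of \<open>V\<close>,
  \<open>hr\<close> and \<open>b0\<close> is not known.\<close>

definition R where "R t = bump ((t - a) * (c - t))" for t
definition R1 where "R1 t = bump_deriv (Suc 0) ((t - a) * (c - t)) * ((c - t) - (t - a))" for t
definition \<rho> where "\<rho> x = R ((norm x)\<^sup>2)" for x :: 'a

lemma R_deriv: "(R has_real_derivative R1 t) (at t)"
  unfolding R_def[abs_def] R1_def
  by (rule DERIV_chain2[OF bump_has_deriv]) (auto intro!: derivative_eq_intros)

lemma R_outside: "\<not> (a < t \<and> t < c) \<Longrightarrow> R t = 0" "\<not> (a < t \<and> t < c) \<Longrightarrow> R1 t = 0"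
proof -
  assume "\<not> (a < t \<and> t < c)"
  then have "(t - a) * (c - t) \<le> 0" using ac by (auto simp: mult_le_0_iff)
  then show "R t = 0" "R1 t = 0" by (auto simp: R_def R1_def bump_def bump_deriv_1)
qed

lemma R_pos: "a < t \<Longrightarrow> t < c \<Longrightarrow> R t > 0"
  by (simp add: R_def bump_pos)

lemma R_bounds: "0 \<le> R t" "R t \<le> 1" by (auto simp: R_def bump_bounds)

lemma R_cont: "continuous_on S R" "continuous_on S R1"
proof -
  show "continuous_on S R" using R_deriv DERIV_isCont by (blast intro: continuous_at_imp_continuous_on)
  have "continuous_on UNIV (bump_deriv (Suc 0))"
    using bump_deriv_Suc DERIV_isCont by (blast intro: continuous_at_imp_continuous_on)
  then have "continuous_on S (\<lambda>t. bump_deriv (Suc 0) ((t - a) * (c - t)))"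
    by (rule continuous_on_compose2) (auto intro!: continuous_intros)
  then show "continuous_on S R1" unfolding R1_def
    by (rule continuous_on_mult) (auto intro!: continuous_intros)
qed

lemma R_measurable [measurable]: "R \<in> borel_measurable borel" "R1 \<in> borel_measurable borel"
  using R_cont by (auto intro: borel_measurable_continuous_onI)

lemma R1_bounded: "\<exists>B\<ge>0. \<forall>t. \<bar>R1 t\<bar> \<le> B"
proof -
  have "compact (R1 ` {a..c})" by (intro compact_continuous_image R_cont) auto
  then have "bounded (R1 ` {a..c})" by (rule compact_imp_bounded)
  then obtain B where B: "\<forall>y\<in>R1 ` {a..c}. norm y \<le> B" unfolding bounded_iff by blast
  have "\<bar>R1 t\<bar> \<le> \<bar>B\<bar>" for t
  proof (cases "a < t \<and> t < c")
    case True
    then have "norm (R1 t) \<le> B" using B by auto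
    then show ?thesis by simp
  next
    case False
    then show ?thesis using R_outside(2)[OF False] by simp
  qed
  then show ?thesis by (intro exI[of _ "\<bar>B\<bar>"]) auto
qed

lemma \<rho>_smooth: "smooth_fun \<rho>"
proof -
  have "smooth_fun (\<lambda>x::'a. bump ((- a + 1 * (norm x)\<^sup>2) * (c + (-1) * (norm x)\<^sup>2)))"
    by (intro smooth_fun_bump_comp smooth_fun_mult smooth_fun_affine smooth_fun_norm_sq)
  then show ?thesis by (simp add: \<rho>_def[abs_def] R_def algebra_simps)
qed

lemma \<rho>_derivative: "(\<rho> has_derivative (\<lambda>y. y \<bullet> ((2 * R1 ((norm x)\<^sup>2)) *\<^sub>R x))) (at x)"
  unfolding \<rho>_def[abs_def] by (rule has_derivative_radial_square[OF R_deriv])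

lemma \<rho>_support: "norm x > sqrt c \<Longrightarrow> \<rho> x = 0" "norm x > sqrt c \<Longrightarrow> R1 ((norm x)\<^sup>2) = 0"
proof -
  assume "norm x > sqrt c"
  then have "c < (norm x)\<^sup>2" using real_less_lsqrt[of c "norm x"] ac by (meson norm_ge_zero not_less real_le_rsqrt)
  then have n: "\<not> (a < (norm x)\<^sup>2 \<and> (norm x)\<^sup>2 < c)" by simp
  show "\<rho> x = 0" "R1 ((norm x)\<^sup>2) = 0" unfolding \<rho>_def using R_outside[OF n] by auto
qed

text \<open>The equation tested with \<open>u \<rho>\<close>, which is reached through the test functions \<open>\<phi> k * \<rho>\<close>.\<close>

lemma energy_identity:
  shows "integrable lborel (\<lambda>x. \<rho> x * flux x (g x))"
    "integrable lborel (\<lambda>x. u x * (2 * R1 ((norm x)\<^sup>2) * flux x x))"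
    "integrable lborel (\<lambda>x. h x * (\<rho> x * u x))"
    "(\<integral>x. \<rho> x * flux x (g x) \<partial>lborel) + (\<integral>x. u x * (2 * R1 ((norm x)\<^sup>2) * flux x x) \<partial>lborel) =
     (\<integral>x. h x * (\<rho> x * u x) \<partial>lborel)"
proof -
  let ?B = "cball (0::'a) (sqrt c)"
  from D1p obtain \<phi> :: "nat \<Rightarrow> 'a \<Rightarrow> real" where \<phi>: "\<And>k. test_fun (\<phi> k)"
    and limg: "(\<lambda>k. \<integral>\<^sup>+ x. ennreal (norm (grad (\<phi> k) x - g x) powr p) \<partial>lborel) \<longlonglongrightarrow> 0"
    and limu: "(\<lambda>k. \<integral>\<^sup>+ x. ennreal (\<bar>\<phi> k x - u x\<bar> powr sob_exp TYPE('a) p) \<partial>lborel) \<longlonglongrightarrow> 0"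
    and gfin: "(\<integral>\<^sup>+ x. ennreal (norm (g x) powr p) \<partial>lborel) < \<infinity>"
    unfolding D1p_grad_def by blast
  have [measurable]: "\<phi> k \<in> borel_measurable borel" "grad (\<phi> k) \<in> borel_measurable borel" for k
    using test_fun_measurable[OF \<phi>] by auto
  have [measurable]: "\<rho> \<in> borel_measurable borel" unfolding \<rho>_def[abs_def] by measurable
  have sob: "sob_exp TYPE('a) p \<ge> p" by (rule sob_exp_ge[OF p])
  have bd: "(\<phi> k has_derivative (\<lambda>y. y \<bullet> grad (\<phi> k) x)) (at x)" for k x
    using smooth_fun_grad(1) \<phi>[of k] by (auto simp: test_fun_def)
  have test: "test_fun (\<lambda>x. \<phi> k x * \<rho> x)" for k
  proof -
    have "smooth_fun (\<lambda>x. \<phi> k x * \<rho> x)" using \<phi>[of k] \<rho>_smooth by (intro smooth_fun_mult) (auto simp: test_fun_def)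
    moreover have "bounded {x. \<phi> k x * \<rho> x \<noteq> 0}"
      by (rule bounded_subset[of "{x. \<phi> k x \<noteq> 0}"]) (use \<phi>[of k] in \<open>auto simp: test_fun_def\<close>)
    ultimately show ?thesis by (simp add: test_fun_def)
  qed
  have grad: "grad (\<lambda>x. \<phi> k x * \<rho> x) x = \<rho> x *\<^sub>R grad (\<phi> k) x + (\<phi> k x * (2 * R1 ((norm x)\<^sup>2))) *\<^sub>R x" for k x
    by (rule grad_eqI, rule has_derivative_eq_rhs[OF has_derivative_mult[OF bd \<rho>_derivative]])
      (auto simp: inner_add_right algebra_simps)
  have fl: "flux x (grad (\<lambda>x. \<phi> k x * \<rho> x) x) = \<rho> x * flux x (grad (\<phi> k) x) + \<phi> k x * (2 * R1 ((norm x)\<^sup>2) * flux x x)" for k x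
    by (simp add: grad flux_def inner_add_right algebra_simps)
  obtain B1 where B1: "B1 \<ge> 0" "\<And>t. \<bar>R1 t\<bar> \<le> B1" using R1_bounded by blast
  define C where "C = 2 * B1 * sqrt c"
  have C0: "C \<ge> 0" using B1 ac by (simp add: C_def)
  have fR: "\<bar>2 * R1 ((norm x)\<^sup>2) * flux x x\<bar> \<le> C * norm (g x) powr (p - 1) * indicator ?B x" for x
  proof (cases "norm x \<le> sqrt c")
    case True
    have "\<bar>2 * R1 ((norm x)\<^sup>2) * flux x x\<bar> = 2 * \<bar>R1 ((norm x)\<^sup>2)\<bar> * \<bar>flux x x\<bar>" by (simp add: abs_mult)
    also have "\<dots> \<le> 2 * B1 * (norm (g x) powr (p - 1) * sqrt c)"
    proof (intro mult_mono B1)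
      have "\<bar>flux x x\<bar> \<le> norm (g x) powr (p - 1) * norm x" by (rule flux_abs)
      also have "\<dots> \<le> norm (g x) powr (p - 1) * sqrt c" using True by (intro mult_left_mono) auto
      finally show "\<bar>flux x x\<bar> \<le> norm (g x) powr (p - 1) * sqrt c" .
    qed (use B1 in auto)
    finally show ?thesis using True by (simp add: C_def mult_ac)
  qed (use \<rho>_support(2) in auto)
  have f\<rho>: "\<bar>\<rho> x * flux x y\<bar> \<le> norm (g x) powr (p - 1) * norm y * indicator ?B x" for x y
  proof (cases "norm x \<le> sqrt c")
    case True
    have "\<bar>\<rho> x * flux x y\<bar> \<le> 1 * (norm (g x) powr (p - 1) * norm y)"
      unfolding abs_mult using R_bounds[of "(norm x)\<^sup>2"] flux_abs[of x y] by (intro mult_mono) (auto simp: \<rho>_def)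
    then show ?thesis using True by simp
  qed (use \<rho>_support(1) in auto)
  \<comment> \<open>On the annulus \<open>h\<close> agrees almost everywhere with a continuous
    function of the radius and is therefore bounded, so convergence of the approximants in L^1 on
    the ball suffices for the source term.\<close>
  obtain Bh where Bh: "Bh \<ge> 0" "\<And>r. r > 0 \<Longrightarrow> a \<le> r\<^sup>2 \<Longrightarrow> r\<^sup>2 \<le> c \<Longrightarrow> \<bar>hr r\<bar> \<le> Bh"
    using bounded_on_annulus[OF hr_cont ac(1), of c] by blast
  have h\<rho>: "AE x in lborel. \<bar>h x * \<rho> x\<bar> \<le> Bh * indicator ?B x"
    using h_eq_hr AE_nonzero
  proof eventually_elim
    case (elim x)
    show ?case
    proof (cases "a < (norm x)\<^sup>2 \<and> (norm x)\<^sup>2 < c")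
      case True
      then have "\<bar>h x\<bar> \<le> Bh" using Bh(2)[of "norm x"] elim by simp
      then have "\<bar>h x\<bar> * \<bar>\<rho> x\<bar> \<le> Bh * 1" using R_bounds[of "(norm x)\<^sup>2"] Bh(1) by (intro mult_mono) (auto simp: \<rho>_def)
      moreover have "norm x \<le> sqrt c" using True by (intro real_le_rsqrt) simp
      ultimately show ?thesis by (simp add: abs_mult)
    next
      case False
      then show ?thesis using R_outside(1)[OF False] Bh(1) by (simp add: \<rho>_def)
    qed
  qed
  note gl = D1p_local_integrable(3)[OF D1p p, of "sqrt c"]
  have i1: "integrable lborel (\<lambda>x. \<rho> x * flux x (grad (\<phi> k) x))" for k
  proof -
    obtain L' R' where L: "\<And>x. norm (grad (\<phi> k) x) \<le> L'" using test_fun_facts[OF \<phi>[of k]] by blast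
    show ?thesis
    proof (rule Bochner_Integration.integrable_bound[OF integrable_mult_right[OF gl, of L']])
      show "AE x in lborel. norm (\<rho> x * flux x (grad (\<phi> k) x)) \<le> norm (L' * (indicator ?B x * norm (g x) powr (p - 1)))"
      proof (intro AE_I2)
        fix x
        have "\<bar>\<rho> x * flux x (grad (\<phi> k) x)\<bar> \<le> norm (g x) powr (p - 1) * norm (grad (\<phi> k) x) * indicator ?B x" by (rule f\<rho>)
        also have "\<dots> \<le> norm (g x) powr (p - 1) * L' * indicator ?B x" using L by (intro mult_right_mono mult_left_mono) auto
        also have "\<dots> \<le> norm (L' * (indicator ?B x * norm (g x) powr (p - 1)))" by (simp add: mult_ac)
        finally show "norm (\<rho> x * flux x (grad (\<phi> k) x)) \<le> norm (L' * (indicator ?B x * norm (g x) powr (p - 1)))" by simp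
      qed
    qed measurable
  qed
  have i2: "integrable lborel (\<lambda>x. \<phi> k x * (2 * R1 ((norm x)\<^sup>2) * flux x x))" for k
  proof -
    have "integrable lborel (\<lambda>x. flux x (grad (\<lambda>x. \<phi> k x * \<rho> x) x) - \<rho> x * flux x (grad (\<phi> k) x))"
      by (intro Bochner_Integration.integrable_diff test_equation(1)[OF test] i1)
    then show ?thesis by (simp add: fl)
  qed
  have i3: "integrable lborel (\<lambda>x. h x * (\<rho> x * \<phi> k x))" for k
    using test_equation(2)[OF test[of k]] by (simp add: mult_ac)
  have eq: "(\<integral>x. \<rho> x * flux x (grad (\<phi> k) x) \<partial>lborel) + (\<integral>x. \<phi> k x * (2 * R1 ((norm x)\<^sup>2) * flux x x) \<partial>lborel) = (\<integral>x. h x * (\<rho> x * \<phi> k x) \<partial>lborel)" for k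
    using test_equation(3)[OF test[of k]] unfolding fl
    by (subst Bochner_Integration.integral_add[OF i1 i2, symmetric]) (simp add: mult_ac)
  have lg: "(\<lambda>k. \<integral>\<^sup>+ x. ennreal (norm (grad (\<phi> k) x - g x) powr p) * indicator ?B x \<partial>lborel) \<longlonglongrightarrow> 0"
    by (rule nn_integral_local_convergence[OF _ _ _ _ limg]) (use p in auto)
  have lu: "(\<lambda>k. \<integral>\<^sup>+ x. ennreal (\<bar>\<phi> k x - u x\<bar> powr p) * indicator ?B x \<partial>lborel) \<longlonglongrightarrow> 0"
    by (rule nn_integral_local_convergence[OF _ _ _ _ limu]) (use p sob in auto)
  have lu1: "(\<lambda>k. \<integral>\<^sup>+ x. ennreal \<bar>\<phi> k x - u x\<bar> * indicator ?B x \<partial>lborel) \<longlonglongrightarrow> 0"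
    using nn_integral_local_convergence[OF _ _ _ _ limu, of 1 "sqrt c"] p sob by simp
  have y1: "(\<lambda>k. \<integral>\<^sup>+ x. ennreal (norm (g x) powr (p - 1) * norm (grad (\<phi> k) x - g x)) * indicator ?B x \<partial>lborel) \<longlonglongrightarrow> 0"
    by (rule nn_integral_young_convergence[OF _ _ _ _ _ gfin lg]) (use p in auto)
  have y2: "(\<lambda>k. \<integral>\<^sup>+ x. ennreal (norm (g x) powr (p - 1) * \<bar>\<phi> k x - u x\<bar>) * indicator ?B x \<partial>lborel) \<longlonglongrightarrow> 0"
    by (rule nn_integral_young_convergence[OF _ _ _ _ _ gfin lu]) (use p in auto)
  have c1: "(\<lambda>k. \<integral>\<^sup>+ x. ennreal \<bar>\<rho> x * flux x (grad (\<phi> k) x) - \<rho> x * flux x (g x)\<bar> \<partial>lborel) \<longlonglongrightarrow> 0"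
  proof (rule nn_integral_weighted_null[OF y1, where C = 1])
    fix k
    have "\<rho> x * flux x (grad (\<phi> k) x) - \<rho> x * flux x (g x) = \<rho> x * flux x (grad (\<phi> k) x - g x)" for x
      by (simp add: flux_def inner_diff_right algebra_simps)
    then show "AE x in lborel. \<bar>\<rho> x * flux x (grad (\<phi> k) x) - \<rho> x * flux x (g x)\<bar> \<le> 1 * (norm (g x) powr (p - 1) * norm (grad (\<phi> k) x - g x)) * indicator ?B x"
      using f\<rho> by simp
  qed auto
  have c2: "(\<lambda>k. \<integral>\<^sup>+ x. ennreal \<bar>\<phi> k x * (2 * R1 ((norm x)\<^sup>2) * flux x x) - u x * (2 * R1 ((norm x)\<^sup>2) * flux x x)\<bar> \<partial>lborel) \<longlonglongrightarrow> 0"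
  proof (rule nn_integral_weighted_null[OF y2, where C = C])
    fix k
    show "AE x in lborel. \<bar>\<phi> k x * (2 * R1 ((norm x)\<^sup>2) * flux x x) - u x * (2 * R1 ((norm x)\<^sup>2) * flux x x)\<bar> \<le> C * (norm (g x) powr (p - 1) * \<bar>\<phi> k x - u x\<bar>) * indicator ?B x"
    proof (intro AE_I2)
      fix x
      have "\<bar>\<phi> k x * (2 * R1 ((norm x)\<^sup>2) * flux x x) - u x * (2 * R1 ((norm x)\<^sup>2) * flux x x)\<bar> = \<bar>\<phi> k x - u x\<bar> * \<bar>2 * R1 ((norm x)\<^sup>2) * flux x x\<bar>"
        by (simp only: abs_mult[symmetric] left_diff_distrib)
      also have "\<dots> \<le> \<bar>\<phi> k x - u x\<bar> * (C * norm (g x) powr (p - 1) * indicator ?B x)" by (intro mult_left_mono fR) auto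
      finally show "\<bar>\<phi> k x * (2 * R1 ((norm x)\<^sup>2) * flux x x) - u x * (2 * R1 ((norm x)\<^sup>2) * flux x x)\<bar> \<le> C * (norm (g x) powr (p - 1) * \<bar>\<phi> k x - u x\<bar>) * indicator ?B x"
        by (simp add: mult_ac)
    qed
  qed (use C0 in auto)
  have c3: "(\<lambda>k. \<integral>\<^sup>+ x. ennreal \<bar>h x * (\<rho> x * \<phi> k x) - h x * (\<rho> x * u x)\<bar> \<partial>lborel) \<longlonglongrightarrow> 0"
  proof (rule nn_integral_weighted_null[OF lu1, where C = Bh])
    fix k
    show "AE x in lborel. \<bar>h x * (\<rho> x * \<phi> k x) - h x * (\<rho> x * u x)\<bar> \<le> Bh * \<bar>\<phi> k x - u x\<bar> * indicator ?B x"
      using h\<rho>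
    proof eventually_elim
      case (elim x)
      have "\<bar>h x * (\<rho> x * \<phi> k x) - h x * (\<rho> x * u x)\<bar> = \<bar>h x * \<rho> x\<bar> * \<bar>\<phi> k x - u x\<bar>"
        by (simp only: abs_mult[symmetric] right_diff_distrib mult.assoc)
      also have "\<dots> \<le> (Bh * indicator ?B x) * \<bar>\<phi> k x - u x\<bar>" using elim by (intro mult_right_mono) auto
      finally show ?case by (simp add: mult_ac)
    qed
  qed (use Bh in auto)
  have m: "(\<lambda>x. \<rho> x * flux x (g x)) \<in> borel_measurable lborel"
    "(\<lambda>x. u x * (2 * R1 ((norm x)\<^sup>2) * flux x x)) \<in> borel_measurable lborel"
    "(\<lambda>x. h x * (\<rho> x * u x)) \<in> borel_measurable lborel" by measurable
  show "integrable lborel (\<lambda>x. \<rho> x * flux x (g x))" by (rule integral_convergence_L1(1)[OF i1 m(1) c1])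
  show "integrable lborel (\<lambda>x. u x * (2 * R1 ((norm x)\<^sup>2) * flux x x))" by (rule integral_convergence_L1(1)[OF i2 m(2) c2])
  show "integrable lborel (\<lambda>x. h x * (\<rho> x * u x))" by (rule integral_convergence_L1(1)[OF i3 m(3) c3])
  have "(\<lambda>k. \<integral>x. h x * (\<rho> x * \<phi> k x) \<partial>lborel) \<longlonglongrightarrow> (\<integral>x. \<rho> x * flux x (g x) \<partial>lborel) + (\<integral>x. u x * (2 * R1 ((norm x)\<^sup>2) * flux x x) \<partial>lborel)"
    unfolding eq[symmetric]
    by (intro tendsto_add integral_convergence_L1(2)[OF i1 m(1) c1] integral_convergence_L1(2)[OF i2 m(2) c2])
  from LIMSEQ_unique[OF this integral_convergence_L1(2)[OF i3 m(3) c3]]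
  show "(\<integral>x. \<rho> x * flux x (g x) \<partial>lborel) + (\<integral>x. u x * (2 * R1 ((norm x)\<^sup>2) * flux x x) \<partial>lborel) =
     (\<integral>x. h x * (\<rho> x * u x) \<partial>lborel)" .
qed

text \<open>The field \<psi>(|x|) x is the cut-off negative of the candidate flux. Since r^{N-1}
  \<open>b0\<close> has derivative r^{N-1} \<open>hr\<close>, its divergence N \<psi> + r \<psi>' is
  2 r R1 b0 + R hr: the candidate flux satisfies the equation, up to the derivative of the
  cutoff.\<close>

lemma field_identity:
  defines "\<psi> \<equiv> \<lambda>r. R (r\<^sup>2) * b0 r / r"
  defines "\<psi>' \<equiv> \<lambda>r. (2 * r * R1 (r\<^sup>2) * b0 r + R (r\<^sup>2) * hr r - N * (R (r\<^sup>2) * b0 r / r)) / r"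
  shows "integrable lborel (\<lambda>x. \<psi> (norm x) * (g x \<bullet> x))"
    "integrable lborel (\<lambda>x. u x * (N * \<psi> (norm x) + norm x * \<psi>' (norm x)))"
    "(\<integral>x. \<psi> (norm x) * (g x \<bullet> x) \<partial>lborel) =
       - (\<integral>x. u x * (N * \<psi> (norm x) + norm x * \<psi>' (norm x)) \<partial>lborel)"
proof -
  have [measurable]: "\<psi> \<in> borel_measurable borel" "\<psi>' \<in> borel_measurable borel"
    unfolding \<psi>_def \<psi>'_def by measurable
  have d: "(\<psi> has_real_derivative \<psi>' r) (at r)" if r: "r > 0" for r
  proof -
    \<comment> \<open>Equal to \<open>r * pd r\<close> for r > 0, but written as a pure power so
      that the quotient rule applies to \<psi> = R \<open>ball_int h\<close> / E.\<close>
    define E where "E r = pd 1 * r powr N" for r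
    have Er: "E r = r * pd r" if "r > 0" for r using that pd_eq[OF that] by (simp add: E_def powr_diff)
    have 1: "((\<lambda>r. R (r\<^sup>2)) has_real_derivative R1 (r\<^sup>2) * (2 * r)) (at r)"
      by (rule DERIV_chain2[OF R_deriv]) (auto intro!: derivative_eq_intros)
    have 2: "(E has_real_derivative pd 1 * (N * r powr N * 1 / r)) (at r)"
      unfolding E_def[abs_def] by (rule DERIV_cmult[OF DERIV_powr_const[OF DERIV_ident r]])
    have E0: "E r \<noteq> 0" "pd r > 0" using Er[OF r] pd_pos[OF r] r by auto
    have "((\<lambda>r. R (r\<^sup>2) * ball_int h r / E r) has_real_derivative
       ((R1 (r\<^sup>2) * (2 * r) * ball_int h r + pd r * hr r * R (r\<^sup>2)) * E r - R (r\<^sup>2) * ball_int h r * (pd 1 * (N * r powr N * 1 / r))) / (E r * E r)) (at r)"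
      by (rule DERIV_divide[OF DERIV_mult[OF 1 ball_int_h_deriv[OF r]] 2 E0(1)])
    moreover have "((R1 (r\<^sup>2) * (2 * r) * ball_int h r + pd r * hr r * R (r\<^sup>2)) * E r - R (r\<^sup>2) * ball_int h r * (pd 1 * (N * r powr N * 1 / r))) / (E r * E r) = \<psi>' r"
    proof -
      have e1: "pd 1 * (N * r powr N * 1 / r) = N * pd r" using Er[OF r] r by (simp add: E_def field_simps)
      have e2: "ball_int h r = b0 r * pd r" using E0 by (simp add: b0_def)
      show ?thesis unfolding \<psi>'_def e1 e2 Er[OF r] using E0(2) r by (simp add: field_simps)
    qed
    ultimately have "((\<lambda>r. R (r\<^sup>2) * ball_int h r / E r) has_real_derivative \<psi>' r) (at r)" by simp
    then show ?thesis
      by (rule has_field_derivative_transform_within_open[of _ _ _ "{0<..}"])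
        (use r in \<open>auto simp: \<psi>_def Er b0_def mult.commute\<close>)
  qed
  have out: "\<psi> r = 0" "\<psi>' r = 0" if "\<not> (a < r\<^sup>2 \<and> r\<^sup>2 < c)" for r
    using R_outside[OF that] by (auto simp: \<psi>_def \<psi>'_def)
  have "continuous_on {0<..} \<psi>'"
    unfolding \<psi>'_def
    by (intro continuous_intros b0_cont hr_cont continuous_on_compose2[OF R_cont(1)[of UNIV]] continuous_on_compose2[OF R_cont(2)[of UNIV]]) auto
  from bounded_on_annulus[OF this ac(1), of c]
  obtain L where L: "L \<ge> 0" "\<And>r. r > 0 \<Longrightarrow> a \<le> r\<^sup>2 \<Longrightarrow> r\<^sup>2 \<le> c \<Longrightarrow> \<bar>\<psi>' r\<bar> \<le> L" by blast
  have L': "\<bar>\<psi>' r\<bar> \<le> L" if "r > 0" for r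
    using L out(2)[of r] that by (cases "a < r\<^sup>2 \<and> r\<^sup>2 < c") auto
  have lip0: "\<bar>\<psi> r - \<psi> s\<bar> \<le> L * (r - s)" if "0 < s" "s \<le> r" for r s
  proof (cases "s = r")
    case False
    then have "s < r" using that by simp
    then have "\<exists>z>s. z < r \<and> \<psi> r - \<psi> s = (r - s) * \<psi>' z" by (rule MVT2) (use d that in auto)
    then obtain z where z: "s < z" "z < r" "\<psi> r - \<psi> s = (r - s) * \<psi>' z" by blast
    have "\<bar>\<psi> r - \<psi> s\<bar> = (r - s) * \<bar>\<psi>' z\<bar>" using z that by (simp add: abs_mult)
    also have "\<dots> \<le> (r - s) * L" using L'[of z] z that by (intro mult_left_mono) auto
    finally show ?thesis by (simp add: mult.commute)
  qed simp
  \<comment> \<open>The mean value theorem gives the bound for positive radii only; for s = 0 the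
    radius \<open>sqrt a\<close>, up to which \<psi> vanishes, takes the place of s.\<close>
  have lip1: "\<bar>\<psi> r - \<psi> s\<bar> \<le> L * (r - s)" if sr: "0 \<le> s" "s \<le> r" for r s
  proof (cases "s = 0")
    case True
    show ?thesis
    proof (cases "r \<le> sqrt a")
      case True
      then have "r\<^sup>2 \<le> (sqrt a)\<^sup>2" using sr by (intro power_mono) auto
      then have "\<psi> r = 0" using ac by (intro out) simp
      moreover have "\<psi> s = 0" using \<open>s = 0\<close> by (simp add: \<psi>_def)
      ultimately show ?thesis using L sr by simp
    next
      case False
      have z: "\<psi> s = 0" "\<psi> (sqrt a) = 0" using True ac by (auto simp: \<psi>_def intro!: R_outside)
      have "\<bar>\<psi> r - \<psi> (sqrt a)\<bar> \<le> L * (r - sqrt a)" using False ac by (intro lip0) auto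
      also have "\<dots> \<le> L * (r - s)" using L True ac by (intro mult_left_mono) auto
      finally show ?thesis using z by simp
    qed
  qed (use lip0[of s r] sr in auto)
  have lip: "\<bar>\<psi> r - \<psi> s\<bar> \<le> L * \<bar>r - s\<bar>" if "0 \<le> r" "0 \<le> s" for r s
    using lip1[of s r] lip1[of r s] that by (cases "s \<le> r") (auto simp: abs_minus_commute)
  have supp: "\<psi> r = 0" if "r > sqrt c" for r
  proof (rule out(1))
    have "(sqrt c)\<^sup>2 \<le> r\<^sup>2" using that ac by (intro power_mono) auto
    then show "\<not> (a < r\<^sup>2 \<and> r\<^sup>2 < c)" using ac by simp
  qed
  have sc: "sqrt c \<ge> 0" using ac by simp
  note F = D1p_radial_field[OF D1p p lip sc supp, of "{}" \<psi>']
  show "integrable lborel (\<lambda>x. \<psi> (norm x) * (g x \<bullet> x))"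
    "integrable lborel (\<lambda>x. u x * (N * \<psi> (norm x) + norm x * \<psi>' (norm x)))"
    "(\<integral>x. \<psi> (norm x) * (g x \<bullet> x) \<partial>lborel) =
       - (\<integral>x. u x * (N * \<psi> (norm x) + norm x * \<psi>' (norm x)) \<partial>lborel)"
    using F d by (auto simp: N_def)
qed

text \<open>Extends the vanishing over balls to bounded radial weights on the annulus. Such a weight
  may contain \<open>V\<close>, and thus \<open>u\<close> itself, as well as \<beta>.\<close>

lemma flux_radial_annulus:
  assumes [measurable]: "F \<in> borel_measurable borel"
    and B: "\<And>r. r > 0 \<Longrightarrow> \<bar>F r\<bar> \<le> B" and out: "\<And>r. \<not> (a < r\<^sup>2 \<and> r\<^sup>2 < c) \<Longrightarrow> F r = 0"
  shows "integrable lborel (\<lambda>x. F (norm x) * (flux x x + norm x * b0 (norm x)))"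
    "(\<integral>x. F (norm x) * (flux x x + norm x * b0 (norm x)) \<partial>lborel) = 0"
proof -
  have sc: "sqrt c + 1 > 0" using ac by (simp add: add_nonneg_pos)
  show "integrable lborel (\<lambda>x. F (norm x) * (flux x x + norm x * b0 (norm x)))"
  proof (rule Bochner_Integration.integrable_bound[OF integrable_mult_right[OF flux_layer(1)[OF sc], of B]])
    show "AE x in lborel. norm (F (norm x) * (flux x x + norm x * b0 (norm x))) \<le>
       norm (B * (indicator (ball 0 (sqrt c + 1)) x * (flux x x + norm x * b0 (norm x))))"
      using AE_nonzero
    proof eventually_elim
      case (elim x)
      show ?case
      proof (cases "a < (norm x)\<^sup>2 \<and> (norm x)\<^sup>2 < c")
        case True
        then have "norm x \<le> sqrt c" by (intro real_le_rsqrt) simp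
        then have "x \<in> ball 0 (sqrt c + 1)" by simp
        moreover have "\<bar>F (norm x)\<bar> \<le> \<bar>B\<bar>" using B[of "norm x"] elim by simp
        ultimately show ?thesis by (simp add: abs_mult mult_right_mono)
      qed (simp add: out)
    qed
  qed measurable
  then show "(\<integral>x. F (norm x) * (flux x x + norm x * b0 (norm x)) \<partial>lborel) = 0"
    by (rule flux_radial_zero[OF assms(1)])
qed

text \<open>Adding the energy identity and the field identity cancels the source terms \<rho> h u;
  what remains from the derivative of the cutoff is a radial weight \<open>F2\<close> times flux.x +
  |x| b0 and has integral zero, because u = V(|x|). The two remaining terms of the monotonicity
  product form the weight \<open>F3\<close> times the same expression. So \<rho> times the product
  has integral zero, and being nonnegative it vanishes almost everywhere.\<close>

lemma gradient_on_annulus: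
  "AE x in lborel. a < (norm x)\<^sup>2 \<and> (norm x)\<^sup>2 < c \<longrightarrow> g x = - (\<beta> (norm x) / norm x) *\<^sub>R x"
proof -
  define \<psi> where "\<psi> = (\<lambda>r. R (r\<^sup>2) * b0 r / r)"
  define \<psi>' where "\<psi>' = (\<lambda>r. (2 * r * R1 (r\<^sup>2) * b0 r + R (r\<^sup>2) * hr r - N * (R (r\<^sup>2) * b0 r / r)) / r)"
  define K where "K x = flux x x + norm x * b0 (norm x)" for x
  have FI: "integrable lborel (\<lambda>x. \<psi> (norm x) * (g x \<bullet> x))"
    "integrable lborel (\<lambda>x. u x * (N * \<psi> (norm x) + norm x * \<psi>' (norm x)))"
    "(\<integral>x. \<psi> (norm x) * (g x \<bullet> x) \<partial>lborel) = - (\<integral>x. u x * (N * \<psi> (norm x) + norm x * \<psi>' (norm x)) \<partial>lborel)"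
    unfolding \<psi>_def \<psi>'_def by (rule field_identity)+
  have [measurable]: "\<psi> \<in> borel_measurable borel" "\<psi>' \<in> borel_measurable borel"
    "\<rho> \<in> borel_measurable borel" "K \<in> borel_measurable borel"
    unfolding \<psi>_def \<psi>'_def \<rho>_def[abs_def] K_def[abs_def] by measurable
  define F2 where "F2 r = V r * (2 * R1 (r\<^sup>2))" for r
  define F3 where "F3 r = R (r\<^sup>2) * (\<beta> r / r)" for r
  have [measurable]: "F2 \<in> borel_measurable borel" "F3 \<in> borel_measurable borel"
    unfolding F2_def[abs_def] F3_def[abs_def] by measurable
  have c2: "continuous_on {0<..} F2" unfolding F2_def
    by (intro continuous_intros V_cont continuous_on_compose2[OF R_cont(2)[of UNIV]]) auto
  have c3: "continuous_on {0<..} F3" unfolding F3_def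
    by (intro continuous_intros \<beta>_cont continuous_on_compose2[OF R_cont(1)[of UNIV]]) auto
  have o2: "F2 r = 0" "F3 r = 0" if "\<not> (a < r\<^sup>2 \<and> r\<^sup>2 < c)" for r
    using R_outside[OF that] by (auto simp: F2_def F3_def)
  obtain A2 where A2: "A2 \<ge> 0" "\<And>r. r > 0 \<Longrightarrow> a \<le> r\<^sup>2 \<Longrightarrow> r\<^sup>2 \<le> c \<Longrightarrow> \<bar>F2 r\<bar> \<le> A2"
    using bounded_on_annulus[OF c2 ac(1), of c] by blast
  obtain A3 where A3: "A3 \<ge> 0" "\<And>r. r > 0 \<Longrightarrow> a \<le> r\<^sup>2 \<Longrightarrow> r\<^sup>2 \<le> c \<Longrightarrow> \<bar>F3 r\<bar> \<le> A3"
    using bounded_on_annulus[OF c3 ac(1), of c] by blast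
  have b2: "\<bar>F2 r\<bar> \<le> A2" if "r > 0" for r using A2 o2(1)[of r] that by (cases "a < r\<^sup>2 \<and> r\<^sup>2 < c") auto
  have b3: "\<bar>F3 r\<bar> \<le> A3" if "r > 0" for r using A3 o2(2)[of r] that by (cases "a < r\<^sup>2 \<and> r\<^sup>2 < c") auto
  note R2 = flux_radial_annulus[of F2, OF _ b2 o2(1), folded K_def]
  note R3 = flux_radial_annulus[of F3, OF _ b3 o2(2), folded K_def]
  have i2: "integrable lborel (\<lambda>x. F2 (norm x) * K x)" "(\<integral>x. F2 (norm x) * K x \<partial>lborel) = 0" using R2 by auto
  have i3: "integrable lborel (\<lambda>x. F3 (norm x) * K x)" "(\<integral>x. F3 (norm x) * K x \<partial>lborel) = 0" using R3 by auto
  note E = energy_identity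
  have iz: "integrable lborel (\<lambda>x. h x * (\<rho> x * u x) - u x * (2 * R1 ((norm x)\<^sup>2) * flux x x))"
    by (intro Bochner_Integration.integrable_diff E)
  have "(\<integral>x. (h x * (\<rho> x * u x) - u x * (2 * R1 ((norm x)\<^sup>2) * flux x x)) - u x * (N * \<psi> (norm x) + norm x * \<psi>' (norm x)) + F2 (norm x) * K x \<partial>lborel) = (\<integral>x. 0 \<partial>(lborel :: 'a measure))"
  proof (rule integral_cong_AE)
    show "AE x in lborel. (h x * (\<rho> x * u x) - u x * (2 * R1 ((norm x)\<^sup>2) * flux x x)) - u x * (N * \<psi> (norm x) + norm x * \<psi>' (norm x)) + F2 (norm x) * K x = 0"
      using h_eq_hr u_eq_V AE_nonzero
    proof eventually_elim
      case (elim x)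
      have "N * \<psi> (norm x) + norm x * \<psi>' (norm x) = 2 * norm x * R1 ((norm x)\<^sup>2) * b0 (norm x) + R ((norm x)\<^sup>2) * hr (norm x)"
        using elim(3) by (simp add: \<psi>_def \<psi>'_def)
      then show ?case using elim(1,2) by (simp add: \<rho>_def F2_def K_def algebra_simps)
    qed
  qed measurable
  then have z: "(\<integral>x. h x * (\<rho> x * u x) \<partial>lborel) - (\<integral>x. u x * (2 * R1 ((norm x)\<^sup>2) * flux x x) \<partial>lborel)
     - (\<integral>x. u x * (N * \<psi> (norm x) + norm x * \<psi>' (norm x)) \<partial>lborel) = 0"
    using i2(2) by (simp add: Bochner_Integration.integral_add[OF Bochner_Integration.integrable_diff[OF iz FI(2)] i2(1)]
        Bochner_Integration.integral_diff[OF iz FI(2)] Bochner_Integration.integral_diff[OF E(3) E(2)])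
  define J where "J x = \<rho> x * flux x (g x) + \<psi> (norm x) * (g x \<bullet> x) + F3 (norm x) * K x" for x
  have Ji: "integrable lborel J" unfolding J_def by (intro Bochner_Integration.integrable_add E FI i3)
  have J0: "(\<integral>x. J x \<partial>lborel) = 0"
    unfolding J_def
    using z E(4) FI(3) i3(2)
    by (simp add: Bochner_Integration.integral_add[OF Bochner_Integration.integrable_add[OF E(1) FI(1)] i3(1)]
        Bochner_Integration.integral_add[OF E(1) FI(1)])
  have Je: "J x = \<rho> x * (norm (g x) powr (p - 2) * (g x \<bullet> g x) + b0 (norm x) / norm x * (g x \<bullet> x) +
      \<beta> (norm x) / norm x * (norm (g x) powr (p - 2) * (g x \<bullet> x)) + \<beta> (norm x) * b0 (norm x))" if "x \<noteq> 0" for x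
    using that by (simp add: J_def \<rho>_def \<psi>_def F3_def K_def flux_def algebra_simps)
  note mono = p_laplace_strict_monotone[OF p(1) b0_nonneg, folded \<beta>_def]
  have "AE x in lborel. 0 \<le> J x"
    using AE_nonzero
  proof eventually_elim
    case (elim x)
    show ?case unfolding Je[OF elim] using mono(1)[OF elim] R_bounds(1) by (auto simp: \<rho>_def intro!: mult_nonneg_nonneg)
  qed
  then have "AE x in lborel. J x = 0" using J0 by (subst (asm) integral_nonneg_eq_0_iff_AE[OF Ji]) auto
  then show ?thesis using AE_nonzero
  proof eventually_elim
    case (elim x)
    show ?case
    proof
      assume an: "a < (norm x)\<^sup>2 \<and> (norm x)\<^sup>2 < c"
      then have "\<rho> x > 0" by (simp add: \<rho>_def R_pos)
      then have "norm (g x) powr (p - 2) * (g x \<bullet> g x) + b0 (norm x) / norm x * (g x \<bullet> x) +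
        \<beta> (norm x) / norm x * (norm (g x) powr (p - 2) * (g x \<bullet> x)) + \<beta> (norm x) * b0 (norm x) = 0"
        using elim Je by simp
      then show "g x = - (\<beta> (norm x) / norm x) *\<^sub>R x" by (rule mono(2)[OF elim(2)])
    qed
  qed
qed

end

section \<open>The radial system and the behaviour at the origin\<close>

lemma gradient_radial: "AE x in lborel. g x = - (\<beta> (norm x) / norm x) *\<^sub>R x"
proof -
  \<comment> \<open>The shifts by 1 and 2 make every annulus nonempty with positive inner radius,
    already for n = 0.\<close>
  have "AE x in lborel. \<forall>n. 1 / real (n + 1) < (norm x)\<^sup>2 \<and> (norm x)\<^sup>2 < real (n + 2) \<longrightarrow> g x = - (\<beta> (norm x) / norm x) *\<^sub>R x"
    unfolding AE_all_countable
  proof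
    fix n :: nat
    have "1 / real (n + 1) \<le> 1" by simp
    then have "1 / real (n + 1) < real (n + 2)" by (rule order.strict_trans1) simp
    then show "AE x in lborel. 1 / real (n + 1) < (norm x)\<^sup>2 \<and> (norm x)\<^sup>2 < real (n + 2) \<longrightarrow> g x = - (\<beta> (norm x) / norm x) *\<^sub>R x"
      by (intro gradient_on_annulus) auto
  qed
  then show ?thesis using AE_nonzero
  proof eventually_elim
    case (elim x)
    obtain n1 where n1: "(norm x)\<^sup>2 < real n1" using reals_Archimedean2 by blast
    obtain n2 where n2: "1 / (norm x)\<^sup>2 < real n2" using reals_Archimedean2 by blast
    define n where "n = max n1 n2"
    have "(norm x)\<^sup>2 < real (n + 2)" using n1 by (simp add: n_def)
    moreover have "1 / (norm x)\<^sup>2 < real (n + 1)" using n2 by (simp add: n_def)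
    then have "1 / real (n + 1) < (norm x)\<^sup>2" using elim by (simp add: field_simps)
    ultimately show ?case using elim(1) by blast
  qed
qed

text \<open>The formula for \<open>g\<close> makes \<open>f\<close> radial with the continuous
  profile -\<beta> r + N V, so the ball integral of \<open>f\<close> is differentiable and with it
  V. In V' = (-\<beta> r + N V)/r - N V/r the terms with N cancel.\<close>

lemma V_deriv:
  assumes r: "r > 0"
  shows "(V has_real_derivative - \<beta> r) (at r)"
proof -
  define F where "F r = - \<beta> r * r + N * V r" for r
  have [measurable]: "F \<in> borel_measurable borel" unfolding F_def[abs_def] by measurable
  have "AE x in lborel. f x = F (norm x)"
    using gradient_radial u_eq_V AE_nonzero
  proof eventually_elim
    case (elim x)
    have "g x \<bullet> x = - (\<beta> (norm x) / norm x) * (x \<bullet> x)" by (subst elim(1)) simp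
    also have "\<dots> = - \<beta> (norm x) * norm x" using elim(3) by (simp add: power2_norm_eq_inner[symmetric] power2_eq_square)
    finally show ?case using elim(2) by (simp add: f_def F_def)
  qed
  moreover have "continuous_on {0<..} F" unfolding F_def by (intro continuous_intros \<beta>_cont V_cont)
  ultimately have dI: "(ball_int f has_real_derivative pd r * F r) (at r)"
    unfolding pd_def by (intro ball_int_derivative[OF _ f_ball_integrable] r) auto
  define E where "E r = pd 1 * r powr N" for r
  have Er: "E r = r * pd r" if "r > 0" for r using that pd_eq[OF that] by (simp add: E_def powr_diff)
  have 2: "(E has_real_derivative pd 1 * (N * r powr N * 1 / r)) (at r)"
    unfolding E_def[abs_def] by (rule DERIV_cmult[OF DERIV_powr_const[OF DERIV_ident r]])
  have E0: "E r \<noteq> 0" "pd r > 0" using Er[OF r] pd_pos[OF r] r by auto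
  have "((\<lambda>r. ball_int f r / E r) has_real_derivative (pd r * F r * E r - ball_int f r * (pd 1 * (N * r powr N * 1 / r))) / (E r * E r)) (at r)"
    by (rule DERIV_divide[OF dI 2 E0(1)])
  moreover have "(pd r * F r * E r - ball_int f r * (pd 1 * (N * r powr N * 1 / r))) / (E r * E r) = - \<beta> r"
  proof -
    have e1: "pd 1 * (N * r powr N * 1 / r) = N * pd r" using Er[OF r] r by (simp add: E_def field_simps)
    have e2: "ball_int f r = V r * (r * pd r)" using E0 r by (simp add: V_def)
    show ?thesis unfolding e1 e2 Er[OF r] F_def using E0(2) r by (simp add: field_simps)
  qed
  ultimately have "((\<lambda>r. ball_int f r / E r) has_real_derivative - \<beta> r) (at r)" by simp
  then show ?thesis
    by (rule has_field_derivative_transform_within_open[of _ _ _ "{0<..}"]) (use r in \<open>auto simp: V_def Er\<close>)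
qed

lemma ball_int_h_pos:
  assumes r: "r > 0"
  shows "ball_int h r > 0"
proof (rule ccontr)
  assume "\<not> ball_int h r > 0"
  moreover have "ball_int h r \<ge> 0" unfolding ball_int_def by (intro integral_nonneg_AE AE_I2) (simp add: h_nonneg)
  ultimately have "(\<integral>x. indicator (ball 0 r) x * h x \<partial>lborel) = 0" by (simp add: ball_int_def)
  then have "AE x in lborel. indicator (ball 0 r) x * h x = 0"
    by (subst (asm) integral_nonneg_eq_0_iff_AE[OF h_ball_integrable]) (auto simp: h_nonneg)
  then have "AE x in lborel. x \<notin> ball (0::'a) r"
    using positive AE_nonzero by eventually_elim (auto simp: h_def split: split_indicator_asm)
  from AE_open_not_empty[OF open_ball this] show False using r by (simp add: ball_eq_empty)
qed

lemma b0_pos: "r > 0 \<Longrightarrow> b0 r > 0"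
  by (simp add: b0_def ball_int_h_pos pd_pos)

lemma V_decreasing:
  assumes "0 < r" "r < s"
  shows "V s < V r"
proof (rule DERIV_neg_imp_decreasing[OF assms(2)])
  fix x assume "r \<le> x" "x \<le> s"
  then have "x > 0" using assms by simp
  moreover have "- \<beta> x < 0" using b0_pos[OF \<open>x > 0\<close>] by (simp add: \<beta>_def)
  ultimately show "\<exists>y. (V has_real_derivative y) (at x) \<and> y < 0" using V_deriv by blast
qed

lemma V_pos: "r > 0 \<Longrightarrow> V r > 0"
  using V_decreasing[of r "r + 1"] V_nonneg[of "r + 1"] by simp

text \<open>Since V decreases, V(r)^s times the volume of the ball of radius r, s the Sobolev
  exponent, is at most the integral of |u|^s over that ball, which tends to 0 with r. As \<gamma> s
  = N, this is a statement about r^\<gamma> V(r).\<close>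

lemma V_decay: "((\<lambda>r. r powr ((N - p) / p) * V r) \<longlongrightarrow> 0) (at_right 0)"
proof -
  define s where "s = sob_exp TYPE('a) p"
  define \<gamma> where "\<gamma> = (N - p) / p"
  define \<omega> where "\<omega> = unit_ball_vol N"
  have s: "s > 0" using sob_exp_ge[OF p] p by (simp add: s_def)
  have \<omega>: "\<omega> > 0" by (simp add: \<omega>_def N_def)
  have gs: "\<gamma> * s = N" using p by (simp add: \<gamma>_def s_def sob_exp_def N_def)
  define U where "U x = \<bar>u x\<bar> powr s" for x
  have [measurable]: "U \<in> borel_measurable borel" unfolding U_def[abs_def] by measurable
  have Ui: "integrable lborel U"
    using D1p_Lsob[OF D1p p] unfolding U_def[abs_def] s_def by (intro integrableI_bounded) auto
  have Ub: "integrable lborel (\<lambda>x. indicator (ball 0 b) x * U x)" for b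
    by (rule Bochner_Integration.integrable_bound[OF Ui], measurable) (auto split: split_indicator)
  have lim: "(ball_int U \<longlongrightarrow> 0) (at_right 0)" by (rule ball_int_tendsto_0) (use Ub in auto)
  have le: "(r powr \<gamma> * V r) powr s \<le> ball_int U r / \<omega>" if r: "r > 0" for r
  proof -
    have "(\<integral>x. indicator (ball (0::'a) r) x * V r powr s \<partial>lborel) \<le> ball_int U r"
      unfolding ball_int_def
    proof (rule integral_mono_AE)
      show "integrable lborel (\<lambda>x. indicator (ball (0::'a) r) x * V r powr s)"
        by (intro integrable_mult_left integrable_real_indicator) (auto simp: emeasure_bounded_finite[unfolded infinity_ennreal_def])
      show "AE x in lborel. indicator (ball (0::'a) r) x * V r powr s \<le> indicator (ball 0 r) x * U x"
        using u_eq_V AE_nonzero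
      proof eventually_elim
        case (elim x)
        show ?case
        proof (cases "norm x < r")
          case True
          have "V r \<le> V (norm x)" using V_decreasing[of "norm x" r] True elim by simp
          then have "V r powr s \<le> U x" unfolding U_def elim(1) using V_pos[OF r] s by (intro powr_mono2) auto
          then show ?thesis using True by simp
        qed simp
      qed
    qed (rule Ub)
    moreover have "(\<integral>x. indicator (ball (0::'a) r) x * V r powr s \<partial>lborel) = \<omega> * r powr N * V r powr s"
      using r by (simp add: content_ball \<omega>_def N_def powr_realpow)
    moreover have "(r powr \<gamma> * V r) powr s = r powr N * V r powr s"
      using r V_pos[OF r] by (simp add: powr_mult powr_powr gs)
    ultimately have "\<omega> * (r powr \<gamma> * V r) powr s \<le> ball_int U r" by (simp only: mult.assoc)
    then show ?thesis using \<omega> by (simp add: pos_le_divide_eq mult.commute)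
  qed
  have "((\<lambda>r. (r powr \<gamma> * V r) powr s) \<longlongrightarrow> 0) (at_right 0)"
  proof (rule tendsto_sandwich[of "\<lambda>r. 0" _ _ "\<lambda>r. ball_int U r / \<omega>"])
    have "((\<lambda>r. ball_int U r / \<omega>) \<longlongrightarrow> 0 / \<omega>) (at_right 0)" by (intro tendsto_intros lim) (use \<omega> in auto)
    then show "((\<lambda>r. ball_int U r / \<omega>) \<longlongrightarrow> 0) (at_right 0)" by simp
    show "\<forall>\<^sub>F r in at_right 0. (r powr \<gamma> * V r) powr s \<le> ball_int U r / \<omega>"
      using le by (auto simp: eventually_at_right_field intro!: exI[of _ 1])
  qed auto
  then have "((\<lambda>r. ((r powr \<gamma> * V r) powr s) powr (1 / s)) \<longlongrightarrow> 0) (at_right 0)"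
    by (rule tendsto_zero_powrI[OF _ tendsto_const]) (use s in auto)
  moreover have "\<forall>\<^sub>F r in at_right 0. ((r powr \<gamma> * V r) powr s) powr (1 / s) = r powr \<gamma> * V r"
    unfolding eventually_at_right_field
  proof (intro exI[of _ 1] conjI allI impI)
    fix r :: real assume "0 < r"
    then have "r powr \<gamma> * V r > 0" using V_pos by simp
    then show "((r powr \<gamma> * V r) powr s) powr (1 / s) = r powr \<gamma> * V r" using s by (simp add: powr_powr)
  qed simp
  ultimately show ?thesis unfolding \<gamma>_def by (rule Lim_transform_eventually)
qed

lemma is_bubble: "\<exists>l>0. AE x in lborel. u x = U_fun p \<alpha> l x"
proof -
  \<comment> \<open>Division by the area of the unit sphere turns m r^{1-N} into \<open>b0\<close>
    and removes the constant from both equations of the system.\<close>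
  define m where "m r = ball_int h r / pd 1" for r
  have pd1: "pd 1 > 0" by (rule pd_pos) simp
  have qe: "q = p * (N + \<alpha>) / (N - p)" by (simp add: q_def crit_exp_def N_def)
  have mb: "m r * r powr (1 - N) = b0 r" if "r > 0" for r
    using that pd1 by (simp add: m_def b0_def pd_eq[OF that] powr_diff)
  have "\<exists>A>0. \<exists>B>0. (\<forall>r>0. V r = (A + B * r powr ((p + \<alpha>) / (p - 1))) powr (- ((N - p) / (p + \<alpha>))))
           \<and> (N + \<alpha>) * ((N - p) / (p - 1)) powr (p - 1) * A * B powr (p - 1) = 1"
  proof (rule critical_ode[where m = m])
    show "1 < p" "p < N" "0 < \<alpha>" using p \<alpha> by (auto simp: N_def)
    show "V r > 0" "m r > 0" if "r > 0" for r using that V_pos ball_int_h_pos pd1 by (auto simp: m_def)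
    show "(V has_real_derivative - ((m r * r powr (1 - N)) powr (1 / (p - 1)))) (at r)" if "r > 0" for r
      using V_deriv[OF that] by (simp add: mb[OF that] \<beta>_def)
    show "(m has_real_derivative r powr (N - 1 + \<alpha>) * V r powr (p * (N + \<alpha>) / (N - p) - 1)) (at r)" if r: "r > 0" for r
    proof -
      have "(m has_real_derivative pd r * hr r / pd 1) (at r)"
        unfolding m_def[abs_def] by (rule DERIV_cdivide[OF ball_int_h_deriv[OF r]])
      moreover have "pd r * hr r / pd 1 = r powr (N - 1 + \<alpha>) * V r powr (p * (N + \<alpha>) / (N - p) - 1)"
        using pd1 by (simp add: pd_eq[OF r] hr_def qe powr_add)
      ultimately show ?thesis by simp
    qed
    show "((\<lambda>r. r powr ((N - p) / p) * V r) \<longlongrightarrow> 0) (at_right 0)" by (rule V_decay)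
    have "(ball_int h \<longlongrightarrow> 0) (at_right 0)" by (rule ball_int_tendsto_0) (use h_ball_integrable in auto)
    then have "((\<lambda>r. ball_int h r / pd 1) \<longlongrightarrow> 0 / pd 1) (at_right 0)" by (intro tendsto_intros) (use pd1 in auto)
    then show "(m \<longlongrightarrow> 0) (at_right 0)" by (simp add: m_def[abs_def])
  qed
  then obtain A B where AB: "A > 0" "B > 0"
    and VAB: "\<And>r. r > 0 \<Longrightarrow> V r = (A + B * r powr ((p + \<alpha>) / (p - 1))) powr (- ((N - p) / (p + \<alpha>)))"
    and rel: "(N + \<alpha>) * ((N - p) / (p - 1)) powr (p - 1) * A * B powr (p - 1) = 1" by blast
  define l where "l = (B / A) powr ((p - 1) / (p + \<alpha>))"
  have "l > 0" using AB by (simp add: l_def)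
  moreover have "AE x in lborel. u x = U_fun p \<alpha> l x"
    using u_eq_V AE_nonzero
  proof eventually_elim
    case (elim x)
    have "p < N" using p by (simp add: N_def)
    from bubble_parameters[OF p(1) this \<alpha> AB rel, of "norm x"] show ?case
      using elim VAB[of "norm x"] by (simp add: U_fun_def N_def l_def)
  qed
  ultimately show ?thesis by blast
qed

end

section \<open>The classification\<close>

lemma U_fun_pos:
  assumes "1 < p" "p < real DIM('a::euclidean_space)" "\<alpha> > 0" "l > 0"
  shows "U_fun p \<alpha> l (x::'a) > 0"
proof -
  have "0 < 1 + l powr ((p + \<alpha>) / (p - 1)) * norm x powr ((p + \<alpha>) / (p - 1))"
    by (intro add_pos_nonneg) auto
  then show ?thesis using assms by (simp add: U_fun_def C_const_def)
qed

lemma U_fun_radial: "radial (U_fun p \<alpha> l)"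
  unfolding radial_def U_fun_def
  by (rule exI[of _ "\<lambda>r. C_const (real DIM('a)) p \<alpha> * l powr ((real DIM('a) - p) / p) /
     (1 + l powr ((p + \<alpha>) / (p - 1)) * r powr ((p + \<alpha>) / (p - 1))) powr ((real DIM('a) - p) / (p + \<alpha>))"]) simp

text \<open>The functions \<open>U_fun p \<alpha> l\<close> with l > 0 are precisely the scalings of
  the one with l = 1, so the second half is uniqueness up to scaling. Solutions are functions modulo
  null sets, hence the equality almost everywhere.\<close>

theorem theorem1p1:
  fixes p \<alpha> :: real
  assumes "DIM('a::euclidean_space) \<ge> 2" and "1 < p" and "p < real DIM('a)" and "\<alpha> > 0"
  shows "(\<forall>l>0. weak_solution p \<alpha> (U_fun p \<alpha> l :: 'a \<Rightarrow> real) \<and> radial (U_fun p \<alpha> l :: 'a \<Rightarrow> real)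
              \<and> (\<forall>x::'a. U_fun p \<alpha> l x > 0))
       \<and> (\<forall>u :: 'a \<Rightarrow> real. weak_solution p \<alpha> u \<and> radial u \<and> (AE x in lborel. u x > 0)
              \<and> \<not> (AE x in lborel. u x = 0)
            \<longrightarrow> (\<exists>l>0. AE x in lborel. u x = U_fun p \<alpha> l x))"
proof (intro conjI allI impI)
  fix l :: real assume "l > 0"
  then show "weak_solution p \<alpha> (U_fun p \<alpha> l :: 'a \<Rightarrow> real)" using assms by (intro U_fun_weak_solution) auto
  show "radial (U_fun p \<alpha> l :: 'a \<Rightarrow> real)" by (rule U_fun_radial)
  show "U_fun p \<alpha> l x > 0" for x :: 'a using assms \<open>l > 0\<close> by (intro U_fun_pos) auto
next
  fix u :: "'a \<Rightarrow> real"
  assume u: "weak_solution p \<alpha> u \<and> radial u \<and> (AE x in lborel. u x > 0) \<and> \<not> (AE x in lborel. u x = 0)"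
  then obtain g where g: "D1p_grad p u g" "\<And>\<phi>. test_fun \<phi> \<Longrightarrow>
        integrable lborel (\<lambda>x. norm (g x) powr (p - 2) * (g x \<bullet> grad \<phi> x)) \<and>
        integrable lborel (\<lambda>x. norm x powr \<alpha> * u x powr (crit_exp TYPE('a) p \<alpha> - 1) * \<phi> x) \<and>
        (\<integral>x. norm (g x) powr (p - 2) * (g x \<bullet> grad \<phi> x) \<partial>lborel) =
        (\<integral>x. norm x powr \<alpha> * u x powr (crit_exp TYPE('a) p \<alpha> - 1) * \<phi> x \<partial>lborel)"
    unfolding weak_solution_def by blast
  obtain v where v: "AE x in lborel. u x = v (norm x)" using u unfolding radial_def by blast
  interpret radial_solution p \<alpha> u g v
    by unfold_locales (use assms g v u in auto)
  show "\<exists>l>0. AE x in lborel. u x = U_fun p \<alpha> l x" by (rule is_bubble)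
qed

end
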